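(* Let $\mathcal X,\mathcal Y$, the functions $\bar i_k$ ($k=1,2,3$), the constants, and the constraint equations with their boundary conditions be as given in the context. For $(\boldsymbol c,\boldsymbol\varphi,I,c_0,\varphi_0)\in\mathcal X\times\mathcal Y\times\mathbb R^3$ (where $c_0$ stands for $c_1(0)$ and $\varphi_0$ for $\varphi_2(L_1)$), put $g_{k,j}(s)=\frac{\partial \bar i_k}{\partial\varphi_j}(\boldsymbol c,\boldsymbol\varphi)(s)$, $j=1,2$, and define the linear operator $D\boldsymbol{\mathcal O}(\boldsymbol c,\boldsymbol\varphi,I,c_0,\varphi_0)$ on $\mathcal Y\times\mathbb R$ by the operator matrix $$ \begin{bmatrix} k^{eff}+\sum_{k=1}^3a_k\int_0^x\!\int_0^y g_{k,1}(s)\,ds\,dy-x\int_0^L\sum_{k=1}^3a_kg_{k,1}(s)\,ds & \sum_{k=1}^3a_k\int_0^x\!\int_0^y g_{k,2}(s)\,ds\,dy-x\int_0^L\sum_{k=1}^3a_kg_{k,2}(s)\,ds & 0\\ -\sum_{k=1}^3a_k\int_0^x\!\int_0^y g_{k,1}(s)\,ds\,dy & \sigma^{eff}-\sum_{k=1}^3a_k\int_0^x\!\int_0^y g_{k,2}(s)\,ds\,dy & -\sigma^{eff}\\ \int_0^L\sum_{k=1}^3a_kg_{k,1}(s)\,ds & \int_0^L\sum_{k=1}^3a_kg_{k,2}(s)\,ds & 0 \end{bmatrix}, $$ where an entry in column $j\in\{1,2\}$ acts on the $j$-th component $h_j$ of $(h_1,h_2,h_3)\in\mathcal Y\times\mathbb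 R$ by inserting the factor $h_j(s)$ under the integral signs (the constants $k^{eff},\sigma^{eff}$ act by multiplication), and an entry in column 3 multiplies the scalar $h_3$. If $D\boldsymbol{\mathcal O}$ is nonsingular at a point $(\boldsymbol c^*,\boldsymbol\varphi^*,I^*,c_0^*,\varphi_0^* )\in\mathcal X\times\mathcal Y\times\mathbb R^3$, then the constraint equations have a unique solution such that the potential vector $\boldsymbol\varphi$ can be written as a Fréchet differentiable function of the state vector $\boldsymbol c$ and the input $I$ in a neighborhood of this point. In other words, in some neighborhood of $(\boldsymbol c^*,\boldsymbol\varphi^*,I^*,c_0^*,\varphi_0^* )$, $$\boldsymbol\varphi=\boldsymbol{\mathcal R}_{\boldsymbol\varphi}(\boldsymbol c,c_1(0),I),$$ where $\boldsymbol{\mathcal R}_{\boldsymbol\varphi}:\mathcal X\times\mathbb R^2\to\mathcal Y$ is a Fréchet differentiable function.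
   Context: Spaces. $0<L_1<L$ and $R_1,R_2,R_3>0$ are fixed. $[0,L_1]$ is the separator and $[L_1,L]$ the electrode. For $k=1,2,3$, $\mathcal X_k$ is the Hilbert space of measurable $z$ on $[L_1,L]\times[0,R_k]$ with inner product $\int_{L_1}^L\int_0^{R_k}r_k^2\,w\,z\,dr_k\,dx$. Set $\mathcal X=L^2(0,L)\times\mathcal X_1\times\mathcal X_2\times\mathcal X_3$ and $\mathcal Y=L^2(0,L)\times L^2(L_1,L)$. The state vector is $\boldsymbol c=(c_1,c_2,c_3,c_4)\in\mathcal X$ ($c_1$ electrolyte concentration; $c_{k+1}$ solid concentration in particle bin $k$). The potential vector is $\boldsymbol\varphi=(\varphi_1,\varphi_2)\in\mathcal Y$ (electrolyte and solid potentials). $I=I(t)\in\mathbb R$ is the input current. Constants. $a_k,k^{eff},\sigma^{eff},i_0,F,R,T,c_{ini},c_{max},a_0,b_0>0$, $t_+^0\in(0,1)$ and a small $\epsilon_0\in(0,1)$ are fixed. Reaction rate. Let $\mathrm{sat}_y(s)=\frac{1}{1+\exp(-a_0s)}$ and $\mathrm{sat}(s)=\frac{2b_0}{1+\exp(-a_0s)}-b_0$. Let $\delta(r-R_k)=\frac1{\epsilon_0R_k}$ for $r\in[R_k-\epsilon_0R_k,R_k]$ and $0$ for $r\in[0,R_k-\epsilon_0R_k)$. Put $\bar c_{k+1}(x)=\int_0^{R_k}\delta(r_k-R_k)c_{k+1}(x,r_k)\,dr_k$ and $\bar y_k=\mathrm{sat}_y(\bar c_{k+1}/c_{max})$. The function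 $U$ is either $U(y)=3.4510-0.009y+0.6687e^{-35y}-0.5e^{-210(1-y)}$ (charging) or $U(y)=3.4077-0.020269y+0.5e^{-200y}-0.9e^{-30(1-y)}$ (discharging). With $\bar\eta_k=\varphi_2-\varphi_1-U(\bar y_k)$, $$\bar i_k(\boldsymbol c,\boldsymbol\varphi)(x)=\begin{cases}2i_0\sinh\!\big(\mathrm{sat}\big(\tfrac{F\bar\eta_k(x)}{2RT}\big)\big), & x\in[L_1,L],\\ 0,& x\in[0,L_1).\end{cases}$$ $\partial\bar i_k/\partial\varphi_j$ denotes the pointwise partial derivative with respect to the value $\varphi_j(x)$. Constraint equations. They are $$0=\frac{\partial}{\partial x}\Big(k^{eff}\frac{\partial\varphi_1}{\partial x}\Big)+k^{eff}\frac{\partial}{\partial x}\Big(\frac{2RT(1-t_+^0)}{Fc_{ini}}\frac{\partial c_1}{\partial x}\Big)+\sum_{k=1}^3a_k\bar i_k(\boldsymbol c,\boldsymbol\varphi)\ \text{ on }(0,L),$$ $$0=\frac{\partial}{\partial x}\Big(\sigma^{eff}\frac{\partial\varphi_2}{\partial x}\Big)-\sum_{k=1}^3a_k\bar i_k(\boldsymbol c,\boldsymbol\varphi)\ \text{ on }(L_1,L),$$ with boundary conditions $\partial_xc_1(L)=0$, $\varphi_1(0)=0$, $\partial_x\varphi_1(L)=0$, $\partial_x\varphi_2(L_1)=0$, $-\sigma^{eff}\partial_x\varphi_2(L)=I$. For $\boldsymbol c\in\mathcal X$, $\boldsymbol\varphi\in\mathcal Y$ they are understood in the integrated form, with $c_1(0)$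 and $\varphi_2(L_1)$ treated as separate real variables: $$\varphi_1(x)=\frac{x}{k^{eff}}\int_0^L\sum_ka_k\bar i_k\,ds-\frac{2RT(1-t_+^0)}{Fc_{ini}}\big(c_1(x)-c_1(0)\big)-\frac1{k^{eff}}\int_0^x\!\int_0^y\sum_ka_k\bar i_k\,ds\,dy,$$ $$\varphi_2(x)=\varphi_2(L_1)+\frac1{\sigma^{eff}}\int_0^x\!\int_0^y\sum_ka_k\bar i_k\,ds\,dy,\qquad 0=I+\int_0^L\sum_ka_k\bar i_k\,ds .$$ The unknowns are $(\boldsymbol\varphi,\varphi_2(L_1))$; the data are $(\boldsymbol c,c_1(0),I)$.
   Formalization: The point (c*, φ*, I*, c0*, φ0* ) is additionally assumed to satisfy the constraint equations; without this the claim fails, e.g. for |I*| so large that 0 = I + ∫Σ a_k i_k has no solution, since the rates are bounded and DO does not depend on I. *)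

theory Defs
  imports "HOL-Analysis.Analysis"
begin

section \<open>Square integrable functions modulo null sets\<close>

definition L2_fun :: "'a measure \<Rightarrow> ('a \<Rightarrow> real) set" where
  "L2_fun M = {f \<in> borel_measurable M. integrable M (\<lambda>x. (f x)\<^sup>2)}"

definition L2_eq :: "'a measure \<Rightarrow> ('a \<Rightarrow> real) \<Rightarrow> ('a \<Rightarrow> real) \<Rightarrow> bool" where
  "L2_eq M f g \<longleftrightarrow> f \<in> L2_fun M \<and> g \<in> L2_fun M \<and> (AE x in M. f x = g x)"

lemma L2_fun_zero: "(\<lambda>_. 0) \<in> L2_fun M"
  by (simp add: L2_fun_def)

lemma L2_fun_mult_integrable:
  assumes "f \<in> L2_fun M" "g \<in> L2_fun M"
  shows "integrable M (\<lambda>x. f x * g x)"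
proof (rule Bochner_Integration.integrable_bound)
  show "integrable M (\<lambda>x. (f x)\<^sup>2 + (g x)\<^sup>2)"
    using assms by (auto simp: L2_fun_def)
  show "(\<lambda>x. f x * g x) \<in> borel_measurable M"
    using assms by (auto simp: L2_fun_def)
  have "\<bar>a * b\<bar> \<le> a\<^sup>2 + b\<^sup>2" for a b :: real
  proof -
    have "2 * (\<bar>a\<bar> * \<bar>b\<bar>) \<le> a\<^sup>2 + b\<^sup>2"
      using sum_squares_bound[of "\<bar>a\<bar>" "\<bar>b\<bar>"] by (simp add: mult.assoc)
    moreover have "0 \<le> \<bar>a\<bar> * \<bar>b\<bar>" by simp
    ultimately show ?thesis unfolding abs_mult by linarith
  qed
  then show "AE x in M. norm (f x * g x) \<le> norm ((f x)\<^sup>2 + (g x)\<^sup>2)"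
    by (auto simp: abs_of_nonneg)
qed

lemma L2_fun_add:
  assumes "f \<in> L2_fun M" "g \<in> L2_fun M"
  shows "(\<lambda>x. f x + g x) \<in> L2_fun M"
proof -
  have "integrable M (\<lambda>x. (f x)\<^sup>2 + (g x)\<^sup>2 + 2 * (f x * g x))"
    using assms L2_fun_mult_integrable[OF assms] by (auto simp: L2_fun_def)
  then show ?thesis
    using assms by (auto simp: L2_fun_def power2_sum mult.assoc)
qed

lemma L2_fun_scale:
  assumes "f \<in> L2_fun M"
  shows "(\<lambda>x. a * f x) \<in> L2_fun M"
  using assms by (auto simp: L2_fun_def power_mult_distrib)

lemma L2_fun_uminus:
  assumes "f \<in> L2_fun M"
  shows "(\<lambda>x. - f x) \<in> L2_fun M"
  using assms by (auto simp: L2_fun_def)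

lemma L2_fun_minus:
  assumes "f \<in> L2_fun M" "g \<in> L2_fun M"
  shows "(\<lambda>x. f x - g x) \<in> L2_fun M"
  using L2_fun_add[OF assms(1) L2_fun_uminus[OF assms(2)]] by simp

lemma L2_fun_AE_zero:
  assumes "f \<in> L2_fun M" "(\<integral>x. f x * f x \<partial>M) = 0"
  shows "AE x in M. f x = 0"
  using assms integral_nonneg_eq_0_iff_AE[of M "\<lambda>x. f x * f x"]
    L2_fun_mult_integrable[OF assms(1) assms(1)] by auto

lemma part_equivp_L2_eq: "part_equivp (L2_eq M)"
proof (rule part_equivpI)
  show "\<exists>f. L2_eq M f f"
    using L2_fun_zero by (auto simp: L2_eq_def)
  show "symp (L2_eq M)"
    by (rule sympI) (auto simp: L2_eq_def elim: AE_mp)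
  show "transp (L2_eq M)"
    by (rule transpI) (auto simp: L2_eq_def elim: AE_mp)
qed

lemma L2_eq_inner:
  assumes "L2_eq M f f'" "L2_eq M g g'"
  shows "(\<integral>x. f x * g x \<partial>M) = (\<integral>x. f' x * g' x \<partial>M)"
proof (rule integral_cong_AE)
  show "AE x in M. f x * g x = f' x * g' x"
    using assms by (auto simp: L2_eq_def elim: AE_mp)
qed (use assms in \<open>auto simp: L2_eq_def L2_fun_def\<close>)


subsection \<open>The Hilbert space of square integrable functions on the real line\<close>

quotient_type line_L2 = "real \<Rightarrow> real" / partial: "L2_eq lborel"
  morphisms rep_line abs_line
  by (rule part_equivp_L2_eq)

instantiation line_L2 :: real_inner
begin

lift_definition zero_line_L2 :: line_L2 is "\<lambda>_. 0"
  by (simp add: L2_eq_def L2_fun_zero)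

lift_definition plus_line_L2 :: "line_L2 \<Rightarrow> line_L2 \<Rightarrow> line_L2" is "\<lambda>f g x. f x + g x"
  by (auto simp: L2_eq_def L2_fun_add elim: AE_mp)

lift_definition uminus_line_L2 :: "line_L2 \<Rightarrow> line_L2" is "\<lambda>f x. - f x"
  by (auto simp: L2_eq_def L2_fun_uminus elim: AE_mp)

lift_definition minus_line_L2 :: "line_L2 \<Rightarrow> line_L2 \<Rightarrow> line_L2" is "\<lambda>f g x. f x - g x"
  by (auto simp: L2_eq_def L2_fun_minus elim: AE_mp)

lift_definition scaleR_line_L2 :: "real \<Rightarrow> line_L2 \<Rightarrow> line_L2" is "\<lambda>a f x. a * f x"
  by (auto simp: L2_eq_def L2_fun_scale elim: AE_mp)

lift_definition inner_line_L2 :: "line_L2 \<Rightarrow> line_L2 \<Rightarrow> real" is "\<lambda>f g. \<integral>x. f x * g x \<partial>lborel"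
  by (rule L2_eq_inner)

definition norm_line_L2 :: "line_L2 \<Rightarrow> real" where
  "norm_line_L2 f = sqrt (f \<bullet> f)"

definition sgn_line_L2 :: "line_L2 \<Rightarrow> line_L2" where
  "sgn_line_L2 f = inverse (norm f) *\<^sub>R f"

definition dist_line_L2 :: "line_L2 \<Rightarrow> line_L2 \<Rightarrow> real" where
  "dist_line_L2 f g = norm (f - g)"

definition uniformity_line_L2 :: "(line_L2 \<times> line_L2) filter" where
  [code del]: "uniformity_line_L2 = (INF e\<in>{0<..}. principal {(f, g). dist f g < e})"

definition open_line_L2 :: "line_L2 set \<Rightarrow> bool" where
  [code del]: "open_line_L2 S \<longleftrightarrow>
    (\<forall>f\<in>S. \<forall>\<^sub>F (f', g) in uniformity. f' = f \<longrightarrow> g \<in> S)"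

instance
proof
  fix f g h :: line_L2 and a b :: real
  show "f + g + h = f + (g + h)"
    by transfer (auto simp: L2_eq_def L2_fun_add add.assoc)
  show "f + g = g + f"
    by transfer (auto simp: L2_eq_def L2_fun_add add.commute)
  show "0 + f = f"
    by transfer (auto simp: L2_eq_def)
  show "- f + f = 0"
    by transfer (auto simp: L2_eq_def L2_fun_zero)
  show "f - g = f + - g"
    by transfer (auto simp: L2_eq_def L2_fun_minus)
  show "a *\<^sub>R (f + g) = a *\<^sub>R f + a *\<^sub>R g"
    by transfer (auto simp: L2_eq_def L2_fun_add L2_fun_scale distrib_left)
  show "(a + b) *\<^sub>R f = a *\<^sub>R f + b *\<^sub>R f"
    by transfer (auto simp: L2_eq_def L2_fun_add L2_fun_scale distrib_right)
  show "a *\<^sub>R b *\<^sub>R f = (a * b) *\<^sub>R f"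
    by transfer (auto simp: L2_eq_def L2_fun_scale mult.assoc)
  show "1 *\<^sub>R f = f"
    by transfer (auto simp: L2_eq_def)
  show "dist f g = norm (f - g)"
    by (rule dist_line_L2_def)
  show "sgn f = inverse (norm f) *\<^sub>R f"
    by (rule sgn_line_L2_def)
  show "uniformity = (INF e\<in>{0<..}. principal {(f :: line_L2, g). dist f g < e})"
    by (rule uniformity_line_L2_def)
  show "open S \<longleftrightarrow> (\<forall>f\<in>S. \<forall>\<^sub>F (f', g) in uniformity. f' = f \<longrightarrow> g \<in> S)"
    for S :: "line_L2 set"
    by (rule open_line_L2_def)
  show "f \<bullet> g = g \<bullet> f"
    by transfer (simp add: mult.commute)
  show "(f + g) \<bullet> h = f \<bullet> h + g \<bullet> h"
    by transfer (simp add: L2_eq_def distrib_right L2_fun_mult_integrable)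
  show "a *\<^sub>R f \<bullet> g = a * (f \<bullet> g)"
    by transfer (simp add: mult.assoc)
  show "0 \<le> f \<bullet> f"
    by transfer simp
  show "f \<bullet> f = 0 \<longleftrightarrow> f = 0"
    by transfer (auto simp: L2_eq_def L2_fun_zero intro: L2_fun_AE_zero integral_eq_zero_AE)
  show "norm f = sqrt (f \<bullet> f)"
    by (rule norm_line_L2_def)
qed

end


subsection \<open>The Hilbert space with the radial weight\<close>

definition particle_measure :: "(real \<times> real) measure" where
  "particle_measure = density lborel (\<lambda>(x, r). ennreal (r\<^sup>2))"

quotient_type particle_L2 = "real \<times> real \<Rightarrow> real" / partial: "L2_eq particle_measure"
  morphisms rep_particle abs_particle
  by (rule part_equivp_L2_eq)

instantiation particle_L2 :: real_inner
begin

lift_definition zero_particle_L2 :: particle_L2 is "\<lambda>_. 0"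
  by (simp add: L2_eq_def L2_fun_zero)

lift_definition plus_particle_L2 :: "particle_L2 \<Rightarrow> particle_L2 \<Rightarrow> particle_L2" is "\<lambda>f g x. f x + g x"
  by (auto simp: L2_eq_def L2_fun_add elim: AE_mp)

lift_definition uminus_particle_L2 :: "particle_L2 \<Rightarrow> particle_L2" is "\<lambda>f x. - f x"
  by (auto simp: L2_eq_def L2_fun_uminus elim: AE_mp)

lift_definition minus_particle_L2 :: "particle_L2 \<Rightarrow> particle_L2 \<Rightarrow> particle_L2" is "\<lambda>f g x. f x - g x"
  by (auto simp: L2_eq_def L2_fun_minus elim: AE_mp)

lift_definition scaleR_particle_L2 :: "real \<Rightarrow> particle_L2 \<Rightarrow> particle_L2" is "\<lambda>a f x. a * f x"
  by (auto simp: L2_eq_def L2_fun_scale elim: AE_mp)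

lift_definition inner_particle_L2 :: "particle_L2 \<Rightarrow> particle_L2 \<Rightarrow> real"
  is "\<lambda>f g. \<integral>x. f x * g x \<partial>particle_measure"
  by (rule L2_eq_inner)

definition norm_particle_L2 :: "particle_L2 \<Rightarrow> real" where
  "norm_particle_L2 f = sqrt (f \<bullet> f)"

definition sgn_particle_L2 :: "particle_L2 \<Rightarrow> particle_L2" where
  "sgn_particle_L2 f = inverse (norm f) *\<^sub>R f"

definition dist_particle_L2 :: "particle_L2 \<Rightarrow> particle_L2 \<Rightarrow> real" where
  "dist_particle_L2 f g = norm (f - g)"

definition uniformity_particle_L2 :: "(particle_L2 \<times> particle_L2) filter" where
  [code del]: "uniformity_particle_L2 = (INF e\<in>{0<..}. principal {(f, g). dist f g < e})"

definition open_particle_L2 :: "particle_L2 set \<Rightarrow> bool" where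
  [code del]: "open_particle_L2 S \<longleftrightarrow>
    (\<forall>f\<in>S. \<forall>\<^sub>F (f', g) in uniformity. f' = f \<longrightarrow> g \<in> S)"

instance
proof
  fix f g h :: particle_L2 and a b :: real
  show "f + g + h = f + (g + h)"
    by transfer (auto simp: L2_eq_def L2_fun_add add.assoc)
  show "f + g = g + f"
    by transfer (auto simp: L2_eq_def L2_fun_add add.commute)
  show "0 + f = f"
    by transfer (auto simp: L2_eq_def)
  show "- f + f = 0"
    by transfer (auto simp: L2_eq_def L2_fun_zero)
  show "f - g = f + - g"
    by transfer (auto simp: L2_eq_def L2_fun_minus)
  show "a *\<^sub>R (f + g) = a *\<^sub>R f + a *\<^sub>R g"
    by transfer (auto simp: L2_eq_def L2_fun_add L2_fun_scale distrib_left)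
  show "(a + b) *\<^sub>R f = a *\<^sub>R f + b *\<^sub>R f"
    by transfer (auto simp: L2_eq_def L2_fun_add L2_fun_scale distrib_right)
  show "a *\<^sub>R b *\<^sub>R f = (a * b) *\<^sub>R f"
    by transfer (auto simp: L2_eq_def L2_fun_scale mult.assoc)
  show "1 *\<^sub>R f = f"
    by transfer (auto simp: L2_eq_def)
  show "dist f g = norm (f - g)"
    by (rule dist_particle_L2_def)
  show "sgn f = inverse (norm f) *\<^sub>R f"
    by (rule sgn_particle_L2_def)
  show "uniformity = (INF e\<in>{0<..}. principal {(f :: particle_L2, g). dist f g < e})"
    by (rule uniformity_particle_L2_def)
  show "open S \<longleftrightarrow> (\<forall>f\<in>S. \<forall>\<^sub>F (f', g) in uniformity. f' = f \<longrightarrow> g \<in> S)"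
    for S :: "particle_L2 set"
    by (rule open_particle_L2_def)
  show "f \<bullet> g = g \<bullet> f"
    by transfer (simp add: mult.commute)
  show "(f + g) \<bullet> h = f \<bullet> h + g \<bullet> h"
    by transfer (simp add: L2_eq_def distrib_right L2_fun_mult_integrable)
  show "a *\<^sub>R f \<bullet> g = a * (f \<bullet> g)"
    by transfer (simp add: mult.assoc)
  show "0 \<le> f \<bullet> f"
    by transfer simp
  show "f \<bullet> f = 0 \<longleftrightarrow> f = 0"
    by transfer (auto simp: L2_eq_def L2_fun_zero intro: L2_fun_AE_zero integral_eq_zero_AE)
  show "norm f = sqrt (f \<bullet> f)"
    by (rule norm_particle_L2_def)
qed

end


section \<open>Cell parameters\<close>

text \<open>
  The three particle bins are indexed by the type \<open>3\<close>.
  \<open>ocp\<close> is the open circuit potential \<open>U\<close>, \<open>Rgas\<close> the gas constant \<open>R\<close>;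
  \<open>Rad $ k\<close> is the particle radius \<open>R_k\<close>.
\<close>

record cell =
  L1 :: real
  L :: real
  Rad :: "real^3"
  area :: "real^3"
  k_eff :: real
  sigma_eff :: real
  i0 :: real
  Far :: real
  Rgas :: real
  Temp :: real
  c_ini :: real
  c_max :: real
  a0 :: real
  b0 :: real
  t_plus :: real
  eps0 :: real
  ocp :: "real \<Rightarrow> real"

definition U_charging :: "real \<Rightarrow> real" where
  "U_charging y = 3.4510 - 0.009 * y + 0.6687 * exp (- 35 * y) - 0.5 * exp (- 210 * (1 - y))"

definition U_discharging :: "real \<Rightarrow> real" where
  "U_discharging y =
     3.4077 - 0.020269 * y + 0.5 * exp (- 200 * y) - 0.9 * exp (- 30 * (1 - y))"

definition valid_cell :: "cell \<Rightarrow> bool" where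
  "valid_cell P \<longleftrightarrow>
     0 < L1 P \<and> L1 P < L P \<and> (\<forall>k. 0 < Rad P $ k) \<and> (\<forall>k. 0 < area P $ k) \<and>
     0 < k_eff P \<and> 0 < sigma_eff P \<and> 0 < i0 P \<and> 0 < Far P \<and> 0 < Rgas P \<and> 0 < Temp P \<and>
     0 < c_ini P \<and> 0 < c_max P \<and> 0 < a0 P \<and> 0 < b0 P \<and>
     0 < t_plus P \<and> t_plus P < 1 \<and> 0 < eps0 P \<and> eps0 P < 1 \<and>
     (ocp P = U_charging \<or> ocp P = U_discharging)"


section \<open>State and potential spaces\<close>

text \<open>
  The domains depend on the parameters, so the function spaces on them cannot be types.
  They are taken as closed subspaces of the spaces on the whole line, respectively plane,
  by extension by zero: \<open>L2_on S\<close> is isometric to \<open>L^2(S)\<close>, and \<open>particle_space P k\<close> is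
  isometric to the square integrable functions on \<open>[L1, L] \<times> [0, R_k]\<close> with weight \<open>r^2\<close>.
\<close>

definition L2_on :: "real set \<Rightarrow> line_L2 set" where
  "L2_on S = {f. AE x in lborel. x \<notin> S \<longrightarrow> rep_line f x = 0}"

definition particle_space :: "cell \<Rightarrow> 3 \<Rightarrow> particle_L2 set" where
  "particle_space P k =
     {z. AE p in particle_measure. p \<notin> {L1 P..L P} \<times> {0..Rad P $ k} \<longrightarrow> rep_particle z p = 0}"

text \<open>A state is \<open>(c\<^sub>1, (c\<^sub>2, c\<^sub>3, c\<^sub>4))\<close>: bin \<open>k\<close> carries \<open>c_{k+1}\<close>.\<close>

type_synonym state = "line_L2 \<times> (particle_L2^3)"
type_synonym potential = "line_L2 \<times> line_L2"

definition state_space :: "cell \<Rightarrow> state set" where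
  "state_space P = L2_on {0..L P} \<times> {z. \<forall>k. z $ k \<in> particle_space P k}"

definition potential_space :: "cell \<Rightarrow> potential set" where
  "potential_space P = L2_on {0..L P} \<times> L2_on {L1 P..L P}"

text \<open>The class in \<open>L^2(S)\<close> of a function given by its values on \<open>S\<close>.\<close>

definition L2_class :: "real set \<Rightarrow> (real \<Rightarrow> real) \<Rightarrow> line_L2" where
  "L2_class S f = abs_line (\<lambda>x. indicator S x * f x)"


section \<open>Reaction rates\<close>

definition sat_y :: "cell \<Rightarrow> real \<Rightarrow> real" where
  "sat_y P s = 1 / (1 + exp (- a0 P * s))"

definition sat :: "cell \<Rightarrow> real \<Rightarrow> real" where
  "sat P s = 2 * b0 P / (1 + exp (- a0 P * s)) - b0 P"

definition surface_delta :: "cell \<Rightarrow> 3 \<Rightarrow> real \<Rightarrow> real" where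
  "surface_delta P k s =
     (if - (eps0 P * Rad P $ k) \<le> s \<and> s \<le> 0 then 1 / (eps0 P * Rad P $ k) else 0)"

definition c_bar :: "cell \<Rightarrow> state \<Rightarrow> 3 \<Rightarrow> real \<Rightarrow> real" where
  "c_bar P c k x =
     (LBINT r:{0..Rad P $ k}. surface_delta P k (r - Rad P $ k) * rep_particle (snd c $ k) (x, r))"

definition y_bar :: "cell \<Rightarrow> state \<Rightarrow> 3 \<Rightarrow> real \<Rightarrow> real" where
  "y_bar P c k x = sat_y P (c_bar P c k x / c_max P)"

text \<open>
  The rate at position \<open>x\<close> as a function of the potential values \<open>p1\<close>, \<open>p2\<close> there.
\<close>

definition rate :: "cell \<Rightarrow> state \<Rightarrow> 3 \<Rightarrow> real \<Rightarrow> real \<Rightarrow> real \<Rightarrow> real" where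
  "rate P c k x p1 p2 =
     (if x \<in> {L1 P..L P}
      then 2 * i0 P *
             sinh (sat P (Far P * (p2 - p1 - ocp P (y_bar P c k x)) / (2 * Rgas P * Temp P)))
      else 0)"

definition i_bar :: "cell \<Rightarrow> state \<Rightarrow> potential \<Rightarrow> 3 \<Rightarrow> real \<Rightarrow> real" where
  "i_bar P c \<phi> k x = rate P c k x (rep_line (fst \<phi>) x) (rep_line (snd \<phi>) x)"

definition g1 :: "cell \<Rightarrow> state \<Rightarrow> potential \<Rightarrow> 3 \<Rightarrow> real \<Rightarrow> real" where
  "g1 P c \<phi> k x = deriv (\<lambda>p. rate P c k x p (rep_line (snd \<phi>) x)) (rep_line (fst \<phi>) x)"

definition g2 :: "cell \<Rightarrow> state \<Rightarrow> potential \<Rightarrow> 3 \<Rightarrow> real \<Rightarrow> real" where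
  "g2 P c \<phi> k x = deriv (\<lambda>p. rate P c k x (rep_line (fst \<phi>) x) p) (rep_line (snd \<phi>) x)"


section \<open>Constraint equations and the linearised operator\<close>

definition dbl_int :: "(real \<Rightarrow> real) \<Rightarrow> real \<Rightarrow> real" where
  "dbl_int f x = (LBINT y:{0..x}. (LBINT s:{0..y}. f s))"

text \<open>\<open>c0\<close> stands for \<open>c\<^sub>1(0)\<close> and \<open>\<phi>0\<close> for \<open>\<phi>\<^sub>2(L1)\<close>.\<close>

definition constraint_eqs ::
    "cell \<Rightarrow> state \<Rightarrow> potential \<Rightarrow> real \<Rightarrow> real \<Rightarrow> real \<Rightarrow> bool" where
  "constraint_eqs P c \<phi> I c0 \<phi>0 \<longleftrightarrow>
     (let J = (\<lambda>s. \<Sum>k\<in>UNIV. area P $ k * i_bar P c \<phi> k s) in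
       (AE x in lborel. x \<in> {0..L P} \<longrightarrow>
          rep_line (fst \<phi>) x =
            x / k_eff P * (LBINT s:{0..L P}. J s)
            - 2 * Rgas P * Temp P * (1 - t_plus P) / (Far P * c_ini P) * (rep_line (fst c) x - c0)
            - 1 / k_eff P * dbl_int J x) \<and>
       (AE x in lborel. x \<in> {L1 P..L P} \<longrightarrow>
          rep_line (snd \<phi>) x = \<phi>0 + 1 / sigma_eff P * dbl_int J x) \<and>
       0 = I + (LBINT s:{0..L P}. J s))"

text \<open>The operator matrix does not involve \<open>I\<close>, \<open>c0\<close>, \<open>\<phi>0\<close>.\<close>

definition DO ::
    "cell \<Rightarrow> state \<Rightarrow> potential \<Rightarrow> real \<Rightarrow> real \<Rightarrow> real \<Rightarrow> potential \<times> real \<Rightarrow> potential \<times> real"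
where
  "DO P c \<phi> I c0 \<phi>0 = (\<lambda>((h1, h2), h3).
     let u1 = rep_line h1; u2 = rep_line h2;
         G1 = (\<lambda>k s. g1 P c \<phi> k s * u1 s);
         G2 = (\<lambda>k s. g2 P c \<phi> k s * u2 s)
     in
     ((L2_class {0..L P} (\<lambda>x.
         (k_eff P * u1 x + (\<Sum>k\<in>UNIV. area P $ k * dbl_int (G1 k) x)
            - x * (LBINT s:{0..L P}. \<Sum>k\<in>UNIV. area P $ k * G1 k s))
         + ((\<Sum>k\<in>UNIV. area P $ k * dbl_int (G2 k) x)
            - x * (LBINT s:{0..L P}. \<Sum>k\<in>UNIV. area P $ k * G2 k s))
         + 0 * h3),
       L2_class {L1 P..L P} (\<lambda>x.
         - (\<Sum>k\<in>UNIV. area P $ k * dbl_int (G1 k) x)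
         + (sigma_eff P * u2 x - (\<Sum>k\<in>UNIV. area P $ k * dbl_int (G2 k) x))
         + - sigma_eff P * h3)),
      (LBINT s:{0..L P}. \<Sum>k\<in>UNIV. area P $ k * G1 k s)
      + (LBINT s:{0..L P}. \<Sum>k\<in>UNIV. area P $ k * G2 k s)
      + 0 * h3))"

text \<open>A linear operator on the subspace \<open>S\<close> is nonsingular if it has a bounded inverse on \<open>S\<close>.\<close>

definition nonsingular_on :: "'a::real_normed_vector set \<Rightarrow> ('a \<Rightarrow> 'a) \<Rightarrow> bool" where
  "nonsingular_on S T \<longleftrightarrow> bij_betw T S S \<and> (\<exists>B. \<forall>h\<in>S. norm h \<le> B * norm (T h))"

end

theory Submission
  imports Defs
begin

text \<open>
  The superposition operator of the reaction rate is not Frechet differentiable from \<open>L\<^sup>2\<close> to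
  \<open>L\<^sup>2\<close>, but the rate is a function with bounded second derivatives of \<open>\<phi>\<^sub>2 - \<phi>\<^sub>1\<close> and the
  surface concentration, so as a map from \<open>L\<^sup>2\<close> to \<open>L\<^sup>1\<close> it has a quadratic Taylor remainder and
  a Lipschitz derivative. The double integrals map \<open>L\<^sup>1\<close> back to \<open>L\<^sup>2\<close>. Hence the
  residual of the constraint equations is differentiable, its partial derivative in the potentials
  is \<open>DO\<close>, and the implicit function theorem in Banach spaces, which requires completeness
  of \<open>L\<^sup>2\<close>, yields the local solution. A smooth cutoff in the Hilbert norm extends
  it to the whole state space.
\<close>

section \<open>An implicit function theorem\<close>

text \<open>All bounds are global because both nonlinearities saturate: one sigmoid keeps the
  argument of \<open>U\<close> between 0 and 1, the other keeps the argument of sinh bounded. A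
  single constant then serves every point, and the fixed point argument runs with explicit radii.
  The obstacle is that the true spaces depend on the cell parameters and are only subspaces, while
  the fixed point argument lives on a complete type. The equations are therefore extended to the
  whole type by an invertible block on the complement; nonsingularity of \<open>DO\<close> on the
  subspace then becomes invertibility on the type. Completeness is used for the unknowns; for the
  data the argument uses a norm, and an inner product for the cutoff. The surface average is a
  bounded map although the weight \<open>r^2\<close> degenerates at the centre of the particle:
  \<open>eps0 P < 1\<close> keeps the averaging shell away from it.\<close>

lemma has_derivative_quadratic_bound:
  fixes f :: "'a::real_normed_vector \<Rightarrow> 'b::real_normed_vector"
  assumes "bounded_linear f'" "0 < e"
    and bound: "\<And>y. y \<in> ball x e \<Longrightarrow> norm (f y - f x - f' (y - x)) \<le> C * (norm (y - x))\<^sup>2"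
  shows "(f has_derivative f') (at x)"
proof (rule has_derivativeI_sandwich[OF \<open>0 < e\<close> \<open>bounded_linear f'\<close>])
  show "norm (f y - f x - f' (y - x)) / norm (y - x) \<le> C * norm (y - x)"
    if "y \<noteq> x" "dist y x < e" for y
    using bound[of y] that by (simp add: dist_commute divide_le_eq power2_eq_square mult.assoc)
  have "((\<lambda>y. C * norm (y - x)) \<longlongrightarrow> C * norm (x - x)) (at x)"
    by (intro tendsto_intros)
  then show "((\<lambda>y. C * norm (y - x)) \<longlongrightarrow> 0) (at x)" by simp
qed

text \<open>The equation \<open>T' h = w\<close> is the fixed point equation of
  \<open>h - inv T (T' h - w)\<close>, a contraction with factor 1/2 since \<open>inv T\<close> is
  bounded by \<open>B\<close>. This carries invertibility of the derivative from the base point to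
  nearby points, which differentiability away from the base point requires.\<close>

lemma bij_perturbation:
  fixes T T' :: "'a::banach \<Rightarrow> 'a"
  assumes T: "bounded_linear T" "bij T" "\<And>h. norm h \<le> B * norm (T h)" "0 \<le> B"
    and T': "bounded_linear T'" "\<And>h. norm (T' h - T h) \<le> e * norm h" "B * e \<le> 1/2"
  shows "bij T'" "norm h \<le> 2 * B * norm (T' h)"
proof -
  interpret T: bounded_linear T by fact
  interpret T': bounded_linear T' by fact
  have lower: "norm h \<le> 2 * B * norm (T' h)" for h
  proof -
    have "norm (T h) \<le> norm (T' h) + norm (T' h - T h)"
      using norm_triangle_ineq4[of "T' h" "T' h - T h"] by simp
    also have "\<dots> \<le> norm (T' h) + e * norm h" using T'(2) by simp
    finally have "B * norm (T h) \<le> B * (norm (T' h) + e * norm h)"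
      using \<open>0 \<le> B\<close> by (rule mult_left_mono)
    moreover have "B * e * norm h \<le> 1/2 * norm h"
      using T'(3) by (rule mult_right_mono) simp
    ultimately show ?thesis using T(3)[of h] by (simp add: algebra_simps)
  qed
  then show "norm h \<le> 2 * B * norm (T' h)" .
  have "inj T'"
  proof (rule injI)
    fix a b assume "T' a = T' b"
    then show "a = b" using lower[of "a - b"] by (simp add: T'.diff)
  qed
  have TS: "T (inv T w) = w" for w using \<open>bij T\<close> by (simp add: bij_is_surj surj_f_inv_f)
  have "surj T'"
  proof (rule surjI)
    fix w
    define f where "f h = h - inv T (T' h - w)" for h
    have "\<exists>!h. f h = h"
    proof (rule banach_fix_type[of "1/2"]; (intro allI)?)
      fix a b
      have "T (f a - f b) = - (T' (a - b) - T (a - b))"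
        by (simp add: f_def T.diff T'.diff TS)
      then have "norm (f a - f b) \<le> B * norm (T' (a - b) - T (a - b))"
        using T(3)[of "f a - f b"] by (simp only: norm_minus_cancel)
      also have "\<dots> \<le> B * (e * norm (a - b))" using T'(2) \<open>0 \<le> B\<close> by (rule mult_left_mono)
      also have "\<dots> \<le> 1/2 * norm (a - b)" using mult_right_mono[OF T'(3), of "norm (a - b)"] by simp
      finally show "dist (f a) (f b) \<le> 1/2 * dist a b" by (simp add: dist_norm)
    qed auto
    then obtain h where "f h = h" by blast
    then have "inv T (T' h - w) = 0" by (simp add: f_def)
    then have "T' h = w" using TS[of "T' h - w"] by (simp add: T.zero)
    then show "T' (inv T' w) = w" by (metis f_inv_into_f rangeI)
  qed
  with \<open>inj T'\<close> show "bij T'" by (simp add: bij_def)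
qed

text \<open>A quadratic remainder and a Lipschitz derivative, both with one global constant, take
  the place of continuous differentiability. They make the solution map differentiable on a whole
  ball rather than at its centre alone. The fixed point is sought in the second factor, hence the
  completeness there.\<close>

theorem implicit_function_quadratic:
  fixes G :: "'a::real_normed_vector \<times> 'b::banach \<Rightarrow> 'b"
    and D :: "'a \<times> 'b \<Rightarrow> 'a \<times> 'b \<Rightarrow> 'b"
  assumes lin: "\<And>p. bounded_linear (D p)"
    and quad: "\<And>p h. norm (G (p + h) - G p - D p h) \<le> C * (norm h)\<^sup>2"
    and lip: "\<And>p p' h. norm (D p' h - D p h) \<le> C * norm (p' - p) * norm h"
    and zero: "G (z0, q0) = 0"
    and bij: "bij (\<lambda>h. D (z0, q0) (0, h))"
    and lower: "\<And>h. norm h \<le> B * norm (D (z0, q0) (0, h))"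
  obtains r \<rho> R where "0 < r" "0 < \<rho>"
    "\<And>z. z \<in> ball z0 r \<Longrightarrow> R z \<in> ball q0 \<rho> \<and> G (z, R z) = 0"
    "\<And>z q. z \<in> ball z0 r \<Longrightarrow> q \<in> ball q0 \<rho> \<Longrightarrow> G (z, q) = 0 \<Longrightarrow> q = R z"
    "\<And>z. z \<in> ball z0 r \<Longrightarrow> R differentiable (at z)"
proof -
  \<comment> \<open>The given constants may be zero or negative; raising them to at least 1
    preserves the inequalities and permits the divisions below.\<close>
  define C' where "C' = max C 1"
  define B' where "B' = max B 1"
  have pos: "0 < B'" "0 < C'" by (auto simp: B'_def C'_def)
  have quad': "norm (G (p + h) - G p - D p h) \<le> C' * (norm h)\<^sup>2" for p h
    using quad[of p h] mult_right_mono[of C C' "(norm h)\<^sup>2"] by (simp add: C'_def)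
  have lip': "norm (D p' h - D p h) \<le> C' * norm (p' - p) * norm h" for p p' h
    using lip[of p' h p] mult_right_mono[of C C' "norm (p' - p) * norm h"]
    by (simp add: C'_def mult.assoc)
  define T where "T p h = D p (0, h)" for p h
  define p0 where "p0 = (z0, q0)"
  have linT: "bounded_linear (T p)" for p
    unfolding T_def
    by (rule bounded_linear_compose[OF lin]) (intro bounded_linear_Pair bounded_linear_zero bounded_linear_ident)
  have bijT: "bij (T p0)" using bij by (simp add: T_def[abs_def] p0_def)
  have lowT: "norm h \<le> B' * norm (T p0 h)" for h
    using lower[of h] mult_right_mono[of B B' "norm (T p0 h)"] by (simp add: T_def p0_def B'_def)
  define S where "S = inv (T p0)"
  have TS: "T p0 (S w) = w" for w using bijT by (simp add: S_def bij_is_surj surj_f_inv_f)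
  interpret T0: bounded_linear "T p0" by (rule linT)
  \<comment> \<open>In the contraction estimate the point of expansion is within 2\<rho> of
    \<open>p0\<close> and the increment is at most 2\<rho>. This value makes the resulting factor
    \<open>B' * C' * (4 * \<rho>)\<close> equal to 1/2.\<close>
  define \<rho> where "\<rho> = 1 / (8 * B' * C')"
  have \<rho>: "0 < \<rho>" "B' * C' * (4 * \<rho>) = 1/2" using pos by (auto simp: \<rho>_def)
  obtain K where K: "0 < K" "\<And>h. norm (D p0 h) \<le> K * norm h"
    using bounded_linear.pos_bounded[OF lin[of p0]] by (auto simp: mult.commute)
  \<comment> \<open>Three demands: at most \<rho> for the contraction, at most 1 so that a square is
    bounded by its base, and the quotient so that the first iterate moves \<open>q0\<close> by at
    most \<rho>/4.\<close>
  define r where "r = min (min \<rho> 1) (\<rho> / (4 * B' * (K + C')))"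
  have r: "0 < r" "r \<le> \<rho>" "r \<le> 1" "B' * (K + C') * r \<le> \<rho> / 4"
  proof -
    show "0 < r" "r \<le> \<rho>" "r \<le> 1" using pos \<rho> K by (auto simp: r_def)
    have "r \<le> \<rho> / (4 * B' * (K + C'))" by (simp add: r_def)
    then have "r * (4 * B' * (K + C')) \<le> \<rho>" using pos K by (subst (asm) pos_le_divide_eq) auto
    then show "B' * (K + C') * r \<le> \<rho> / 4" by (simp add: mult.commute mult.left_commute)
  qed
  \<comment> \<open>Newton's map with the derivative frozen at the base point; its fixed points are
    the zeros of \<open>G (z, q)\<close> in \<open>q\<close>.\<close>
  define N where "N z q = q - S (G (z, q))" for z q
  have N0: "N z q = q \<longleftrightarrow> G (z, q) = 0" for z q
    using TS[of "G (z, q)"] TS[of 0] T0.zero lowT[of "S 0"] by (auto simp: N_def)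
  have contr: "norm (N z q - N z q') \<le> 1/2 * norm (q - q')"
    if z: "norm (z - z0) < \<rho>" and q: "norm (q - q0) < \<rho>" and q': "norm (q' - q0) < \<rho>" for z q q'
  proof -
    have d: "norm ((z, q') - p0) \<le> 2 * \<rho>"
      using norm_Pair_le[of "z - z0" "q' - q0"] z q' by (simp add: p0_def)
    have d': "norm (q - q') \<le> 2 * \<rho>"
      using norm_triangle_ineq4[of "q - q0" "q' - q0"] q q' by simp
    \<comment> \<open>Expansion at \<open>(z, q')\<close>: the first bracket is the Taylor
      remainder, the second the drift of the derivative away from \<open>p0\<close>.\<close>
    have "G (z, q) - G (z, q') - T p0 (q - q') =
        (G ((z, q') + (0, q - q')) - G (z, q') - D (z, q') (0, q - q'))
        + (D (z, q') (0, q - q') - D p0 (0, q - q'))"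
      by (simp add: T_def)
    also have "norm \<dots> \<le> C' * (norm (q - q'))\<^sup>2 + C' * norm ((z, q') - p0) * norm (q - q')"
      using quad'[of "(z, q')" "(0, q - q')"] lip'[of "(z, q')" "(0, q - q')" p0]
      by (intro norm_triangle_le add_mono) (simp_all add: norm_Pair)
    also have "\<dots> = C' * (norm (q - q') + norm ((z, q') - p0)) * norm (q - q')"
      by (simp add: power2_eq_square algebra_simps)
    also have "\<dots> \<le> C' * (4 * \<rho>) * norm (q - q')"
      using d d' pos by (intro mult_right_mono mult_left_mono) auto
    finally have "norm (G (z, q) - G (z, q') - T p0 (q - q')) \<le> C' * (4 * \<rho>) * norm (q - q')" .
    moreover have "T p0 (N z q - N z q') = - (G (z, q) - G (z, q') - T p0 (q - q'))"
      by (simp add: N_def T0.diff TS)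
    ultimately have "norm (T p0 (N z q - N z q')) \<le> C' * (4 * \<rho>) * norm (q - q')"
      by (simp only: norm_minus_cancel)
    then have "norm (N z q - N z q') \<le> B' * (C' * (4 * \<rho>) * norm (q - q'))"
      using pos by (intro order_trans[OF lowT mult_left_mono]) auto
    then show ?thesis using \<rho>(2) by (metis mult.assoc)
  qed
  have uniq: "q = q'" if "z \<in> ball z0 r" "q \<in> ball q0 \<rho>" "q' \<in> ball q0 \<rho>"
    "G (z, q) = 0" "G (z, q') = 0" for z q q'
    using contr[of z q q'] that r by (auto simp: dist_norm norm_minus_commute N0[THEN iffD2])
  have exist: "\<exists>q. q \<in> ball q0 \<rho> \<and> G (z, q) = 0" if z: "z \<in> ball z0 r" for z
  proof -
    have nz: "norm (z - z0) < r" using z by (simp add: dist_norm norm_minus_commute)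
    have "norm (G (p0 + (z - z0, 0)) - G p0 - D p0 (z - z0, 0)) \<le> C' * (norm (z - z0, 0 :: 'b))\<^sup>2"
      by (rule quad')
    then have 1: "norm (G (z, q0) - D p0 (z - z0, 0)) \<le> C' * (norm (z - z0))\<^sup>2"
      using zero by (simp add: p0_def norm_Pair)
    have 2: "norm (D p0 (z - z0, 0)) \<le> K * norm (z - z0)"
      using K(2)[of "(z - z0, 0)"] by (simp add: norm_Pair)
    have 3: "(norm (z - z0))\<^sup>2 \<le> norm (z - z0)"
      using nz r(3) by (simp add: power2_eq_square mult_left_le)
    have "norm (G (z, q0)) \<le> C' * (norm (z - z0))\<^sup>2 + K * norm (z - z0)"
      using norm_triangle_ineq[of "G (z, q0) - D p0 (z - z0, 0)" "D p0 (z - z0, 0)"] 1 2 by simp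
    also have "\<dots> \<le> C' * norm (z - z0) + K * norm (z - z0)"
      using 3 pos by simp
    also have "\<dots> = (K + C') * norm (z - z0)" by (simp add: algebra_simps)
    also have "\<dots> \<le> (K + C') * r" using nz pos K by (intro mult_left_mono) auto
    finally have "B' * norm (G (z, q0)) \<le> B' * ((K + C') * r)" using pos by (intro mult_left_mono) auto
    then have G0: "B' * norm (G (z, q0)) \<le> \<rho> / 4" using r(4) by (simp add: mult.assoc)
    have N00: "norm (N z q0 - q0) \<le> \<rho> / 4"
      using lowT[of "S (G (z, q0))"] G0 by (simp add: N_def TS)
    \<comment> \<open>Radius \<rho>/2 works because the contraction halves it to \<rho>/4 and the
      first iterate adds at most \<rho>/4. The closed ball is complete and lies inside the open ball
      on which uniqueness holds.\<close>
    have "\<exists>!q. q \<in> cball q0 (\<rho>/2) \<and> N z q = q"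
    proof (rule Banach_fix[where c="1/2"])
      show "complete (cball q0 (\<rho>/2))" by (simp add: complete_eq_closed)
      show "cball q0 (\<rho>/2) \<noteq> {}" using \<rho> by simp
      have *: "norm (q - q0) < \<rho>" if "q \<in> cball q0 (\<rho>/2)" for q
        using that \<rho> by (simp add: dist_norm norm_minus_commute)
      show "N z ` cball q0 (\<rho>/2) \<subseteq> cball q0 (\<rho>/2)"
      proof clarify
        fix q assume q: "q \<in> cball q0 (\<rho>/2)"
        then have "norm (N z q - N z q0) \<le> 1/2 * norm (q - q0)"
          using contr[of z q q0] *[OF q] nz r \<rho> by simp
        then have "norm (N z q - N z q0) \<le> \<rho> / 4"
          using q by (simp add: dist_norm norm_minus_commute)
        then show "N z q \<in> cball q0 (\<rho>/2)"
          using norm_triangle_ineq[of "N z q - N z q0" "N z q0 - q0"] N00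
          by (simp add: dist_norm norm_minus_commute)
      qed
      show "dist (N z q) (N z q') \<le> 1/2 * dist q q'"
        if "q \<in> cball q0 (\<rho>/2)" "q' \<in> cball q0 (\<rho>/2)" for q q'
        using contr[of z q q'] *[OF that(1)] *[OF that(2)] nz r by (simp add: dist_norm)
    qed auto
    then obtain q where "q \<in> cball q0 (\<rho>/2)" "G (z, q) = 0" using N0 by blast
    then show ?thesis using \<rho> by (intro exI[of _ q]) auto
  qed
  then obtain R where R: "\<And>z. z \<in> ball z0 r \<Longrightarrow> R z \<in> ball q0 \<rho> \<and> G (z, R z) = 0" by metis
  have diff: "R differentiable (at z)" if z: "z \<in> ball z0 r" for z
  proof -
    define p where "p = (z, R z)"
    have Rz: "R z \<in> ball q0 \<rho>" "G p = 0" using R[OF z] by (auto simp: p_def)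
    have dp: "norm (p - p0) \<le> 2 * \<rho>"
      using norm_Pair_le[of "z - z0" "R z - q0"] z Rz r
      by (simp add: p_def p0_def dist_norm norm_minus_commute)
    have Tdiff: "norm (T p h - T p0 h) \<le> C' * (2 * \<rho>) * norm h" for h
    proof -
      have "norm (T p h - T p0 h) \<le> C' * norm (p - p0) * norm h"
        using lip'[of p "(0, h)" p0] by (simp add: T_def norm_Pair)
      also have "\<dots> \<le> C' * (2 * \<rho>) * norm h"
        using pos dp by (intro mult_right_mono mult_left_mono) auto
      finally show ?thesis .
    qed
    note T = bij_perturbation[OF linT[of p0] bijT lowT _ linT[of p] Tdiff]
    have bijp: "bij (T p)" and lowp: "\<And>h. norm h \<le> 2 * B' * norm (T p h)"
      using T pos \<rho> by (auto simp: mult.assoc)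
    interpret Tp: bounded_linear "T p" by (rule linT)
    interpret Dp: bounded_linear "D p" by (rule lin)
    obtain Kp where Kp: "0 < Kp" "\<And>h. norm (D p h) \<le> Kp * norm h"
      using Dp.pos_bounded by (auto simp: mult.commute)
    define Sp where "Sp = inv (T p)"
    have TSp: "T p (Sp w) = w" for w using bijp by (simp add: Sp_def bij_is_surj surj_f_inv_f)
    have injp: "T p a = T p b \<Longrightarrow> a = b" for a b using bijp by (simp add: bij_is_inj inj_eq)
    have linSp: "bounded_linear Sp"
    proof (rule bounded_linear_intro)
      show "Sp (a + b) = Sp a + Sp b" for a b by (rule injp) (simp add: Tp.add TSp)
      show "Sp (c *\<^sub>R a) = c *\<^sub>R Sp a" for c a by (rule injp) (simp add: Tp.scaleR TSp)
      show "norm (Sp a) \<le> norm a * (2 * B')" for a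
        using lowp[of "Sp a"] by (simp add: TSp mult.commute)
    qed
    \<comment> \<open>Differentiating \<open>G (z, R z) = 0\<close> leaves this as the only
      candidate for the derivative.\<close>
    define R' where "R' v = - Sp (D p (v, 0))" for v
    have linR': "bounded_linear R'"
      unfolding R'_def
      by (intro bounded_linear_minus bounded_linear_compose[OF linSp] bounded_linear_compose[OF lin]
          bounded_linear_Pair bounded_linear_zero bounded_linear_ident)
    \<comment> \<open>A Lipschitz bound for \<open>R\<close> at \<open>z\<close>. In the estimate
      below \<open>norm u\<close> reappears with factor 1/2; absorbing it doubles the coefficient of
      \<open>norm v\<close>, which gives this value.\<close>
    define \<Lambda> where "\<Lambda> = 4 * B' * (Kp + 2 * C')"
    have "(R has_derivative R') (at z)"
    proof (rule has_derivative_quadratic_bound[OF linR', where C="2 * B' * (C' * (1 + \<Lambda>\<^sup>2))"])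
      show "0 < r - dist z0 z" using z by simp
      fix z' assume "z' \<in> ball z (r - dist z0 z)"
      then have z': "z' \<in> ball z0 r"
        using dist_triangle[of z0 z' z] by simp
      define v u where "v = z' - z" and "u = R z' - R z"
      have Rz': "R z' \<in> ball q0 \<rho>" "G (z', R z') = 0" using R[OF z'] by auto
      have "norm (G (p + (v, u)) - G p - D p (v, u)) \<le> C' * (norm (v, u))\<^sup>2" by (rule quad')
      then have rem: "norm (D p (v, u)) \<le> C' * ((norm v)\<^sup>2 + (norm u)\<^sup>2)"
        using Rz Rz' by (simp add: p_def v_def u_def norm_Pair)
      have split: "D p (v, u) = D p (v, 0) + T p u" by (simp add: T_def flip: Dp.add)
      have u: "norm u \<le> 2 * \<rho>"
        using norm_triangle_ineq4[of "R z' - q0" "R z - q0"] Rz Rz'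
        by (simp add: u_def dist_norm norm_minus_commute)
      have v: "norm v \<le> 2"
        using norm_triangle_ineq4[of "z' - z0" "z - z0"] z z' r
        by (simp add: v_def dist_norm norm_minus_commute)
      have "norm (T p u) \<le> norm (D p (v, u)) + norm (D p (v, 0))"
        using norm_triangle_ineq4[of "D p (v, u)" "D p (v, 0)"] by (simp add: split)
      also have "\<dots> \<le> C' * ((norm v)\<^sup>2 + (norm u)\<^sup>2) + Kp * norm v"
        using rem Kp(2)[of "(v, 0)"] by (simp add: norm_Pair)
      \<comment> \<open>One factor of each square is replaced by its a priori bound, 2 for
        \<open>v\<close> and 2\<rho> for \<open>u\<close>, so that the estimate becomes
        linear.\<close>
      also have "\<dots> \<le> C' * (2 * norm v + 2 * \<rho> * norm u) + Kp * norm v"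
        using u v pos by (intro add_right_mono mult_left_mono add_mono)
          (auto simp: power2_eq_square mult_right_mono)
      finally have "norm u \<le> 2 * B' * (C' * (2 * norm v + 2 * \<rho> * norm u) + Kp * norm v)"
        using pos by (intro order_trans[OF lowp mult_left_mono]) auto
      also have "\<dots> = B' * C' * (4 * \<rho>) * norm u + (\<Lambda> / 2) * norm v"
        by (simp add: \<Lambda>_def algebra_simps)
      finally have "norm u \<le> \<Lambda> * norm v" unfolding \<rho>(2) by simp
      then have "(norm u)\<^sup>2 \<le> (\<Lambda> * norm v)\<^sup>2" by (intro power_mono) auto
      then have uv: "(norm v)\<^sup>2 + (norm u)\<^sup>2 \<le> (1 + \<Lambda>\<^sup>2) * (norm v)\<^sup>2"
        by (simp add: power_mult_distrib algebra_simps)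
      \<comment> \<open>The error of the linear approximation is thus controlled by
        \<open>D p (v, u)\<close>, which is only the Taylor remainder since \<open>G\<close>
        vanishes at both points.\<close>
      have "T p (u - R' v) = D p (v, u)" by (simp add: R'_def Tp.add Tp.diff Tp.neg TSp split)
      then have "norm (u - R' v) \<le> 2 * B' * norm (D p (v, u))" using lowp[of "u - R' v"] by simp
      also have "\<dots> \<le> 2 * B' * (C' * ((1 + \<Lambda>\<^sup>2) * (norm v)\<^sup>2))"
        using pos by (intro mult_left_mono order_trans[OF rem] mult_left_mono[OF uv]) auto
      finally show "norm (R z' - R z - R' (z' - z)) \<le> 2 * B' * (C' * (1 + \<Lambda>\<^sup>2)) * (norm (z' - z))\<^sup>2"
        by (simp add: u_def v_def mult.assoc)
    qed
    then show ?thesis by (auto simp: differentiable_def)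
  qed
  show thesis
    using that[OF r(1) \<rho>(1), of R] R diff uniq by blast
qed

section \<open>A differentiable cutoff in an inner product space\<close>

text \<open>The building block of the cutoff: the squared positive part vanishes on a half line and
  is still differentiable at 0, because its first-order remainder lies between 0 and the square of
  the increment.\<close>

lemma DERIV_max_zero_square:
  "((\<lambda>s. (max 0 s)\<^sup>2) has_real_derivative 2 * max 0 x) (at (x :: real))"
  unfolding has_field_derivative_def
proof (rule has_derivative_quadratic_bound[where C=1 and e=1])
  fix y :: real
  have "0 \<le> (max 0 y)\<^sup>2 - (max 0 x)\<^sup>2 - 2 * max 0 x * (y - x)
      \<and> (max 0 y)\<^sup>2 - (max 0 x)\<^sup>2 - 2 * max 0 x * (y - x) \<le> (y - x)\<^sup>2"
  proof (cases "0 \<le> x")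
    case True
    have "y\<^sup>2 - x\<^sup>2 - 2 * x * (y - x) = (y - x)\<^sup>2" by (simp add: power2_eq_square algebra_simps)
    moreover have "0 \<le> - x\<^sup>2 - 2 * x * (y - x)" "- x\<^sup>2 - 2 * x * (y - x) \<le> (y - x)\<^sup>2" if "y < 0"
    proof -
      have "- x\<^sup>2 - 2 * x * (y - x) = x * x - 2 * (x * y)" by (simp add: power2_eq_square algebra_simps)
      moreover have "x * y \<le> 0" using True that by (simp add: mult_nonneg_nonpos)
      ultimately show "0 \<le> - x\<^sup>2 - 2 * x * (y - x)" using zero_le_square[of x] by linarith
      have "(y - x)\<^sup>2 - (- x\<^sup>2 - 2 * x * (y - x)) = y\<^sup>2" by (simp add: power2_eq_square algebra_simps)
      then show "- x\<^sup>2 - 2 * x * (y - x) \<le> (y - x)\<^sup>2" using zero_le_power2[of y] by linarith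
    qed
    ultimately show ?thesis using True by (cases "0 \<le> y") (auto simp: max_def)
  next
    case False
    then show ?thesis by (auto simp: max_def intro!: power_mono)
  qed
  then show "norm ((max 0 y)\<^sup>2 - (max 0 x)\<^sup>2 - 2 * max 0 x * (y - x)) \<le> 1 * (norm (y - x))\<^sup>2"
    by simp
qed (auto intro: bounded_linear_mult_right)

text \<open>The map is multiplied by a cutoff depending on the squared distance, which is
  differentiable everywhere in an inner product space. The values stay in \<open>V\<close> because
  they are multiples of values of \<open>R\<close>, or zero.\<close>

lemma differentiable_extension:
  fixes R :: "'a::real_inner \<Rightarrow> 'b::real_normed_vector"
  assumes "0 < r" and R: "\<And>z. z \<in> ball z0 r \<Longrightarrow> R differentiable (at z)"
    and V: "subspace V" "\<And>z. z \<in> ball z0 r \<Longrightarrow> R z \<in> V"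
  obtains R' where "\<And>z. R' differentiable (at z)" "\<And>z. R' z \<in> V"
    "\<And>z. z \<in> ball z0 (r/2) \<Longrightarrow> R' z = R z"
proof -
  define p :: "real \<Rightarrow> real" where "p s = (max 0 s)\<^sup>2" for s
  \<comment> \<open>\<open>cut\<close> is 1 where \<open>t \<le> 1\<close> and 0 where
    \<open>2 \<le> t\<close>. The factor 3 gives values of at most 3/4 on the half ball and at least
    3 outside the ball, so the cutoff vanishes before the boundary is reached.\<close>
  define t where "t z = 3 / r\<^sup>2 * ((z - z0) \<bullet> (z - z0))" for z
  define cut where "cut z = p (1 - p (t z - 1))" for z
  define R' where "R' z = cut z *\<^sub>R (if z \<in> ball z0 r then R z else 0)" for z
  have p: "p differentiable (at s)" for s
    using DERIV_max_zero_square[of s] unfolding p_def by (auto simp: real_differentiable_def)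
  have t: "t differentiable (at z)" for z
    unfolding t_def differentiable_def by (rule exI) (rule derivative_eq_intros refl)+
  have p_comp: "(\<lambda>z. p (g z)) differentiable (at z)" if "g differentiable (at z)" for g :: "'a \<Rightarrow> real" and z
    using differentiable_chain_at[OF that p] by (simp add: o_def)
  have cut: "cut differentiable (at z)" for z
    unfolding cut_def[abs_def] by (rule p_comp differentiable_diff differentiable_const t)+
  have cut1: "cut z = 1" if "z \<in> ball z0 (r/2)" for z
  proof -
    have "(norm (z - z0))\<^sup>2 \<le> (r/2)\<^sup>2"
      using that by (intro power_mono) (auto simp: dist_norm norm_minus_commute)
    then have "4 * ((z - z0) \<bullet> (z - z0)) \<le> r\<^sup>2"
      by (simp add: power2_norm_eq_inner power_divide)
    then have "3 * ((z - z0) \<bullet> (z - z0)) \<le> r\<^sup>2"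
      using inner_ge_zero[of "z - z0"] by linarith
    then have "t z \<le> 1"
      using \<open>0 < r\<close> by (simp add: t_def)
    then show ?thesis by (simp add: cut_def p_def)
  qed
  have cut0: "cut z = 0" if "2 \<le> t z" for z
  proof -
    have "1\<^sup>2 \<le> (t z - 1)\<^sup>2" using that by (intro power_mono) auto
    then show ?thesis using that by (simp add: cut_def p_def)
  qed
  have t_big: "2 < t z" if "z \<notin> ball z0 r" for z
  proof -
    have "r\<^sup>2 \<le> (norm (z - z0))\<^sup>2"
      using that \<open>0 < r\<close> by (intro power_mono) (auto simp: dist_norm norm_minus_commute)
    then have "3 * r\<^sup>2 \<le> 3 * ((z - z0) \<bullet> (z - z0))" by (simp add: power2_norm_eq_inner)
    then have "3 \<le> t z" using \<open>0 < r\<close> by (simp add: t_def field_simps)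
    then show ?thesis by simp
  qed
  show thesis
  proof (rule that)
    fix z
    show "R' z = R z" if "z \<in> ball z0 (r/2)"
    proof -
      have "z \<in> ball z0 r" using that \<open>0 < r\<close> subset_ball[of "r/2" r z0] by auto
      then show ?thesis using cut1[OF that] by (simp add: R'_def)
    qed
    show "R' z \<in> V"
      using V by (auto simp: R'_def intro: subspace_mul subspace_0)
    show "R' differentiable (at z)"
    proof (cases "z \<in> ball z0 r")
      case True
      have "(\<lambda>z. cut z *\<^sub>R R z) differentiable (at z)"
        by (intro differentiable_scaleR cut R True)
      then show ?thesis
      proof (rule differentiable_transform_within)
        show "0 < r - dist z0 z" using True by simp
        fix w assume "dist w z < r - dist z0 z"
        then have "w \<in> ball z0 r" using dist_triangle[of z0 w z] by (simp add: dist_commute)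
        then show "cut w *\<^sub>R R w = R' w" by (simp add: R'_def)
      qed simp
    next
      case False
      \<comment> \<open>By continuity \<open>t\<close> still exceeds 2 near \<open>z\<close>, so the
        product is locally zero and nothing is asked of \<open>R\<close> at boundary points.\<close>
      have "continuous (at z) t" by (rule differentiable_imp_continuous_within[OF t])
      then have "\<forall>\<^sub>F w in at z. 2 < t w"
        using t_big[OF False] by (auto simp: continuous_within order_tendsto_iff)
      then obtain d where d: "0 < d" "\<And>w. w \<noteq> z \<Longrightarrow> dist w z < d \<Longrightarrow> 2 < t w"
        by (auto simp: eventually_at)
      have "(\<lambda>_. 0) differentiable (at z)" by simp
      then show ?thesis
      proof (rule differentiable_transform_within[OF _ d(1)])
        fix w assume "dist w z < d"
        then have "2 < t w" using d(2)[of w] t_big[OF False] by (cases "w = z") auto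
        then show "0 = R' w" using cut0[of w] by (simp add: R'_def)
      qed simp
    qed
  qed
qed

section \<open>The Hilbert space on the line\<close>

lemma rep_line_L2: "rep_line f \<in> L2_fun lborel"
  using Quotient3_rep_reflp[OF Quotient3_line_L2, of f] by (simp add: L2_eq_def)

lemma rep_line_measurable [measurable]: "rep_line f \<in> borel_measurable lborel"
  using rep_line_L2[of f] by (simp add: L2_fun_def)

lemma rep_line_square_integrable: "integrable lborel (\<lambda>x. (rep_line f x)\<^sup>2)"
  using rep_line_L2[of f] by (simp add: L2_fun_def)

lemma rep_line_mult_integrable: "integrable lborel (\<lambda>x. rep_line f x * rep_line g x)"
  by (rule L2_fun_mult_integrable) (rule rep_line_L2)+

lemma rep_abs_line: "f \<in> L2_fun lborel \<Longrightarrow> AE x in lborel. rep_line (abs_line f) x = f x"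
  using Quotient3_rep_abs[OF Quotient3_line_L2, of f] by (simp add: L2_eq_def)

lemma line_L2_eqI: "AE x in lborel. rep_line f x = rep_line g x \<Longrightarrow> f = g"
  using Quotient3_rel_rep[OF Quotient3_line_L2, of f g] rep_line_L2[of f] rep_line_L2[of g]
  by (simp add: L2_eq_def)

text \<open>Representatives are chosen class by class, so the algebraic identities hold only off
  null sets. Every pointwise computation below collects such facts and eliminates them
  together.\<close>

lemma rep_line_add: "AE x in lborel. rep_line (f + g) x = rep_line f x + rep_line g x"
  using rep_abs_line[OF L2_fun_add[OF rep_line_L2 rep_line_L2, of f g]]
  by (simp add: plus_line_L2_def)

lemma rep_line_diff: "AE x in lborel. rep_line (f - g) x = rep_line f x - rep_line g x"
  using rep_abs_line[OF L2_fun_minus[OF rep_line_L2 rep_line_L2, of f g]]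
  by (simp add: minus_line_L2_def)

lemma rep_line_scaleR: "AE x in lborel. rep_line (c *\<^sub>R f) x = c * rep_line f x"
  using rep_abs_line[OF L2_fun_scale[OF rep_line_L2, of c f]]
  by (simp add: scaleR_line_L2_def)

lemma rep_line_zero: "AE x in lborel. rep_line 0 x = 0"
  using rep_abs_line[OF L2_fun_zero] by (simp add: zero_line_L2_def)

lemma inner_line: "f \<bullet> g = (\<integral>x. rep_line f x * rep_line g x \<partial>lborel)"
  by (simp add: inner_line_L2_def)

lemma norm_line: "(norm f)\<^sup>2 = (\<integral>x. (rep_line f x)\<^sup>2 \<partial>lborel)"
  unfolding power2_norm_eq_inner inner_line by (simp add: power2_eq_square)

lemma norm_abs_line:
  assumes "f \<in> L2_fun lborel"
  shows "(norm (abs_line f))\<^sup>2 = (\<integral>x. (f x)\<^sup>2 \<partial>lborel)"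
  unfolding norm_line
  by (rule integral_cong_AE)
    (use assms rep_abs_line[OF assms] in \<open>auto simp: L2_fun_def elim: AE_mp\<close>)

lemma L2_class_AE:
  assumes "(\<lambda>x. indicator S x * f x) \<in> L2_fun lborel"
  shows "AE x in lborel. rep_line (L2_class S f) x = indicator S x * f x"
  using rep_abs_line[OF assms] by (simp add: L2_class_def)

lemma L2_fun_indicator_mult:
  assumes "f \<in> L2_fun M" "S \<in> sets M"
  shows "(\<lambda>x. indicator S x * f x) \<in> L2_fun M"
proof -
  have [measurable]: "f \<in> borel_measurable M" "S \<in> sets M" using assms by (auto simp: L2_fun_def)
  have "integrable M (\<lambda>x. (indicator S x * f x)\<^sup>2)"
    by (rule Bochner_Integration.integrable_bound[of M "\<lambda>x. (f x)\<^sup>2"])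
      (use assms in \<open>auto simp: L2_fun_def indicator_def\<close>)
  then show ?thesis by (simp add: L2_fun_def)
qed

lemma bounded_on_interval_L2:
  assumes [measurable]: "f \<in> borel_measurable lborel"
    and f: "\<And>x. x \<in> {a..b} \<Longrightarrow> \<bar>f x\<bar> \<le> m" and "a \<le> b" "0 \<le> m"
  shows "(\<lambda>x. indicator {a..b} x * f x) \<in> L2_fun lborel"
    and "norm (L2_class {a..b} f) \<le> sqrt (b - a) * m"
proof -
  have bd: "(indicator {a..b} x * f x)\<^sup>2 \<le> indicator {a..b} x * m\<^sup>2" for x
    using abs_le_square_iff[of "f x" m] f[of x] \<open>0 \<le> m\<close> by (auto simp: indicator_def)
  have int: "integrable lborel (\<lambda>x. indicator {a..b} x * m\<^sup>2)"
    using \<open>a \<le> b\<close> by (intro integrable_mult_left) (simp add: integrable_indicator_iff)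
  show L2: "(\<lambda>x. indicator {a..b} x * f x) \<in> L2_fun lborel"
    unfolding L2_fun_def using bd
    by (auto intro!: Bochner_Integration.integrable_bound[OF int])
  have "(norm (L2_class {a..b} f))\<^sup>2 = (\<integral>x. (indicator {a..b} x * f x)\<^sup>2 \<partial>lborel)"
    unfolding L2_class_def by (rule norm_abs_line[OF L2])
  also have "\<dots> \<le> (\<integral>x. indicator {a..b} x * m\<^sup>2 \<partial>lborel)"
    using L2 int bd by (intro integral_mono) (auto simp: L2_fun_def)
  also have "\<dots> = (b - a) * m\<^sup>2" using \<open>a \<le> b\<close> by simp
  also have "\<dots> = (sqrt (b - a) * m)\<^sup>2" using \<open>a \<le> b\<close> by (simp add: power_mult_distrib)
  finally show "norm (L2_class {a..b} f) \<le> sqrt (b - a) * m"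
    by (rule power2_le_imp_le) (use assms in simp)
qed

section \<open>Products of square integrable functions as integrable functions\<close>

text \<open>With absolute values available inside the Hilbert space, the abstract Cauchy-Schwarz
  inequality bounds integrals of products of absolute values.\<close>

definition line_abs :: "line_L2 \<Rightarrow> line_L2" where
  "line_abs f = abs_line (\<lambda>x. \<bar>rep_line f x\<bar>)"

lemma rep_line_abs: "AE x in lborel. rep_line (line_abs f) x = \<bar>rep_line f x\<bar>"
  unfolding line_abs_def
  by (rule rep_abs_line) (use rep_line_L2[of f] in \<open>auto simp: L2_fun_def\<close>)

lemma norm_line_abs: "norm (line_abs f) = norm f"
proof -
  have "(norm (line_abs f))\<^sup>2 = (norm f)\<^sup>2"
    unfolding norm_line
    by (rule integral_cong_AE) (use rep_line_abs[of f] in \<open>auto elim: AE_mp\<close>)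
  then show ?thesis by simp
qed

text \<open>Cauchy-Schwarz for \<open>line_abs f + line_abs g\<close> and
  \<open>line_abs h + line_abs k\<close>. The pointwise remainders below are quadratic in the
  increments, and this is how they become integrable.\<close>

lemma integral_abs_mult_le:
  "integrable lborel (\<lambda>x. (\<bar>rep_line f x\<bar> + \<bar>rep_line g x\<bar>) * (\<bar>rep_line h x\<bar> + \<bar>rep_line k x\<bar>))"
  (is "integrable _ ?p")
  "(\<integral>x. (\<bar>rep_line f x\<bar> + \<bar>rep_line g x\<bar>) * (\<bar>rep_line h x\<bar> + \<bar>rep_line k x\<bar>) \<partial>lborel)
    \<le> (norm f + norm g) * (norm h + norm k)"
proof -
  define u v where "u = line_abs f + line_abs g" and "v = line_abs h + line_abs k"
  have u: "AE x in lborel. rep_line u x = \<bar>rep_line f x\<bar> + \<bar>rep_line g x\<bar>"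
    unfolding u_def using rep_line_add[of "line_abs f" "line_abs g"] rep_line_abs[of f] rep_line_abs[of g]
    by eventually_elim simp
  have v: "AE x in lborel. rep_line v x = \<bar>rep_line h x\<bar> + \<bar>rep_line k x\<bar>"
    unfolding v_def using rep_line_add[of "line_abs h" "line_abs k"] rep_line_abs[of h] rep_line_abs[of k]
    by eventually_elim simp
  have eq: "AE x in lborel. rep_line u x * rep_line v x = ?p x"
    using u v by eventually_elim simp
  show "integrable lborel ?p"
    by (rule integrable_cong_AE_imp[OF rep_line_mult_integrable[of u v] _ eq]) measurable
  have "integral\<^sup>L lborel ?p = u \<bullet> v"
    unfolding inner_line by (rule integral_cong_AE) (use eq in \<open>auto elim: AE_mp\<close>)
  also have "\<dots> \<le> norm u * norm v" by (rule norm_cauchy_schwarz)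
  also have "\<dots> \<le> (norm f + norm g) * (norm h + norm k)"
    unfolding u_def v_def
    by (intro mult_mono order_trans[OF norm_triangle_ineq]) (simp_all add: norm_line_abs)
  finally show "integral\<^sup>L lborel ?p \<le> (norm f + norm g) * (norm h + norm k)" .
qed

lemma line_L2_eq_0_iff: "f = 0 \<longleftrightarrow> (AE x in lborel. rep_line f x = 0)"
proof
  assume "AE x in lborel. rep_line f x = 0"
  with rep_line_zero have "AE x in lborel. rep_line f x = rep_line 0 x" by eventually_elim simp
  then show "f = 0" by (rule line_L2_eqI)
qed (simp add: rep_line_zero)

lemma norm_fst_plus_snd_le: "norm (fst h) + norm (snd h) \<le> 2 * norm h"
  using norm_fst_le[of "fst h" "snd h"] norm_snd_le[of "snd h" "fst h"] by simp

lemma integral_le_square_bound: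
  fixes f :: "real \<Rightarrow> real" and h k :: "line_L2 \<times> line_L2"
  assumes f: "integrable lborel f" and "0 \<le> c"
    and bd: "AE s in lborel. \<bar>f s\<bar> \<le> c *
      ((\<bar>rep_line (fst h) s\<bar> + \<bar>rep_line (snd h) s\<bar>) * (\<bar>rep_line (fst k) s\<bar> + \<bar>rep_line (snd k) s\<bar>))"
  shows "(\<integral>s. \<bar>f s\<bar> \<partial>lborel) \<le> 4 * c * (norm h * norm k)"
proof -
  have "(\<integral>s. \<bar>f s\<bar> \<partial>lborel) \<le> (\<integral>s. c *
      ((\<bar>rep_line (fst h) s\<bar> + \<bar>rep_line (snd h) s\<bar>) * (\<bar>rep_line (fst k) s\<bar> + \<bar>rep_line (snd k) s\<bar>)) \<partial>lborel)"
    by (intro integral_mono_AE bd integrable_abs f integrable_mult_right integral_abs_mult_le)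
  also have "\<dots> \<le> c * ((norm (fst h) + norm (snd h)) * (norm (fst k) + norm (snd k)))"
    by (subst integral_mult_right_zero) (intro mult_left_mono integral_abs_mult_le \<open>0 \<le> c\<close>)
  \<comment> \<open>Each sum of two component norms costs a factor 2, hence the 4 in the
    conclusion.\<close>
  also have "\<dots> \<le> c * ((2 * norm h) * (2 * norm k))"
    by (intro mult_left_mono mult_mono norm_fst_plus_snd_le \<open>0 \<le> c\<close>) auto
  finally show ?thesis by simp
qed

lemma rep_line_add_fst_snd:
  "AE s in lborel. rep_line (fst (v + h)) s = rep_line (fst v) s + rep_line (fst h) s \<and>
    rep_line (snd (v + h)) s = rep_line (snd v) s + rep_line (snd h) s"
  using rep_line_add[of "fst v" "fst h"] rep_line_add[of "snd v" "snd h"]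
  by eventually_elim simp

section \<open>Completeness: the Riesz-Fischer theorem\<close>

text \<open>The sequence is the telescoping sum of its increments, and almost everywhere the
  increments are dominated by a convergent geometric series.\<close>

lemma AE_convergent_fast_Cauchy:
  fixes f :: "nat \<Rightarrow> line_L2"
  assumes f: "\<And>n. norm (f (Suc n) - f n) \<le> (1/4) ^ n"
  shows "AE x in lborel. convergent (\<lambda>n. rep_line (f n) x)"
proof -
  define d where "d n x = rep_line (f (Suc n)) x - rep_line (f n) x" for n x
  have [measurable]: "d n \<in> borel_measurable lborel" for n unfolding d_def by measurable
  have dsq: "integrable lborel (\<lambda>x. (d n x)\<^sup>2)" for n
    using L2_fun_minus[OF rep_line_L2 rep_line_L2, of "f (Suc n)" "f n"] by (simp add: L2_fun_def d_def)
  have dint: "(\<integral>x. (d n x)\<^sup>2 \<partial>lborel) \<le> (1/16) ^ n" for n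
  proof -
    have "(\<integral>x. (d n x)\<^sup>2 \<partial>lborel) = (norm (f (Suc n) - f n))\<^sup>2"
      unfolding norm_line d_def
      by (rule integral_cong_AE) (use rep_line_diff[of "f (Suc n)" "f n"] in \<open>auto elim: AE_mp\<close>)
    also have "\<dots> \<le> ((1/4) ^ n)\<^sup>2" using f by (intro power_mono) auto
    also have "\<dots> = (1/16 :: real) ^ n" by (simp add: power2_eq_square flip: power_mult_distrib)
    finally show ?thesis .
  qed
  txt \<open>The weights \<open>4 ^ n\<close> turn almost everywhere finiteness of the sum into a geometric bound on \<open>d n x\<close>.\<close>
  have "(\<integral>\<^sup>+x. (\<Sum>n. ennreal (4 ^ n * (d n x)\<^sup>2)) \<partial>lborel) = (\<Sum>n. \<integral>\<^sup>+x. ennreal (4 ^ n * (d n x)\<^sup>2) \<partial>lborel)"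
    by (rule nn_integral_suminf) measurable
  also have "\<dots> \<le> (\<Sum>n. ennreal ((1/4) ^ n))"
  proof (rule suminf_le)
    fix n
    have "(\<integral>\<^sup>+x. ennreal (4 ^ n * (d n x)\<^sup>2) \<partial>lborel) = ennreal (4 ^ n * (\<integral>x. (d n x)\<^sup>2 \<partial>lborel))"
      using dsq[of n] by (subst nn_integral_eq_integral) auto
    also have "\<dots> \<le> ennreal (4 ^ n * (1/16) ^ n)"
      by (intro ennreal_leI mult_left_mono dint) auto
    also have "4 ^ n * (1/16) ^ n = (1/4 :: real) ^ n" by (simp flip: power_mult_distrib)
    finally show "(\<integral>\<^sup>+x. ennreal (4 ^ n * (d n x)\<^sup>2) \<partial>lborel) \<le> ennreal ((1/4) ^ n)" .
  qed auto
  also have "\<dots> < \<infinity>"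
    using summable_geometric[of "1/4 :: real"] by (subst suminf_ennreal2) (auto simp: top.not_eq_extremum)
  finally have "AE x in lborel. (\<Sum>n. ennreal (4 ^ n * (d n x)\<^sup>2)) \<noteq> \<infinity>"
    by (intro nn_integral_PInf_AE) auto
  then show ?thesis
  proof eventually_elim
    fix x assume "(\<Sum>n. ennreal (4 ^ n * (d n x)\<^sup>2)) \<noteq> \<infinity>"
    then have "summable (\<lambda>n. 4 ^ n * (d n x)\<^sup>2)"
      by (intro summable_suminf_not_top) auto
    then have "Bseq (\<lambda>n. 4 ^ n * (d n x)\<^sup>2)"
      by (intro convergent_imp_Bseq) (auto intro: convergentI dest: summable_LIMSEQ_zero)
    then obtain K where K: "0 < K" "\<And>n. norm (4 ^ n * (d n x)\<^sup>2) \<le> K" by (auto simp: Bseq_def)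
    have "\<bar>d n x\<bar> \<le> sqrt K * (1/2) ^ n" for n
    proof (rule power2_le_imp_le)
      have "((1/2 :: real) ^ n)\<^sup>2 = (1/4) ^ n"
        by (simp add: power2_eq_square flip: power_mult_distrib)
      then have "(sqrt K * (1/2) ^ n)\<^sup>2 = K * (1/4) ^ n"
        using K(1) by (simp add: power_mult_distrib)
      moreover have "(d n x)\<^sup>2 \<le> K / 4 ^ n"
        using K(2)[of n] by (simp add: pos_le_divide_eq mult.commute)
      ultimately show "\<bar>d n x\<bar>\<^sup>2 \<le> (sqrt K * (1/2) ^ n)\<^sup>2"
        by (simp add: power_divide)
    qed (use K in simp)
    moreover have "summable (\<lambda>n. sqrt K * (1/2 :: real) ^ n)"
      by (intro summable_mult summable_geometric) simp
    ultimately have "summable (\<lambda>n. d n x)"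
      by (intro summable_comparison_test'[of "\<lambda>n. sqrt K * (1/2) ^ n" 0 "\<lambda>n. d n x"]) simp_all
    then have "convergent (\<lambda>n. \<Sum>i<n. d i x)" by (simp add: summable_iff_convergent)
    moreover have "(\<Sum>i<n. d i x) = rep_line (f n) x - rep_line (f 0) x" for n
      unfolding d_def by (rule sum_lessThan_telescope)
    ultimately have "convergent (\<lambda>n. rep_line (f n) x - rep_line (f 0) x)" by simp
    then show "convergent (\<lambda>n. rep_line (f n) x)"
      by (simp add: convergent_diff_const_right_iff)
  qed
qed

text \<open>Fatou's lemma, applied to the squared differences with the later index tending to
  infinity, bounds the distance from \<open>f n\<close> to the pointwise limit. This yields at once
  that the limit is square integrable and that convergence holds in norm.\<close>

lemma line_L2_fast_Cauchy_convergent: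
  fixes f :: "nat \<Rightarrow> line_L2"
  assumes f: "\<And>m n. n \<le> m \<Longrightarrow> norm (f m - f n) \<le> (1/4) ^ n"
  shows "convergent f"
proof -
  \<comment> \<open>Points of divergence form a null set; the unspecified value of
    \<open>lim\<close> there does not destroy measurability.\<close>
  define g where "g x = lim (\<lambda>n. rep_line (f n) x)" for x
  have [measurable]: "g \<in> borel_measurable lborel"
    unfolding g_def by (rule borel_measurable_lim_metric) measurable
  have lim: "AE x in lborel. (\<lambda>n. rep_line (f n) x) \<longlonglongrightarrow> g x"
    using AE_convergent_fast_Cauchy[of f] f by (auto simp: g_def convergent_LIMSEQ_iff)
  have bound: "(\<integral>\<^sup>+x. ennreal ((g x - rep_line (f n) x)\<^sup>2) \<partial>lborel) \<le> ennreal (((1/4) ^ n)\<^sup>2)" for n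
  proof -
    have "(\<integral>\<^sup>+x. ennreal ((g x - rep_line (f n) x)\<^sup>2) \<partial>lborel)
        = (\<integral>\<^sup>+x. liminf (\<lambda>m. ennreal ((rep_line (f m) x - rep_line (f n) x)\<^sup>2)) \<partial>lborel)"
    proof (rule nn_integral_cong_AE, use lim in eventually_elim)
      case (elim x)
      then have "(\<lambda>m. ennreal ((rep_line (f m) x - rep_line (f n) x)\<^sup>2)) \<longlonglongrightarrow> ennreal ((g x - rep_line (f n) x)\<^sup>2)"
        by (intro tendsto_intros tendsto_ennrealI)
      then show ?case by (rule lim_imp_Liminf[OF trivial_limit_sequentially, symmetric])
    qed
    also have "\<dots> \<le> liminf (\<lambda>m. \<integral>\<^sup>+x. ennreal ((rep_line (f m) x - rep_line (f n) x)\<^sup>2) \<partial>lborel)"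
      by (rule nn_integral_liminf) measurable
    also have "\<dots> \<le> liminf (\<lambda>m. ennreal (((1/4) ^ n)\<^sup>2))"
    proof (rule Liminf_mono, rule eventually_sequentiallyI[of n])
      fix m assume "n \<le> m"
      have "(\<integral>\<^sup>+x. ennreal ((rep_line (f m) x - rep_line (f n) x)\<^sup>2) \<partial>lborel)
          = (\<integral>\<^sup>+x. ennreal ((rep_line (f m - f n) x)\<^sup>2) \<partial>lborel)"
        by (rule nn_integral_cong_AE) (use rep_line_diff[of "f m" "f n"] in eventually_elim, simp)
      also have "\<dots> = ennreal ((norm (f m - f n))\<^sup>2)"
        unfolding norm_line by (rule nn_integral_eq_integral) (auto simp: rep_line_square_integrable)
      also have "\<dots> \<le> ennreal (((1/4) ^ n)\<^sup>2)"
        using f[OF \<open>n \<le> m\<close>] by (intro ennreal_leI power_mono) auto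
      finally show "(\<integral>\<^sup>+x. ennreal ((rep_line (f m) x - rep_line (f n) x)\<^sup>2) \<partial>lborel) \<le> ennreal (((1/4) ^ n)\<^sup>2)" .
    qed
    finally show ?thesis by (simp add: Liminf_const)
  qed
  have diff_L2: "(\<lambda>x. g x - rep_line (f n) x) \<in> L2_fun lborel" for n
  proof -
    have "(\<integral>\<^sup>+x. ennreal ((g x - rep_line (f n) x)\<^sup>2) \<partial>lborel) < \<infinity>"
      using bound[of n] by (rule le_less_trans) simp
    then have "integrable lborel (\<lambda>x. (g x - rep_line (f n) x)\<^sup>2)"
      by (intro integrableI_nonneg) auto
    then show ?thesis by (simp add: L2_fun_def)
  qed
  have g: "g \<in> L2_fun lborel"
    using L2_fun_add[OF diff_L2[of 0] rep_line_L2[of "f 0"]] by simp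
  have "norm (abs_line g - f n) \<le> (1/4) ^ n" for n
  proof (rule power2_le_imp_le)
    have "(norm (abs_line g - f n))\<^sup>2 = (\<integral>x. (g x - rep_line (f n) x)\<^sup>2 \<partial>lborel)"
      unfolding norm_line
    proof (rule integral_cong_AE)
      show "AE x in lborel. (rep_line (abs_line g - f n) x)\<^sup>2 = (g x - rep_line (f n) x)\<^sup>2"
        using rep_line_diff[of "abs_line g" "f n"] rep_abs_line[OF g] by eventually_elim simp
    qed measurable
    moreover have "ennreal (\<integral>x. (g x - rep_line (f n) x)\<^sup>2 \<partial>lborel) \<le> ennreal (((1/4) ^ n)\<^sup>2)"
      using bound[of n] diff_L2[of n] by (subst (asm) nn_integral_eq_integral) (auto simp: L2_fun_def)
    ultimately show "(norm (abs_line g - f n))\<^sup>2 \<le> ((1/4) ^ n)\<^sup>2" by simp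
  qed simp
  then have "(\<lambda>n. f n - abs_line g) \<longlonglongrightarrow> 0"
    by (intro Lim_null_comparison[OF _ LIMSEQ_realpow_zero[of "1/4"]]) (auto simp: norm_minus_commute)
  then have "f \<longlonglongrightarrow> abs_line g" by (rule LIM_zero_cancel)
  then show ?thesis by (rule convergentI)
qed

instance line_L2 :: banach
proof
  fix X :: "nat \<Rightarrow> line_L2" assume X: "Cauchy X"
  have "\<exists>N. \<forall>m\<ge>N. \<forall>n\<ge>N. norm (X m - X n) < (1/4) ^ k" for k
    using CauchyD[OF X, of "(1/4) ^ k"] by simp
  then obtain N where N: "\<And>k m n. N k \<le> m \<Longrightarrow> N k \<le> n \<Longrightarrow> norm (X m - X n) < (1/4) ^ k" by metis
  \<comment> \<open>The sum dominates the threshold \<open>N k\<close>, and the summand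
    \<open>k\<close> makes the indices strictly increasing.\<close>
  define r where "r k = (\<Sum>i\<le>k. N i) + k" for k
  have Nr: "N k \<le> r k" for k
    unfolding r_def by (rule trans_le_add1) (rule member_le_sum, auto)
  have r: "strict_mono r" by (rule strict_mono_Suc_iff[THEN iffD2]) (simp add: r_def)
  have "convergent (X \<circ> r)"
  proof (rule line_L2_fast_Cauchy_convergent)
    fix m n :: nat assume "n \<le> m"
    then have "r n \<le> r m" using r by (simp add: strict_mono_less_eq)
    then show "norm ((X \<circ> r) m - (X \<circ> r) n) \<le> (1/4) ^ n"
      using N[of n "r m" "r n"] Nr[of n] by simp
  qed
  then obtain l where "(X \<circ> r) \<longlonglongrightarrow> l" by (auto simp: convergent_def)
  then show "convergent X" using Cauchy_converges_subseq[OF X r] by (auto simp: convergent_def)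
qed

section \<open>Double integrals\<close>

lemma set_integral_abs_le:
  fixes f :: "real \<Rightarrow> real"
  assumes "integrable lborel f"
  shows "\<bar>LBINT s:A. f s\<bar> \<le> (\<integral>s. \<bar>f s\<bar> \<partial>lborel)"
proof (cases "set_integrable lborel A f")
  case True
  have "\<bar>LBINT s:A. f s\<bar> \<le> (LBINT s:A. \<bar>f s\<bar>)"
    using integral_norm_bound[of lborel "\<lambda>s. indicator A s *\<^sub>R f s"]
    by (simp add: set_lebesgue_integral_def abs_mult)
  also have "\<dots> \<le> (\<integral>s. \<bar>f s\<bar> \<partial>lborel)"
    unfolding set_lebesgue_integral_def
    using True assms
    by (intro integral_mono) (auto simp: set_integrable_def indicator_def abs_mult dest: integrable_abs)
  finally show ?thesis .
next
  \<comment> \<open>No measurability of \<open>A\<close> is assumed; a non-integrable integrand has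
    integral 0 by convention, and the bound is nonnegative.\<close>
  case False
  then show ?thesis by (simp add: set_lebesgue_integral_def set_integrable_def not_integrable_integral_eq)
qed

lemma set_integrable_lborel:
  fixes f :: "real \<Rightarrow> real"
  assumes "integrable lborel f" "A \<in> sets borel"
  shows "set_integrable lborel A f"
  unfolding set_integrable_def using assms by (intro integrable_mult_indicator) auto

lemma measurable_integral_upto [measurable]:
  fixes f :: "real \<Rightarrow> real"
  assumes [measurable]: "f \<in> borel_measurable borel"
  shows "(\<lambda>y. LBINT s:{0..y}. f s) \<in> borel_measurable borel"
proof -
  \<comment> \<open>The moving domain is put into the integrand, which is jointly measurable in
    \<open>y\<close> and \<open>s\<close>.\<close>
  have "(\<lambda>y. LBINT s:{0..y}. f s) = (\<lambda>y. \<integral>s. (if 0 \<le> s \<and> s \<le> y then f s else 0) \<partial>lborel)"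
    by (intro ext) (auto simp: set_lebesgue_integral_def indicator_def intro!: Bochner_Integration.integral_cong)
  also have "\<dots> \<in> borel_measurable borel"
    by (rule lborel.borel_measurable_lebesgue_integral) measurable
  finally show ?thesis .
qed

lemma measurable_dbl_int [measurable]:
  "f \<in> borel_measurable borel \<Longrightarrow> dbl_int f \<in> borel_measurable borel"
  unfolding dbl_int_def[abs_def] by measurable

lemma set_integrable_integral_upto:
  fixes f :: "real \<Rightarrow> real"
  assumes "integrable lborel f"
  shows "set_integrable lborel {0..x} (\<lambda>y. LBINT s:{0..y}. f s)"
  unfolding set_integrable_def
proof (rule Bochner_Integration.integrable_bound)
  show "integrable lborel (\<lambda>y. indicator {0..x} y *\<^sub>R (\<integral>s. \<bar>f s\<bar> \<partial>lborel))"
    by (intro integrable_scaleR_left) (simp add: integrable_indicator_iff emeasure_lborel_Icc_eq)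
  show "(\<lambda>y. indicator {0..x} y *\<^sub>R (LBINT s:{0..y}. f s)) \<in> borel_measurable lborel"
    using assms by (auto dest: borel_measurable_integrable)
  show "AE y in lborel. norm (indicator {0..x} y *\<^sub>R (LBINT s:{0..y}. f s))
      \<le> norm (indicator {0..x} y *\<^sub>R (\<integral>s. \<bar>f s\<bar> \<partial>lborel))"
    using set_integral_abs_le[OF assms]
    by (auto simp: indicator_def intro!: order_trans[OF set_integral_abs_le[OF assms]])
qed

text \<open>The inner integral is bounded by the L1 norm uniformly in \<open>y\<close>, and the
  outer one contributes the length of the interval. Two integrations thus make an integrable density
  bounded, hence square integrable on a finite interval.\<close>

lemma dbl_int_abs_le:
  assumes "integrable lborel f" "0 \<le> x"
  shows "\<bar>dbl_int f x\<bar> \<le> x * (\<integral>s. \<bar>f s\<bar> \<partial>lborel)"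
proof -
  have int: "integrable lborel (\<lambda>y. indicator {0..x} y * (\<integral>s. \<bar>f s\<bar> \<partial>lborel))"
    by (intro integrable_mult_left) (simp add: integrable_indicator_iff emeasure_lborel_Icc_eq)
  have "\<bar>dbl_int f x\<bar> \<le> (\<integral>y. \<bar>indicator {0..x} y *\<^sub>R (LBINT s:{0..y}. f s)\<bar> \<partial>lborel)"
    using integral_norm_bound[of lborel "\<lambda>y. indicator {0..x} y *\<^sub>R (LBINT s:{0..y}. f s)"]
    by (simp add: dbl_int_def set_lebesgue_integral_def)
  also have "\<dots> \<le> (\<integral>y. indicator {0..x} y * (\<integral>s. \<bar>f s\<bar> \<partial>lborel) \<partial>lborel)"
    using set_integrable_integral_upto[OF assms(1), of x] set_integral_abs_le[OF assms(1)] int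
    by (intro integral_mono) (auto simp: set_integrable_def indicator_def)
  also have "\<dots> = x * (\<integral>s. \<bar>f s\<bar> \<partial>lborel)" using \<open>0 \<le> x\<close> by simp
  finally show ?thesis .
qed

lemma dbl_int_add:
  assumes "integrable lborel f" "integrable lborel g"
  shows "dbl_int (\<lambda>s. f s + g s) x = dbl_int f x + dbl_int g x"
proof -
  have "(LBINT s:{0..y}. f s + g s) = (LBINT s:{0..y}. f s) + (LBINT s:{0..y}. g s)" for y
    by (intro set_integral_add set_integrable_lborel assms) auto
  then show ?thesis
    unfolding dbl_int_def by (simp only: set_integral_add(2)[OF set_integrable_integral_upto set_integrable_integral_upto] assms)
qed

lemma dbl_int_cmult: "dbl_int (\<lambda>s. c * f s) x = c * dbl_int f x"
  by (simp add: dbl_int_def)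

lemma dbl_int_sum:
  assumes "\<And>k. k \<in> A \<Longrightarrow> integrable lborel (f k)"
  shows "dbl_int (\<lambda>s. \<Sum>k\<in>A. c k * f k s) x = (\<Sum>k\<in>A. c k * dbl_int (f k) x)"
  using assms
proof (induction A rule: infinite_finite_induct)
  case (insert k A)
  then show ?case
    by (simp add: dbl_int_add dbl_int_cmult)
qed (simp_all add: dbl_int_def)

lemma dbl_int_cong_AE:
  assumes [measurable]: "f \<in> borel_measurable borel" "g \<in> borel_measurable borel"
    and "AE s in lborel. f s = g s"
  shows "dbl_int f x = dbl_int g x"
proof -
  have "(LBINT s:{0..y}. f s) = (LBINT s:{0..y}. g s)" for y
    unfolding set_lebesgue_integral_def
    by (rule integral_cong_AE; (measurable)?) (use assms(3) in eventually_elim, simp)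
  then show ?thesis by (simp add: dbl_int_def)
qed

section \<open>From reaction densities to the three equations\<close>

text \<open>The contribution of a reaction density to the three constraint equations once the first
  two are multiplied by \<open>k_eff P\<close> and \<open>sigma_eff P\<close>. Fed with the
  linearised density it gives the integral terms of \<open>DO\<close>, so one linear map serves
  both.\<close>

definition green :: "cell \<Rightarrow> (real \<Rightarrow> real) \<Rightarrow> potential \<times> real" where
  "green P w =
    ((L2_class {0..L P} (\<lambda>x. dbl_int w x - x * (LBINT s:{0..L P}. w s)),
      L2_class {L1 P..L P} (\<lambda>x. - dbl_int w x)),
     LBINT s:{0..L P}. w s)"

lemma L2_class_eqI:
  assumes "(\<lambda>x. indicator S x * f x) \<in> L2_fun lborel"
    and "AE x in lborel. rep_line u x = indicator S x * f x"
  shows "u = L2_class S f"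
  by (rule line_L2_eqI) (use assms(2) L2_class_AE[OF assms(1)] in eventually_elim, simp)

context
  fixes P :: cell
  assumes P: "valid_cell P"
begin

lemma cell_len: "0 < L1 P" "L1 P < L P" "0 < L P"
  using P by (auto simp: valid_cell_def)

lemma green_component_L2:
  assumes w: "integrable lborel w"
  shows "(\<lambda>x. indicator {0..L P} x * (dbl_int w x - x * (LBINT s:{0..L P}. w s))) \<in> L2_fun lborel"
    "(\<lambda>x. indicator {L1 P..L P} x * - dbl_int w x) \<in> L2_fun lborel"
    "norm (L2_class {0..L P} (\<lambda>x. dbl_int w x - x * (LBINT s:{0..L P}. w s)))
      \<le> sqrt (L P) * (2 * L P * (\<integral>s. \<bar>w s\<bar> \<partial>lborel))"
    "norm (L2_class {L1 P..L P} (\<lambda>x. - dbl_int w x)) \<le> sqrt (L P - L1 P) * (L P * (\<integral>s. \<bar>w s\<bar> \<partial>lborel))"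
proof -
  have [measurable]: "w \<in> borel_measurable borel" using w by auto
  have n: "0 \<le> (\<integral>s. \<bar>w s\<bar> \<partial>lborel)" by simp
  have d: "\<bar>dbl_int w x\<bar> \<le> L P * (\<integral>s. \<bar>w s\<bar> \<partial>lborel)" if "0 \<le> x" "x \<le> L P" for x
    using dbl_int_abs_le[OF w that(1)] mult_right_mono[OF that(2) n] by linarith
  have d1: "\<bar>dbl_int w x - x * (LBINT s:{0..L P}. w s)\<bar> \<le> 2 * L P * (\<integral>s. \<bar>w s\<bar> \<partial>lborel)"
    if "x \<in> {0..L P}" for x
  proof -
    have "\<bar>x * (LBINT s:{0..L P}. w s)\<bar> \<le> L P * (\<integral>s. \<bar>w s\<bar> \<partial>lborel)"
      unfolding abs_mult using that by (intro mult_mono set_integral_abs_le w) auto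
    then show ?thesis using d[of x] that by auto
  qed
  have m1: "(\<lambda>x. dbl_int w x - x * (LBINT s:{0..L P}. w s)) \<in> borel_measurable lborel"
    and m2: "(\<lambda>x. - dbl_int w x) \<in> borel_measurable lborel" by measurable
  note 1 = bounded_on_interval_L2[OF m1 d1]
  show "(\<lambda>x. indicator {0..L P} x * (dbl_int w x - x * (LBINT s:{0..L P}. w s))) \<in> L2_fun lborel"
    "norm (L2_class {0..L P} (\<lambda>x. dbl_int w x - x * (LBINT s:{0..L P}. w s)))
      \<le> sqrt (L P) * (2 * L P * (\<integral>s. \<bar>w s\<bar> \<partial>lborel))"
    using 1[of 0 "L P"] cell_len n by simp_all
  have d2: "\<bar>- dbl_int w x\<bar> \<le> L P * (\<integral>s. \<bar>w s\<bar> \<partial>lborel)" if "x \<in> {L1 P..L P}" for x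
    using d[of x] that cell_len by simp
  note 2 = bounded_on_interval_L2[OF m2 d2]
  show "(\<lambda>x. indicator {L1 P..L P} x * - dbl_int w x) \<in> L2_fun lborel"
    "norm (L2_class {L1 P..L P} (\<lambda>x. - dbl_int w x)) \<le> sqrt (L P - L1 P) * (L P * (\<integral>s. \<bar>w s\<bar> \<partial>lborel))"
    using 2[of "L1 P" "L P"] cell_len n by simp_all
qed

lemma green_norm_le:
  obtains K where "0 < K" "\<And>w. integrable lborel w \<Longrightarrow> norm (green P w) \<le> K * (\<integral>s. \<bar>w s\<bar> \<partial>lborel)"
proof
  \<comment> \<open>One summand for each component of \<open>green\<close>; in the first, the double
    integral and the linear term in \<open>x\<close> each contribute \<open>L P\<close>.\<close>
  let ?K = "sqrt (L P) * (2 * L P) + sqrt (L P - L1 P) * L P + 1"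
  show "0 < ?K" using cell_len by (simp add: add_nonneg_pos)
  fix w :: "real \<Rightarrow> real" assume w: "integrable lborel w"
  have "norm (green P w) \<le> norm (L2_class {0..L P} (\<lambda>x. dbl_int w x - x * (LBINT s:{0..L P}. w s)))
      + norm (L2_class {L1 P..L P} (\<lambda>x. - dbl_int w x)) + norm (LBINT s:{0..L P}. w s)"
    unfolding green_def by (intro order_trans[OF norm_Pair_le] add_right_mono norm_Pair_le)
  also have "\<dots> \<le> sqrt (L P) * (2 * L P * (\<integral>s. \<bar>w s\<bar> \<partial>lborel))
      + sqrt (L P - L1 P) * (L P * (\<integral>s. \<bar>w s\<bar> \<partial>lborel)) + (\<integral>s. \<bar>w s\<bar> \<partial>lborel)"
    using set_integral_abs_le[OF w, of "{0..L P}"] by (intro add_mono green_component_L2 w) simp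
  also have "\<dots> = ?K * (\<integral>s. \<bar>w s\<bar> \<partial>lborel)" by (simp add: algebra_simps)
  finally show "norm (green P w) \<le> ?K * (\<integral>s. \<bar>w s\<bar> \<partial>lborel)" .
qed

lemma green_add:
  assumes "integrable lborel v" "integrable lborel w"
  shows "green P (\<lambda>s. v s + w s) = green P v + green P w"
proof -
  have vw: "integrable lborel (\<lambda>s. v s + w s)" using assms by simp
  have i: "(LBINT s:{0..L P}. v s + w s) = (LBINT s:{0..L P}. v s) + (LBINT s:{0..L P}. w s)"
    by (intro set_integral_add set_integrable_lborel assms) auto
  \<comment> \<open>Four facts per density: the square integrability statements are 1 and 2 for
    \<open>v\<close>, 5 and 6 for \<open>w\<close>, 9 and 10 for the sum.\<close>
  note L2 = green_component_L2[OF assms(1)] green_component_L2[OF assms(2)] green_component_L2[OF vw]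
  let ?a = "\<lambda>w x. dbl_int w x - x * (LBINT s:{0..L P}. w s)" and ?b = "\<lambda>w x. - dbl_int w x"
  have "L2_class {0..L P} (?a v) + L2_class {0..L P} (?a w) = L2_class {0..L P} (?a (\<lambda>s. v s + w s))"
    by (rule L2_class_eqI[OF L2(9)])
      (use rep_line_add[of "L2_class {0..L P} (?a v)" "L2_class {0..L P} (?a w)"] L2_class_AE[OF L2(1)] L2_class_AE[OF L2(5)] in
        eventually_elim, simp add: i dbl_int_add[OF assms] algebra_simps)
  moreover have "L2_class {L1 P..L P} (?b v) + L2_class {L1 P..L P} (?b w) = L2_class {L1 P..L P} (?b (\<lambda>s. v s + w s))"
    by (rule L2_class_eqI[OF L2(10)])
      (use rep_line_add[of "L2_class {L1 P..L P} (?b v)" "L2_class {L1 P..L P} (?b w)"] L2_class_AE[OF L2(2)] L2_class_AE[OF L2(6)] in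
        eventually_elim, simp add: dbl_int_add[OF assms] algebra_simps)
  ultimately show ?thesis by (simp add: green_def i)
qed

lemma green_cmult:
  assumes "integrable lborel w"
  shows "green P (\<lambda>s. c * w s) = c *\<^sub>R green P w"
proof -
  have cw: "integrable lborel (\<lambda>s. c * w s)" using assms by simp
  note L2 = green_component_L2[OF assms] green_component_L2[OF cw]
  let ?a = "\<lambda>w x. dbl_int w x - x * (LBINT s:{0..L P}. w s)" and ?b = "\<lambda>w x. - dbl_int w x"
  have "c *\<^sub>R L2_class {0..L P} (?a w) = L2_class {0..L P} (?a (\<lambda>s. c * w s))"
    by (rule L2_class_eqI[OF L2(5)])
      (use rep_line_scaleR[of c "L2_class {0..L P} (?a w)"] L2_class_AE[OF L2(1)] in
        eventually_elim, simp add: dbl_int_cmult algebra_simps)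
  moreover have "c *\<^sub>R L2_class {L1 P..L P} (?b w) = L2_class {L1 P..L P} (?b (\<lambda>s. c * w s))"
    by (rule L2_class_eqI[OF L2(6)])
      (use rep_line_scaleR[of c "L2_class {L1 P..L P} (?b w)"] L2_class_AE[OF L2(2)] in
        eventually_elim, simp add: dbl_int_cmult algebra_simps)
  ultimately show ?thesis by (simp add: green_def)
qed

lemma green_diff:
  assumes "integrable lborel v" "integrable lborel w"
  shows "green P (\<lambda>s. v s - w s) = green P v - green P w"
proof -
  have "integrable lborel (\<lambda>s. (-1) * w s)" using assms(2) by (rule integrable_mult_right)
  from green_add[OF assms(1) this] show ?thesis
    unfolding green_cmult[OF assms(2)] by simp
qed

lemma green_cong_AE:
  assumes [measurable]: "v \<in> borel_measurable borel" "w \<in> borel_measurable borel"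
    and "AE s in lborel. v s = w s"
  shows "green P v = green P w"
proof -
  have "(LBINT s:{0..L P}. v s) = (LBINT s:{0..L P}. w s)"
    unfolding set_lebesgue_integral_def
    by (rule integral_cong_AE; (measurable)?) (use assms(3) in eventually_elim, simp)
  then show ?thesis by (simp add: green_def dbl_int_cong_AE[OF assms])
qed

end

section \<open>Surface concentrations\<close>

text \<open>Radial sections of a concentration are plain functions rather than elements of the
  quotient, so the inequality is needed at the level of functions.\<close>

lemma L2_Cauchy_Schwarz:
  fixes f g :: "real \<Rightarrow> real"
  assumes "f \<in> L2_fun lborel" "g \<in> L2_fun lborel"
  shows "(\<integral>x. f x * g x \<partial>lborel)\<^sup>2 \<le> (\<integral>x. (f x)\<^sup>2 \<partial>lborel) * (\<integral>x. (g x)\<^sup>2 \<partial>lborel)"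
proof -
  have "L2_eq lborel f (rep_line (abs_line f))" "L2_eq lborel g (rep_line (abs_line g))"
    using assms rep_abs_line[of f] rep_abs_line[of g] by (auto simp: L2_eq_def rep_line_L2)
  then have "(\<integral>x. f x * g x \<partial>lborel) = abs_line f \<bullet> abs_line g"
    unfolding inner_line by (rule L2_eq_inner)
  then show ?thesis
    using Cauchy_Schwarz_ineq[of "abs_line f" "abs_line g"] norm_abs_line[OF assms(1)] norm_abs_line[OF assms(2)]
    by (simp add: power2_norm_eq_inner)
qed

lemma rep_particle_L2: "rep_particle z \<in> L2_fun particle_measure"
  using Quotient3_rep_reflp[OF Quotient3_particle_L2, of z] by (simp add: L2_eq_def)

lemma rep_abs_particle:
  "f \<in> L2_fun particle_measure \<Longrightarrow> AE p in particle_measure. rep_particle (abs_particle f) p = f p"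
  using Quotient3_rep_abs[OF Quotient3_particle_L2, of f] by (simp add: L2_eq_def)

lemma particle_measure_eq: "particle_measure = density lborel (\<lambda>p. ennreal ((snd p)\<^sup>2))"
  by (simp add: particle_measure_def case_prod_beta')

lemma rep_particle_measurable [measurable]: "rep_particle z \<in> borel_measurable borel"
  using rep_particle_L2[of z] by (simp add: L2_fun_def particle_measure_eq)

lemma snd_borel_measurable [measurable]: "snd \<in> borel_measurable (borel :: (real \<times> real) measure)"
  by (intro borel_measurable_continuous_onI continuous_intros)

text \<open>The weight is positive exactly where \<open>r\<close> is nonzero, so exceptional sets of
  the weighted measure are Lebesgue null off that line; Fubini then passes to almost every
  section.\<close>

lemma AE_particle:
  assumes "AE p in particle_measure. Q p" "Measurable.pred borel Q"
  shows "AE x in lborel. AE r in lborel. r \<noteq> 0 \<longrightarrow> Q (x, r)"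
proof -
  have "AE p in lborel. 0 < ennreal ((snd p)\<^sup>2) \<longrightarrow> Q p"
    using assms(1) unfolding particle_measure_eq by (subst (asm) AE_density) auto
  then have "AE p in lborel \<Otimes>\<^sub>M lborel. 0 < ennreal ((snd p)\<^sup>2) \<longrightarrow> Q p"
    unfolding lborel_prod .
  then have "AE x in lborel. AE r in lborel. 0 < ennreal ((snd (x, r :: real))\<^sup>2) \<longrightarrow> Q (x, r)"
    by (rule lborel_pair.AE_pair)
  then show ?thesis by simp
qed

text \<open>The weight is absorbed into the function: \<open>r\<close> times the concentration is an
  ordinary square integrable function on the plane.\<close>

lemma particle_norm:
  shows "integrable lborel (\<lambda>p. (snd p * rep_particle z p)\<^sup>2)"
    and "(norm z)\<^sup>2 = (\<integral>p. (snd p * rep_particle z p)\<^sup>2 \<partial>lborel)"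
proof -
  have "integrable particle_measure (\<lambda>p. (rep_particle z p)\<^sup>2)"
    using rep_particle_L2[of z] by (simp add: L2_fun_def)
  then show "integrable lborel (\<lambda>p. (snd p * rep_particle z p)\<^sup>2)"
    unfolding particle_measure_eq by (subst (asm) integrable_density) (auto simp: power_mult_distrib)
  have "(norm z)\<^sup>2 = (\<integral>p. (rep_particle z p)\<^sup>2 \<partial>particle_measure)"
    unfolding power2_norm_eq_inner inner_particle_L2_def by (simp add: power2_eq_square)
  also have "\<dots> = (\<integral>p. (snd p * rep_particle z p)\<^sup>2 \<partial>lborel)"
    unfolding particle_measure_eq by (subst integral_density) (auto simp: power_mult_distrib)
  finally show "(norm z)\<^sup>2 = (\<integral>p. (snd p * rep_particle z p)\<^sup>2 \<partial>lborel)" .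
qed

lemma particle_sections:
  shows "AE x in lborel. (\<lambda>r. r * rep_particle z (x, r)) \<in> L2_fun lborel"
    and "integrable lborel (\<lambda>x. \<integral>r. (r * rep_particle z (x, r))\<^sup>2 \<partial>lborel)"
    and "(norm z)\<^sup>2 = (\<integral>x. \<integral>r. (r * rep_particle z (x, r))\<^sup>2 \<partial>lborel \<partial>lborel)"
proof -
  have int: "integrable (lborel \<Otimes>\<^sub>M lborel) (\<lambda>p :: real \<times> real. (snd p * rep_particle z p)\<^sup>2)"
    using particle_norm(1)[of z] by (simp add: lborel_prod)
  show "AE x in lborel. (\<lambda>r. r * rep_particle z (x, r)) \<in> L2_fun lborel"
    using lborel_pair.AE_integrable_fst'[OF int] by (auto simp: L2_fun_def)
  show "integrable lborel (\<lambda>x. \<integral>r. (r * rep_particle z (x, r))\<^sup>2 \<partial>lborel)"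
    using lborel_pair.integrable_fst'[OF int] by simp
  show "(norm z)\<^sup>2 = (\<integral>x. \<integral>r. (r * rep_particle z (x, r))\<^sup>2 \<partial>lborel \<partial>lborel)"
    using lborel_pair.integral_fst'[OF int] particle_norm(2)[of z] by (simp add: lborel_prod)
qed

text \<open>The averaging kernel divided by \<open>r\<close>, to be paired with \<open>r\<close>
  times the concentration, which is the combination that is square integrable on almost every
  section.\<close>

definition shell_weight :: "cell \<Rightarrow> 3 \<Rightarrow> real \<Rightarrow> real" where
  "shell_weight P k r = indicator {0..Rad P $ k} r * surface_delta P k (r - Rad P $ k) / r"

definition shell_integral :: "cell \<Rightarrow> 3 \<Rightarrow> particle_L2 \<Rightarrow> real \<Rightarrow> real" where
  "shell_integral P k z x = (LBINT r:{0..Rad P $ k}. surface_delta P k (r - Rad P $ k) * rep_particle z (x, r))"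

definition surface_conc :: "cell \<Rightarrow> 3 \<Rightarrow> particle_L2 \<Rightarrow> line_L2" where
  "surface_conc P k z = L2_class {L1 P..L P} (shell_integral P k z)"

lemma c_bar_eq: "c_bar P c k = shell_integral P k (snd c $ k)"
  by (simp add: fun_eq_iff c_bar_def shell_integral_def)

lemma surface_delta_measurable [measurable]: "surface_delta P k \<in> borel_measurable borel"
  unfolding surface_delta_def[abs_def] by measurable

lemma shell_integral_measurable [measurable]: "shell_integral P k z \<in> borel_measurable borel"
proof -
  have "(\<lambda>x. \<integral>r. indicator {0..Rad P $ k} r *\<^sub>R (surface_delta P k (r - Rad P $ k) * rep_particle z (x, r)) \<partial>lborel)
      \<in> borel_measurable borel"
    by (rule lborel.borel_measurable_lebesgue_integral) measurable
  then show ?thesis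
    unfolding shell_integral_def[abs_def] set_lebesgue_integral_def .
qed

lemma c_bar_measurable [measurable]: "c_bar P c k \<in> borel_measurable borel"
  by (simp add: c_bar_eq)

context
  fixes P :: cell
  assumes P: "valid_cell P"
begin

text \<open>Since \<open>eps0 P < 1\<close>, the shell stays at distance \<open>R - e > 0\<close>
  from the centre, so dividing by \<open>r\<close> keeps the kernel bounded.\<close>

lemma shell_weight_L2: "shell_weight P k \<in> L2_fun lborel"
proof -
  define R e where "R = Rad P $ k" and "e = eps0 P * R"
  have R: "0 < e" "e < R"
    using P by (auto simp: valid_cell_def R_def e_def mult_less_cancel_right1)
  have "shell_weight P k = (\<lambda>r. indicator {R - e..R} r * (1 / e / r))"
    using R by (auto simp: fun_eq_iff shell_weight_def surface_delta_def indicator_def simp flip: R_def e_def)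
  also have "\<dots> \<in> L2_fun lborel"
  proof (rule bounded_on_interval_L2(1))
    show "\<bar>1 / e / r\<bar> \<le> 1 / e / (R - e)" if "r \<in> {R - e..R}" for r
    proof -
      have "0 < r" using that R by auto
      then show ?thesis using that R by (auto simp: abs_mult divide_simps mult_left_mono)
    qed
  qed (use R in auto)
  finally show ?thesis .
qed

lemma shell_weight_mult:
  "indicator {0..Rad P $ k} r *\<^sub>R (surface_delta P k (r - Rad P $ k) * v) = shell_weight P k r * (r * v)"
proof (cases "r = 0")
  \<comment> \<open>At the centre the right-hand side is 0; the left-hand side is 0 as well because
    the centre lies outside the shell.\<close>
  case True
  have "0 < Rad P $ k - eps0 P * Rad P $ k"
    using P by (auto simp: valid_cell_def mult_less_cancel_right1)
  with True show ?thesis by (simp add: shell_weight_def surface_delta_def)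
qed (simp add: shell_weight_def)

lemma shell_integral_eq: "shell_integral P k z x = (\<integral>r. shell_weight P k r * (r * rep_particle z (x, r)) \<partial>lborel)"
  by (simp only: shell_integral_def set_lebesgue_integral_def shell_weight_mult)

lemma shell_integral_square_le:
  "AE x in lborel. (shell_integral P k z x)\<^sup>2
    \<le> (\<integral>r. (shell_weight P k r)\<^sup>2 \<partial>lborel) * (\<integral>r. (r * rep_particle z (x, r))\<^sup>2 \<partial>lborel)"
  using particle_sections(1)[of z]
  by eventually_elim (simp only: shell_integral_eq L2_Cauchy_Schwarz[OF shell_weight_L2])

lemma shell_integral_L2: "shell_integral P k z \<in> L2_fun lborel"
proof -
  have "integrable lborel (\<lambda>x. (shell_integral P k z x)\<^sup>2)"
    by (rule Bochner_Integration.integrable_bound[OF integrable_mult_right[OF particle_sections(2)[of z],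
            of "\<integral>r. (shell_weight P k r)\<^sup>2 \<partial>lborel"]])
      (use shell_integral_square_le[of k z] in \<open>auto elim!: AE_mp simp: abs_mult\<close>)
  then show ?thesis by (simp add: L2_fun_def)
qed

lemma surface_conc_AE:
  "AE x in lborel. rep_line (surface_conc P k z) x = indicator {L1 P..L P} x * shell_integral P k z x"
  unfolding surface_conc_def
  by (intro L2_class_AE L2_fun_indicator_mult shell_integral_L2) simp

text \<open>Cauchy-Schwarz in \<open>r\<close> followed by integration over \<open>x\<close> bounds
  the norm by the L2 norm of \<open>shell_weight\<close>. Linearity has to be traced through almost
  every section, as the representatives are linear only off null sets of the weighted
  measure.\<close>

lemma bounded_linear_surface_conc: "bounded_linear (surface_conc P k)"
proof (rule bounded_linear_intro)
  fix z w :: particle_L2 and c :: real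
  have "AE p in particle_measure. rep_particle (z + w) p = rep_particle z p + rep_particle w p"
    using rep_abs_particle[OF L2_fun_add[OF rep_particle_L2 rep_particle_L2, of z w]]
    by (simp add: plus_particle_L2_def)
  then have "AE x in lborel. AE r in lborel. r \<noteq> 0 \<longrightarrow>
      rep_particle (z + w) (x, r) = rep_particle z (x, r) + rep_particle w (x, r)"
    by (rule AE_particle) measurable
  then have "AE x in lborel. shell_integral P k (z + w) x = shell_integral P k z x + shell_integral P k w x"
    using particle_sections(1)[of z] particle_sections(1)[of w]
  proof eventually_elim
    case (elim x)
    have "(\<integral>r. shell_weight P k r * (r * rep_particle (z + w) (x, r)) \<partial>lborel)
        = (\<integral>r. shell_weight P k r * (r * rep_particle z (x, r)) + shell_weight P k r * (r * rep_particle w (x, r)) \<partial>lborel)"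
    proof (rule integral_cong_AE)
      show "AE r in lborel. shell_weight P k r * (r * rep_particle (z + w) (x, r))
          = shell_weight P k r * (r * rep_particle z (x, r)) + shell_weight P k r * (r * rep_particle w (x, r))"
        using elim(1) by eventually_elim (auto simp: algebra_simps)
    qed (use shell_weight_L2[of k] in \<open>auto simp: L2_fun_def\<close>)
    also have "\<dots> = (\<integral>r. shell_weight P k r * (r * rep_particle z (x, r)) \<partial>lborel)
        + (\<integral>r. shell_weight P k r * (r * rep_particle w (x, r)) \<partial>lborel)"
      by (intro Bochner_Integration.integral_add L2_fun_mult_integrable shell_weight_L2 elim)
    finally show ?case by (simp only: shell_integral_eq)
  qed
  then have "AE x in lborel. rep_line (surface_conc P k (z + w)) x = rep_line (surface_conc P k z + surface_conc P k w) x"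
    using surface_conc_AE[of k "z + w"] surface_conc_AE[of k z] surface_conc_AE[of k w]
      rep_line_add[of "surface_conc P k z" "surface_conc P k w"]
    by eventually_elim (simp add: distrib_left)
  then show "surface_conc P k (z + w) = surface_conc P k z + surface_conc P k w" by (rule line_L2_eqI)
  have "AE p in particle_measure. rep_particle (c *\<^sub>R z) p = c * rep_particle z p"
    using rep_abs_particle[OF L2_fun_scale[OF rep_particle_L2, of c z]]
    by (simp add: scaleR_particle_L2_def)
  then have "AE x in lborel. AE r in lborel. r \<noteq> 0 \<longrightarrow> rep_particle (c *\<^sub>R z) (x, r) = c * rep_particle z (x, r)"
    by (rule AE_particle) measurable
  then have "AE x in lborel. shell_integral P k (c *\<^sub>R z) x = c * shell_integral P k z x"
  proof eventually_elim
    case (elim x)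
    have "(\<integral>r. shell_weight P k r * (r * rep_particle (c *\<^sub>R z) (x, r)) \<partial>lborel)
        = (\<integral>r. c * (shell_weight P k r * (r * rep_particle z (x, r))) \<partial>lborel)"
    proof (rule integral_cong_AE)
      show "AE r in lborel. shell_weight P k r * (r * rep_particle (c *\<^sub>R z) (x, r))
          = c * (shell_weight P k r * (r * rep_particle z (x, r)))"
        using elim by eventually_elim auto
    qed (use shell_weight_L2[of k] in \<open>auto simp: L2_fun_def\<close>)
    then show ?case by (simp add: shell_integral_eq)
  qed
  then have "AE x in lborel. rep_line (surface_conc P k (c *\<^sub>R z)) x = rep_line (c *\<^sub>R surface_conc P k z) x"
    using surface_conc_AE[of k "c *\<^sub>R z"] surface_conc_AE[of k z] rep_line_scaleR[of c "surface_conc P k z"]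
    by eventually_elim simp
  then show "surface_conc P k (c *\<^sub>R z) = c *\<^sub>R surface_conc P k z" by (rule line_L2_eqI)
  define K where "K = (\<integral>r. (shell_weight P k r)\<^sup>2 \<partial>lborel)"
  have K: "0 \<le> K" by (simp add: K_def)
  have "(norm (surface_conc P k z))\<^sup>2 = (\<integral>x. (indicator {L1 P..L P} x * shell_integral P k z x)\<^sup>2 \<partial>lborel)"
    unfolding surface_conc_def L2_class_def
    by (intro norm_abs_line L2_fun_indicator_mult shell_integral_L2) simp
  also have "\<dots> \<le> (\<integral>x. K * (\<integral>r. (r * rep_particle z (x, r))\<^sup>2 \<partial>lborel) \<partial>lborel)"
  proof (rule integral_mono_AE)
    show "integrable lborel (\<lambda>x. (indicator {L1 P..L P} x * shell_integral P k z x)\<^sup>2)"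
      using L2_fun_indicator_mult[OF shell_integral_L2[of k z], of "{L1 P..L P}"] by (simp add: L2_fun_def)
    show "integrable lborel (\<lambda>x. K * (\<integral>r. (r * rep_particle z (x, r))\<^sup>2 \<partial>lborel))"
      by (intro integrable_mult_right particle_sections(2))
    show "AE x in lborel. (indicator {L1 P..L P} x * shell_integral P k z x)\<^sup>2
        \<le> K * (\<integral>r. (r * rep_particle z (x, r))\<^sup>2 \<partial>lborel)"
      using shell_integral_square_le[of k z] unfolding K_def[symmetric]
      by eventually_elim (auto simp: indicator_def K)
  qed
  also have "\<dots> = (norm z * sqrt K)\<^sup>2"
    using K by (simp add: particle_sections(3) power_mult_distrib)
  finally show "norm (surface_conc P k z) \<le> norm z * sqrt (\<integral>r. (shell_weight P k r)\<^sup>2 \<partial>lborel)"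
    unfolding K_def[symmetric] by (rule power2_le_imp_le) (simp add: K)
qed

end

section \<open>Reaction kinetics\<close>

text \<open>The bound on the function itself is included because it makes the class closed under
  \<open>exp\<close>. The derivatives are existential witnesses, so each closure lemma only has to
  exhibit formulas.\<close>

definition bounded_C2 :: "(real \<Rightarrow> real) \<Rightarrow> bool" where
  "bounded_C2 f \<longleftrightarrow> (\<exists>f' f'' M. \<forall>x.
     (f has_real_derivative f' x) (at x) \<and> (f' has_real_derivative f'' x) (at x) \<and>
     \<bar>f x\<bar> \<le> M \<and> \<bar>f' x\<bar> \<le> M \<and> \<bar>f'' x\<bar> \<le> M)"

lemma bounded_C2I:
  assumes "\<And>x. (f has_real_derivative f' x) (at x)" "\<And>x. (f' has_real_derivative f'' x) (at x)"
    "\<And>x. \<bar>f x\<bar> \<le> M0" "\<And>x. \<bar>f' x\<bar> \<le> M1" "\<And>x. \<bar>f'' x\<bar> \<le> M2"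
  shows "bounded_C2 f"
  unfolding bounded_C2_def
proof (intro exI allI conjI)
  fix x
  show "\<bar>f x\<bar> \<le> max M0 (max M1 M2)" "\<bar>f' x\<bar> \<le> max M0 (max M1 M2)" "\<bar>f'' x\<bar> \<le> max M0 (max M1 M2)"
    using assms(3-5)[of x] by linarith+
qed (rule assms)+

lemma bounded_C2E:
  assumes "bounded_C2 f"
  obtains f' f'' M where
    "\<And>x. (f has_real_derivative f' x) (at x)" "\<And>x. (f' has_real_derivative f'' x) (at x)"
    "\<And>x. \<bar>f x\<bar> \<le> M" "\<And>x. \<bar>f' x\<bar> \<le> M" "\<And>x. \<bar>f'' x\<bar> \<le> M"
  using assms unfolding bounded_C2_def by blast

lemma bounded_C2_const: "bounded_C2 (\<lambda>_. c)"
  by (rule bounded_C2I[where f'="\<lambda>_. 0" and f''="\<lambda>_. 0"]) (auto intro: order_refl)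

lemma bounded_C2_add:
  assumes "bounded_C2 f" "bounded_C2 g"
  shows "bounded_C2 (\<lambda>x. f x + g x)"
proof -
  obtain f' f'' M where f: "\<And>x. (f has_real_derivative f' x) (at x)" "\<And>x. (f' has_real_derivative f'' x) (at x)"
    "\<And>x. \<bar>f x\<bar> \<le> M" "\<And>x. \<bar>f' x\<bar> \<le> M" "\<And>x. \<bar>f'' x\<bar> \<le> M"
    using assms(1) by (rule bounded_C2E) blast
  obtain g' g'' N where g: "\<And>x. (g has_real_derivative g' x) (at x)" "\<And>x. (g' has_real_derivative g'' x) (at x)"
    "\<And>x. \<bar>g x\<bar> \<le> N" "\<And>x. \<bar>g' x\<bar> \<le> N" "\<And>x. \<bar>g'' x\<bar> \<le> N"
    using assms(2) by (rule bounded_C2E) blast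
  show ?thesis
    by (rule bounded_C2I[where f'="\<lambda>x. f' x + g' x" and f''="\<lambda>x. f'' x + g'' x"
          and ?M0.0="M + N" and ?M1.0="M + N" and ?M2.0="M + N"])
      (intro DERIV_add f g order_trans[OF abs_triangle_ineq] add_mono)+
qed

lemma bounded_C2_cmult:
  assumes "bounded_C2 f"
  shows "bounded_C2 (\<lambda>x. c * f x)"
proof -
  obtain f' f'' M where f: "\<And>x. (f has_real_derivative f' x) (at x)" "\<And>x. (f' has_real_derivative f'' x) (at x)"
    "\<And>x. \<bar>f x\<bar> \<le> M" "\<And>x. \<bar>f' x\<bar> \<le> M" "\<And>x. \<bar>f'' x\<bar> \<le> M"
    using assms by (rule bounded_C2E) blast
  show ?thesis
    by (rule bounded_C2I[where f'="\<lambda>x. c * f' x" and f''="\<lambda>x. c * f'' x"])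
      (auto simp: abs_mult intro!: DERIV_cmult f mult_left_mono)
qed

lemma bounded_C2_scale:
  assumes "bounded_C2 f"
  shows "bounded_C2 (\<lambda>x. f (c * x))"
proof -
  obtain f' f'' M where f: "\<And>x. (f has_real_derivative f' x) (at x)" "\<And>x. (f' has_real_derivative f'' x) (at x)"
    "\<And>x. \<bar>f x\<bar> \<le> M" "\<And>x. \<bar>f' x\<bar> \<le> M" "\<And>x. \<bar>f'' x\<bar> \<le> M"
    using assms by (rule bounded_C2E) blast
  have lin: "((*) c has_real_derivative c) (at x)" for x
    by (rule DERIV_cmult_Id)
  have "((\<lambda>x. f (c * x)) has_real_derivative f' (c * x) * c) (at x)" for x
    by (rule DERIV_chain2[OF f(1) lin])
  moreover have "((\<lambda>x. f' (c * x) * c) has_real_derivative f'' (c * x) * c * c) (at x)" for x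
    by (intro DERIV_cmult_right DERIV_chain2[OF f(2) lin])
  ultimately show ?thesis
    by (rule bounded_C2I[where ?M0.0=M and ?M1.0="M * \<bar>c\<bar>" and ?M2.0="M * \<bar>c\<bar> * \<bar>c\<bar>"])
      (auto simp: abs_mult intro!: f mult_right_mono)
qed

lemma bounded_C2_exp:
  assumes "bounded_C2 f"
  shows "bounded_C2 (\<lambda>x. exp (f x))"
proof -
  obtain f' f'' M where f: "\<And>x. (f has_real_derivative f' x) (at x)" "\<And>x. (f' has_real_derivative f'' x) (at x)"
    "\<And>x. \<bar>f x\<bar> \<le> M" "\<And>x. \<bar>f' x\<bar> \<le> M" "\<And>x. \<bar>f'' x\<bar> \<le> M"
    using assms by (rule bounded_C2E) blast
  have e: "\<bar>exp (f x)\<bar> \<le> exp M" for x using f(3)[of x] by simp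
  have d: "((\<lambda>x. exp (f x)) has_real_derivative exp (f x) * f' x) (at x)" for x
    by (rule DERIV_chain2[OF DERIV_exp f(1)])
  have "((\<lambda>x. exp (f x) * f' x) has_real_derivative exp (f x) * f' x * f' x + f'' x * exp (f x)) (at x)" for x
    by (rule DERIV_mult[OF d f(2)])
  with d show ?thesis
  proof (rule bounded_C2I[OF _ _ e])
    show "\<bar>exp (f x) * f' x\<bar> \<le> exp M * M" for x
      unfolding abs_mult by (intro mult_mono e f) auto
    show "\<bar>exp (f x) * f' x * f' x + f'' x * exp (f x)\<bar> \<le> exp M * M * M + M * exp M" for x
      using f(3)[of 0] by (intro order_trans[OF abs_triangle_ineq] add_mono; unfold abs_mult)
        (intro mult_mono e f; simp)+
  qed
qed

text \<open>The logistic equation \<open>f' = a * f * (1 - f)\<close> makes both derivatives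
  polynomials in \<open>f\<close>, which takes values between 0 and 1.\<close>

lemma bounded_C2_logistic: "bounded_C2 (\<lambda>x. 1 / (1 + exp (- a * x)))"
proof -
  define f :: "real \<Rightarrow> real" where "f x = 1 / (1 + exp (- a * x))" for x
  have f01: "0 \<le> f x \<and> f x \<le> 1" for x by (simp add: f_def add_pos_pos)
  have d: "(f has_real_derivative a * (f x * (1 - f x))) (at x)" for x
  proof -
    have pos: "1 + exp (- (a * x)) \<noteq> 0" using exp_gt_zero[of "- (a * x)"] by linarith
    have "(f has_real_derivative - (exp (- a * x) * (- a)) / ((1 + exp (- a * x)) * (1 + exp (- a * x)))) (at x)"
      unfolding f_def[abs_def] using pos by (auto intro!: derivative_eq_intros)
    moreover have "- (exp (- a * x) * (- a)) / ((1 + exp (- a * x)) * (1 + exp (- a * x))) = a * (f x * (1 - f x))"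
      using pos by (simp add: f_def field_simps)
    ultimately show ?thesis by simp
  qed
  have d2: "((\<lambda>x. a * (f x * (1 - f x))) has_real_derivative
      a * (a * (f x * (1 - f x)) * (1 - 2 * f x))) (at x)" for x
    by (auto intro!: derivative_eq_intros d simp: algebra_simps)
  have p: "\<bar>f x * (1 - f x)\<bar> \<le> 1" for x
    using f01[of x] by (simp add: abs_mult mult_le_one)
  have "bounded_C2 f"
  proof (rule bounded_C2I[OF d d2])
    show "\<bar>f x\<bar> \<le> 1" for x using f01[of x] by simp
    show "\<bar>a * (f x * (1 - f x))\<bar> \<le> \<bar>a\<bar>" for x
      using p[of x] by (simp add: abs_mult[of a] mult_left_le)
    show "\<bar>a * (a * (f x * (1 - f x)) * (1 - 2 * f x))\<bar> \<le> \<bar>a\<bar> * (\<bar>a\<bar> * 1 * 1)" for x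
    proof -
      have "\<bar>1 - 2 * f x\<bar> \<le> 1" using f01[of x] by linarith
      then show ?thesis
        using p[of x] unfolding abs_mult[of a] abs_mult[of "a * _"] by (intro mult_left_mono mult_mono) auto
    qed
  qed
  then show ?thesis by (simp add: f_def[abs_def])
qed

section \<open>Pointwise Taylor estimates\<close>

text \<open>What the Taylor estimates consume, phrased with \<open>deriv\<close> because
  \<open>g1\<close> and \<open>g2\<close> are defined by it. The condition \<open>1 \<le> M\<close>
  allows powers of \<open>M\<close> to be rounded up to one common power.\<close>

definition lipschitz_C1 :: "real \<Rightarrow> (real \<Rightarrow> real) \<Rightarrow> bool" where
  "lipschitz_C1 M f \<longleftrightarrow> 1 \<le> M \<and> (\<forall>x. (f has_real_derivative deriv f x) (at x) \<and>
     \<bar>f x\<bar> \<le> M \<and> \<bar>deriv f x\<bar> \<le> M) \<and> (\<forall>x y. \<bar>deriv f y - deriv f x\<bar> \<le> M * \<bar>y - x\<bar>)"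

lemma lipschitz_C1_mono: "lipschitz_C1 M f \<Longrightarrow> M \<le> N \<Longrightarrow> lipschitz_C1 N f"
  unfolding lipschitz_C1_def by (meson abs_ge_zero mult_right_mono order_trans)

lemma bounded_C2_imp_lipschitz_C1:
  assumes "bounded_C2 f"
  obtains M where "lipschitz_C1 M f"
proof -
  obtain f' f'' M where f: "\<And>x. (f has_real_derivative f' x) (at x)" "\<And>x. (f' has_real_derivative f'' x) (at x)"
    "\<And>x. \<bar>f x\<bar> \<le> M" "\<And>x. \<bar>f' x\<bar> \<le> M" "\<And>x. \<bar>f'' x\<bar> \<le> M"
    using assms by (rule bounded_C2E) blast
  have f': "deriv f = f'" using f(1) by (auto intro: DERIV_imp_deriv)
  have "norm (f'' x) \<le> max M 1" for x using f(5)[of x] by simp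
  then have "\<bar>f' y - f' x\<bar> \<le> max M 1 * \<bar>y - x\<bar>" for x y
    using field_differentiable_bound[of UNIV f' f'' "max M 1" y x] f(2) by simp
  then have "lipschitz_C1 (max M 1) f"
    unfolding lipschitz_C1_def f' using f(1,3,4) by (auto simp: le_max_iff_disj)
  then show thesis by (rule that)
qed

lemma lipschitz_C1D:
  assumes "lipschitz_C1 M f"
  shows "1 \<le> M" "(f has_real_derivative deriv f x) (at x)" "\<bar>f x\<bar> \<le> M" "\<bar>deriv f x\<bar> \<le> M"
    "\<bar>deriv f y - deriv f x\<bar> \<le> M * \<bar>y - x\<bar>" "\<bar>f y - f x\<bar> \<le> M * \<bar>y - x\<bar>"
    "\<bar>f y - f x - deriv f x * (y - x)\<bar> \<le> M * (y - x)\<^sup>2"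
proof -
  have f: "1 \<le> M" "\<And>x. (f has_real_derivative deriv f x) (at x)" "\<And>x. \<bar>f x\<bar> \<le> M"
    "\<And>x. \<bar>deriv f x\<bar> \<le> M" "\<And>x y. \<bar>deriv f y - deriv f x\<bar> \<le> M * \<bar>y - x\<bar>"
    using assms by (auto simp: lipschitz_C1_def)
  show "1 \<le> M" "(f has_real_derivative deriv f x) (at x)" "\<bar>f x\<bar> \<le> M" "\<bar>deriv f x\<bar> \<le> M"
    "\<bar>deriv f y - deriv f x\<bar> \<le> M * \<bar>y - x\<bar>" by (rule f)+
  show "\<bar>f y - f x\<bar> \<le> M * \<bar>y - x\<bar>"
    using field_differentiable_bound[of UNIV f "deriv f" M y x] f by auto
  \<comment> \<open>Mean value inequality for \<open>f\<close> minus its tangent slope. It is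
    applied on the segment only, where the slope differs from \<open>deriv f x\<close> by at most
    \<open>M * \<bar>y - x\<bar>\<close>.\<close>
  have "norm ((f y - deriv f x * y) - (f x - deriv f x * x)) \<le> (M * \<bar>y - x\<bar>) * norm (y - x)"
  proof (rule field_differentiable_bound[of "closed_segment x y" _ "\<lambda>t. deriv f t - deriv f x"])
    fix t assume t: "t \<in> closed_segment x y"
    show "((\<lambda>t. f t - deriv f x * t) has_field_derivative deriv f t - deriv f x) (at t within closed_segment x y)"
      using f(2)[of t] by (auto intro!: derivative_eq_intros DERIV_subset[OF f(2)])
    have "\<bar>t - x\<bar> \<le> \<bar>y - x\<bar>" using t by (auto simp: closed_segment_eq_real_ivl split: if_splits)
    then show "norm (deriv f t - deriv f x) \<le> M * \<bar>y - x\<bar>"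
      using f(1) by (simp add: order_trans[OF f(5)] mult_left_mono)
  qed auto
  then show "\<bar>f y - f x - deriv f x * (y - x)\<bar> \<le> M * (y - x)\<^sup>2"
    by (simp add: algebra_simps power2_eq_square flip: abs_mult)
qed

text \<open>The rate has the form \<open>F (e - W y)\<close>, with \<open>e\<close> the potential
  difference, \<open>y\<close> the surface concentration and \<open>W\<close> the open circuit
  potential; \<open>dF\<close> is its differential. The computations give
  \<open>M ^ 3 + M\<^sup>2\<close>, which is rounded up generously.\<close>

lemma lipschitz_C1_composite:
  assumes F: "lipschitz_C1 M F" and W: "lipschitz_C1 M W"
  defines "dF \<equiv> \<lambda>e y he hy. deriv F (e - W y) * (he - deriv W y * hy)"
  shows
    "\<bar>F (e' - W y') - F (e - W y) - dF e y (e' - e) (y' - y)\<bar> \<le> 5 * M ^ 3 * (\<bar>e' - e\<bar> + \<bar>y' - y\<bar>)\<^sup>2"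
    "\<bar>dF e' y' he hy - dF e y he hy\<bar> \<le> 5 * M ^ 3 * ((\<bar>e' - e\<bar> + \<bar>y' - y\<bar>) * (\<bar>he\<bar> + \<bar>hy\<bar>))"
    "\<bar>dF e y he hy\<bar> \<le> M\<^sup>2 * (\<bar>he\<bar> + \<bar>hy\<bar>)"
proof -
  have M: "1 \<le> M" by (rule lipschitz_C1D[OF F])
  have pw: "M \<le> M ^ 3" "M\<^sup>2 \<le> M ^ 3" "0 \<le> M ^ 3"
    using M power_increasing[of 1 3 M] power_increasing[of 2 3 M] by auto
  define n where "n = \<bar>e' - e\<bar> + \<bar>y' - y\<bar>"
  have n: "0 \<le> n" by (simp add: n_def)
  have lin: "\<bar>u - deriv W t * v\<bar> \<le> M * (\<bar>u\<bar> + \<bar>v\<bar>)" for u v t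
  proof -
    have "\<bar>u - deriv W t * v\<bar> \<le> \<bar>u\<bar> + \<bar>deriv W t\<bar> * \<bar>v\<bar>"
      using abs_triangle_ineq4[of u "deriv W t * v"] by (simp add: abs_mult)
    also have "\<dots> \<le> M * \<bar>u\<bar> + M * \<bar>v\<bar>"
      using M by (intro add_mono mult_right_mono lipschitz_C1D(4)[OF W]) (auto simp: mult_right_mono[of 1 M, simplified])
    finally show ?thesis by (simp add: algebra_simps)
  qed
  show "\<bar>dF e y he hy\<bar> \<le> M\<^sup>2 * (\<bar>he\<bar> + \<bar>hy\<bar>)"
    unfolding dF_def abs_mult power2_eq_square mult.assoc
    using M by (intro mult_mono lipschitz_C1D(4)[OF F] lin) auto
  have d: "\<bar>(e' - W y') - (e - W y)\<bar> \<le> M * n"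
  proof -
    have "\<bar>(e' - W y') - (e - W y)\<bar> \<le> \<bar>e' - e\<bar> + \<bar>W y' - W y\<bar>" by linarith
    also have "\<dots> \<le> M * \<bar>e' - e\<bar> + M * \<bar>y' - y\<bar>"
      using M by (intro add_mono lipschitz_C1D(6)[OF W]) (auto simp: mult_right_mono[of 1 M, simplified])
    finally show ?thesis by (simp add: n_def algebra_simps)
  qed
  show "\<bar>dF e' y' he hy - dF e y he hy\<bar> \<le> 5 * M ^ 3 * ((\<bar>e' - e\<bar> + \<bar>y' - y\<bar>) * (\<bar>he\<bar> + \<bar>hy\<bar>))"
  proof -
    define m where "m = \<bar>he\<bar> + \<bar>hy\<bar>"
    have m: "0 \<le> m" by (simp add: m_def)
    \<comment> \<open>Product rule splitting: first the outer slope changes, then the inner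
      one.\<close>
    have "dF e' y' he hy - dF e y he hy =
        (deriv F (e' - W y') - deriv F (e - W y)) * (he - deriv W y' * hy)
        - deriv F (e - W y) * ((deriv W y' - deriv W y) * hy)"
      by (simp add: dF_def algebra_simps)
    also have "\<bar>\<dots>\<bar> \<le> \<bar>deriv F (e' - W y') - deriv F (e - W y)\<bar> * \<bar>he - deriv W y' * hy\<bar>
        + \<bar>deriv F (e - W y)\<bar> * (\<bar>deriv W y' - deriv W y\<bar> * \<bar>hy\<bar>)"
      using abs_triangle_ineq4 by (simp only: flip: abs_mult)
    also have "\<dots> \<le> (M * (M * n)) * (M * m) + M * ((M * n) * m)"
    proof (intro add_mono mult_mono)
      show "\<bar>deriv F (e' - W y') - deriv F (e - W y)\<bar> \<le> M * (M * n)"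
        using M d by (intro order_trans[OF lipschitz_C1D(5)[OF F]] mult_left_mono) auto
      show "\<bar>deriv W y' - deriv W y\<bar> \<le> M * n"
        using M by (intro order_trans[OF lipschitz_C1D(5)[OF W]] mult_left_mono) (auto simp: n_def)
    qed (use M n m lin in \<open>auto simp: m_def intro: lipschitz_C1D[OF F]\<close>)
    also have "\<dots> = (M ^ 3 + M\<^sup>2) * (n * m)"
      by (simp add: power2_eq_square power3_eq_cube algebra_simps)
    also have "\<dots> \<le> 5 * M ^ 3 * (n * m)"
      using pw n m by (intro mult_right_mono) auto
    finally show ?thesis by (simp add: n_def m_def)
  qed
  show "\<bar>F (e' - W y') - F (e - W y) - dF e y (e' - e) (y' - y)\<bar> \<le> 5 * M ^ 3 * (\<bar>e' - e\<bar> + \<bar>y' - y\<bar>)\<^sup>2"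
  proof -
    define a b where "a = e - W y" and "b = e' - W y'"
    define \<rho> where "\<rho> = W y' - W y - deriv W y * (y' - y)"
    \<comment> \<open>The remainder of the composition is the remainder of \<open>F\<close> minus
      its slope times the remainder \<rho> of \<open>W\<close>.\<close>
    have "F b - F a - deriv F a * ((e' - e) - deriv W y * (y' - y))
        = (F b - F a - deriv F a * (b - a)) - deriv F a * \<rho>"
      by (simp add: a_def b_def \<rho>_def algebra_simps)
    also have "\<bar>\<dots>\<bar> \<le> \<bar>F b - F a - deriv F a * (b - a)\<bar> + \<bar>deriv F a\<bar> * \<bar>\<rho>\<bar>"
      using abs_triangle_ineq4 by (simp only: flip: abs_mult)
    also have "\<dots> \<le> M * (M * n)\<^sup>2 + M * (M * n\<^sup>2)"
    proof (intro add_mono mult_mono)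
      have "(b - a)\<^sup>2 \<le> (M * n)\<^sup>2"
        using d M n by (intro abs_le_square_iff[THEN iffD1]) (auto simp: a_def b_def abs_of_nonneg)
      then show "\<bar>F b - F a - deriv F a * (b - a)\<bar> \<le> M * (M * n)\<^sup>2"
        using M by (intro order_trans[OF lipschitz_C1D(7)[OF F]] mult_left_mono) auto
      have "(y' - y)\<^sup>2 \<le> n\<^sup>2"
        by (intro abs_le_square_iff[THEN iffD1]) (auto simp: n_def)
      then show "\<bar>\<rho>\<bar> \<le> M * n\<^sup>2"
        unfolding \<rho>_def using M by (intro order_trans[OF lipschitz_C1D(7)[OF W]] mult_left_mono) auto
    qed (use M in \<open>auto intro: lipschitz_C1D[OF F]\<close>)
    also have "\<dots> = (M ^ 3 + M\<^sup>2) * n\<^sup>2"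
      by (simp add: power2_eq_square power3_eq_cube algebra_simps)
    also have "\<dots> \<le> 5 * M ^ 3 * n\<^sup>2"
      using pw by (intro mult_right_mono) auto
    finally show ?thesis by (simp add: n_def dF_def a_def b_def)
  qed
qed

section \<open>The saturated kinetics and the open circuit potential\<close>

definition kinetics :: "cell \<Rightarrow> real \<Rightarrow> real" where
  "kinetics P \<eta> = 2 * i0 P * sinh (sat P (Far P * \<eta> / (2 * Rgas P * Temp P)))"

definition surface_ocp :: "cell \<Rightarrow> real \<Rightarrow> real" where
  "surface_ocp P s = ocp P (sat_y P (s / c_max P))"

lemma rate_eq: "rate P c k x p1 p2 =
    indicator {L1 P..L P} x * kinetics P (p2 - p1 - surface_ocp P (c_bar P c k x))"
  by (simp add: rate_def kinetics_def surface_ocp_def y_bar_def)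

text \<open>The saturation is an affine function of a logistic function, hence bounded, so the two
  exponentials that make up sinh stay in the class.\<close>

lemma bounded_C2_kinetics: "bounded_C2 (kinetics P)"
proof -
  define r where "r = Far P / (2 * Rgas P * Temp P)"
  \<comment> \<open>The exponential of \<open>c\<close> times the saturation; \<open>c = 1\<close>
    and \<open>c = -1\<close> are the two halves of sinh.\<close>
  define g where "g c x = exp (- c * b0 P + (2 * (c * b0 P)) * (1 / (1 + exp (- a0 P * (r * x)))))" for c x :: real
  have g: "bounded_C2 (g c)" for c
    unfolding g_def
    by (intro bounded_C2_exp bounded_C2_add bounded_C2_const bounded_C2_cmult
        bounded_C2_scale[OF bounded_C2_logistic])
  have "kinetics P \<eta> = i0 P * g 1 \<eta> + (- i0 P) * g (-1) \<eta>" for \<eta>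
  proof -
    define S where "S = sat P (Far P * \<eta> / (2 * Rgas P * Temp P))"
    have "Far P * \<eta> / (2 * Rgas P * Temp P) = r * \<eta>" by (simp add: r_def)
    then have "exp S = g 1 \<eta>" "exp (- S) = g (-1) \<eta>"
      by (simp_all add: S_def g_def sat_def)
    moreover have "kinetics P \<eta> = 2 * i0 P * ((exp S - exp (- S)) / 2)"
      by (simp only: kinetics_def sinh_field_def S_def)
    ultimately show ?thesis by (simp add: algebra_simps)
  qed
  then have "kinetics P = (\<lambda>\<eta>. i0 P * g 1 \<eta> + (- i0 P) * g (-1) \<eta>)" by (rule ext)
  then show ?thesis by (simp only:) (intro bounded_C2_add bounded_C2_cmult g)
qed

text \<open>Both curves are an affine function plus two exponentials of affine functions. Their
  argument is a logistic function of the concentration, so one template with seven constants covers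
  both.\<close>

lemma bounded_C2_surface_ocp:
  assumes "valid_cell P"
  shows "bounded_C2 (surface_ocp P)"
proof -
  have s: "bounded_C2 (\<lambda>s. sat_y P (s / c_max P))"
    using bounded_C2_scale[OF bounded_C2_logistic[of "a0 P"], of "1 / c_max P"]
    by (simp add: sat_y_def)
  have *: "bounded_C2 (\<lambda>s. a + b * sat_y P (s / c_max P) + c * exp (d * sat_y P (s / c_max P))
      + e * exp (f + g * sat_y P (s / c_max P)))" for a b c d e f g
    by (intro bounded_C2_exp bounded_C2_add bounded_C2_const bounded_C2_cmult s)
  have "U_charging y = 3.4510 + (- 0.009) * y + 0.6687 * exp (- 35 * y) + (- 0.5) * exp (- 210 + 210 * y)" for y
    by (simp add: U_charging_def algebra_simps)
  moreover have "U_discharging y = 3.4077 + (- 0.020269) * y + 0.5 * exp (- 200 * y) + (- 0.9) * exp (- 30 + 30 * y)" for y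
    by (simp add: U_discharging_def algebra_simps)
  ultimately show ?thesis
    using assms unfolding valid_cell_def surface_ocp_def[abs_def]
    by (elim conjE disjE) (simp_all only: *)
qed

lemma lipschitz_C1_measurable:
  assumes "lipschitz_C1 M f"
  shows "f \<in> borel_measurable borel" "deriv f \<in> borel_measurable borel"
proof -
  have "continuous_on UNIV f"
    using lipschitz_C1D(2)[OF assms] by (meson DERIV_isCont continuous_at_imp_continuous_on)
  then show "f \<in> borel_measurable borel" by (rule borel_measurable_continuous_onI)
  have "M-lipschitz_on UNIV (deriv f)"
    using lipschitz_C1D(1,5)[OF assms] by (intro lipschitz_onI) (auto simp: dist_real_def)
  then show "deriv f \<in> borel_measurable borel"
    by (intro borel_measurable_continuous_onI lipschitz_on_continuous_on)
qed

section \<open>The rate as a differentiable map from L2 to L1\<close>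

definition rate_at :: "cell \<Rightarrow> line_L2 \<times> line_L2 \<Rightarrow> real \<Rightarrow> real" where
  "rate_at P v s = indicator {L1 P..L P} s *
     kinetics P (rep_line (fst v) s - surface_ocp P (rep_line (snd v) s))"

definition rate_deriv :: "cell \<Rightarrow> line_L2 \<times> line_L2 \<Rightarrow> line_L2 \<times> line_L2 \<Rightarrow> real \<Rightarrow> real" where
  "rate_deriv P v h s = indicator {L1 P..L P} s *
     (deriv (kinetics P) (rep_line (fst v) s - surface_ocp P (rep_line (snd v) s)) *
      (rep_line (fst h) s - deriv (surface_ocp P) (rep_line (snd v) s) * rep_line (snd h) s))"

context
  fixes P :: cell
  assumes P: "valid_cell P"
begin

lemma cell_lipschitz:
  obtains M where "lipschitz_C1 M (kinetics P)" "lipschitz_C1 M (surface_ocp P)"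
proof -
  obtain M where M: "lipschitz_C1 M (kinetics P)"
    using bounded_C2_kinetics by (rule bounded_C2_imp_lipschitz_C1)
  obtain N where N: "lipschitz_C1 N (surface_ocp P)"
    using bounded_C2_surface_ocp[OF P] by (rule bounded_C2_imp_lipschitz_C1)
  show thesis
    by (rule that[of "max M N"]) (use lipschitz_C1_mono M N in \<open>meson max.cobounded1 max.cobounded2\<close>)+
qed

lemma kinetics_measurable [measurable]:
  "kinetics P \<in> borel_measurable borel" "deriv (kinetics P) \<in> borel_measurable borel"
  "surface_ocp P \<in> borel_measurable borel" "deriv (surface_ocp P) \<in> borel_measurable borel"
  by (rule cell_lipschitz; erule lipschitz_C1_measurable)+

lemma rate_at_measurable [measurable]: "rate_at P v \<in> borel_measurable borel"
  unfolding rate_at_def[abs_def] by measurable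

lemma rate_deriv_measurable [measurable]: "rate_deriv P v h \<in> borel_measurable borel"
  unfolding rate_deriv_def[abs_def] by measurable

lemma rate_at_integrable: "integrable lborel (rate_at P v)"
proof -
  obtain M where M: "lipschitz_C1 M (kinetics P)" by (rule cell_lipschitz)
  have "integrable lborel (\<lambda>s. indicator {L1 P..L P} s * M)"
    by (intro integrable_mult_left) (simp add: integrable_indicator_iff emeasure_lborel_Icc_eq)
  then show ?thesis
    by (rule Bochner_Integration.integrable_bound)
      (use lipschitz_C1D(1,3)[OF M] in \<open>auto simp: rate_at_def indicator_def intro: order_trans\<close>)
qed

lemma rate_deriv_integrable_le:
  obtains K where "0 \<le> K" "\<And>v h. integrable lborel (rate_deriv P v h)"
    "\<And>v h. (\<integral>s. \<bar>rate_deriv P v h s\<bar> \<partial>lborel) \<le> K * norm h"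
proof -
  obtain M where M: "lipschitz_C1 M (kinetics P)" "lipschitz_C1 M (surface_ocp P)" by (rule cell_lipschitz)
  \<comment> \<open>The derivative is linear in \<open>h\<close>; the indicator of the electrode
    supplies the second L2 factor that the product estimate expects.\<close>
  define one where "one = L2_class {L1 P..L P} (\<lambda>_. 1)"
  have one: "AE s in lborel. rep_line one s = indicator {L1 P..L P} s"
    using L2_class_AE[OF bounded_on_interval_L2(1)[of "\<lambda>_. 1" "L1 P" "L P" 1]] cell_len[OF P]
    by (auto simp: one_def)
  have bd: "AE s in lborel. \<bar>rate_deriv P v h s\<bar> \<le> M\<^sup>2 *
     ((\<bar>rep_line one s\<bar> + \<bar>rep_line 0 s\<bar>) * (\<bar>rep_line (fst h) s\<bar> + \<bar>rep_line (snd h) s\<bar>))" for v h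
    using one rep_line_zero
  proof eventually_elim
    case (elim s)
    then show ?case
      using lipschitz_C1_composite(3)[OF M] by (auto simp: rate_deriv_def indicator_def)
  qed
  have int: "integrable lborel (\<lambda>s. M\<^sup>2 *
     ((\<bar>rep_line one s\<bar> + \<bar>rep_line 0 s\<bar>) * (\<bar>rep_line (fst h) s\<bar> + \<bar>rep_line (snd h) s\<bar>)))" for h :: "line_L2 \<times> line_L2"
    by (intro integrable_mult_right integral_abs_mult_le)
  have i: "integrable lborel (rate_deriv P v h)" for v h
    by (rule Bochner_Integration.integrable_bound[OF int[of h]])
      (use bd[of v h] in \<open>auto elim!: AE_mp\<close>)
  show thesis
  proof (rule that[of "M\<^sup>2 * (norm one * 2)"])
    fix v h
    have "(\<integral>s. \<bar>rate_deriv P v h s\<bar> \<partial>lborel) \<le> (\<integral>s. M\<^sup>2 *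
     ((\<bar>rep_line one s\<bar> + \<bar>rep_line 0 s\<bar>) * (\<bar>rep_line (fst h) s\<bar> + \<bar>rep_line (snd h) s\<bar>)) \<partial>lborel)"
      by (intro integral_mono_AE int bd integrable_abs i)
    also have "\<dots> \<le> M\<^sup>2 * ((norm one + norm (0 :: line_L2)) * (norm (fst h) + norm (snd h)))"
      by (subst integral_mult_right_zero) (intro mult_left_mono integral_abs_mult_le, simp)
    also have "\<dots> \<le> M\<^sup>2 * ((norm one + norm (0 :: line_L2)) * (2 * norm h))"
      by (intro mult_left_mono norm_fst_plus_snd_le) auto
    finally show "(\<integral>s. \<bar>rate_deriv P v h s\<bar> \<partial>lborel) \<le> M\<^sup>2 * (norm one * 2) * norm h"
      by (simp add: mult.assoc)
  qed (use i in auto)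
qed

lemma rate_deriv_integrable: "integrable lborel (rate_deriv P v h)"
  by (rule rate_deriv_integrable_le)

text \<open>The pointwise remainder is bounded by the squared increments, whose integral is a
  squared L2 norm. Measuring it in L2 would involve fourth powers of the increments, which L2 data
  do not control.\<close>

lemma rate_at_quadratic:
  obtains C where "0 \<le> C"
    "\<And>v h. (\<integral>s. \<bar>rate_at P (v + h) s - rate_at P v s - rate_deriv P v h s\<bar> \<partial>lborel) \<le> C * (norm h)\<^sup>2"
    "\<And>v v' h. (\<integral>s. \<bar>rate_deriv P v' h s - rate_deriv P v h s\<bar> \<partial>lborel) \<le> C * (norm (v' - v) * norm h)"
proof -
  obtain M where M: "lipschitz_C1 M (kinetics P)" "lipschitz_C1 M (surface_ocp P)" by (rule cell_lipschitz)
  have M3: "0 \<le> 5 * M ^ 3" using lipschitz_C1D(1)[OF M(1)] by simp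
  note i = rate_at_integrable rate_deriv_integrable
  show thesis
  proof (rule that[of "4 * (5 * M ^ 3)"])
    fix v h :: "line_L2 \<times> line_L2"
    have "(\<integral>s. \<bar>rate_at P (v + h) s - rate_at P v s - rate_deriv P v h s\<bar> \<partial>lborel)
      \<le> 4 * (5 * M ^ 3) * (norm h * norm h)"
    proof (rule integral_le_square_bound[OF _ M3])
      show "AE s in lborel. \<bar>rate_at P (v + h) s - rate_at P v s - rate_deriv P v h s\<bar> \<le> 5 * M ^ 3 *
          ((\<bar>rep_line (fst h) s\<bar> + \<bar>rep_line (snd h) s\<bar>) * (\<bar>rep_line (fst h) s\<bar> + \<bar>rep_line (snd h) s\<bar>))"
        using rep_line_add_fst_snd[of v h]
      proof eventually_elim
        case (elim s)
        have "\<bar>rate_at P (v + h) s - rate_at P v s - rate_deriv P v h s\<bar> \<le> 5 * M ^ 3 *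
          (\<bar>rep_line (fst (v + h)) s - rep_line (fst v) s\<bar> + \<bar>rep_line (snd (v + h)) s - rep_line (snd v) s\<bar>)\<^sup>2"
          using lipschitz_C1_composite(1)[OF M, of "rep_line (fst (v + h)) s" "rep_line (snd (v + h)) s"
              "rep_line (fst v) s" "rep_line (snd v) s"] elim M3
          by (cases "s \<in> {L1 P..L P}") (simp_all add: rate_at_def rate_deriv_def)
        then show ?case using elim by (simp add: power2_eq_square)
      qed
    qed (intro Bochner_Integration.integrable_diff i)
    then show "(\<integral>s. \<bar>rate_at P (v + h) s - rate_at P v s - rate_deriv P v h s\<bar> \<partial>lborel)
      \<le> 4 * (5 * M ^ 3) * (norm h)\<^sup>2" by (simp add: power2_eq_square)
  next
    fix v v' h :: "line_L2 \<times> line_L2"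
    show "(\<integral>s. \<bar>rate_deriv P v' h s - rate_deriv P v h s\<bar> \<partial>lborel) \<le> 4 * (5 * M ^ 3) * (norm (v' - v) * norm h)"
    proof (rule integral_le_square_bound[OF _ M3])
      show "AE s in lborel. \<bar>rate_deriv P v' h s - rate_deriv P v h s\<bar> \<le> 5 * M ^ 3 *
          ((\<bar>rep_line (fst (v' - v)) s\<bar> + \<bar>rep_line (snd (v' - v)) s\<bar>) * (\<bar>rep_line (fst h) s\<bar> + \<bar>rep_line (snd h) s\<bar>))"
        using rep_line_diff[of "fst v'" "fst v"] rep_line_diff[of "snd v'" "snd v"]
      proof eventually_elim
        case (elim s)
        have "\<bar>rate_deriv P v' h s - rate_deriv P v h s\<bar> \<le> 5 * M ^ 3 *
          ((\<bar>rep_line (fst v') s - rep_line (fst v) s\<bar> + \<bar>rep_line (snd v') s - rep_line (snd v) s\<bar>)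
            * (\<bar>rep_line (fst h) s\<bar> + \<bar>rep_line (snd h) s\<bar>))"
          using lipschitz_C1_composite(2)[OF M, of "rep_line (fst v') s" "rep_line (snd v') s"
              "rep_line (fst h) s" "rep_line (snd h) s" "rep_line (fst v) s" "rep_line (snd v) s"] M3
          by (cases "s \<in> {L1 P..L P}") (simp_all add: rate_deriv_def)
        then show ?case using elim by simp
      qed
    qed (intro Bochner_Integration.integrable_diff i)
  qed (use M3 in simp)
qed

lemma green_rate_quadratic:
  obtains C where "0 \<le> C"
    "\<And>v h. norm (green P (rate_at P (v + h)) - green P (rate_at P v) - green P (rate_deriv P v h)) \<le> C * (norm h)\<^sup>2"
    "\<And>v v' h. norm (green P (rate_deriv P v' h) - green P (rate_deriv P v h)) \<le> C * (norm (v' - v) * norm h)"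
proof -
  obtain K where K: "0 < K" "\<And>w. integrable lborel w \<Longrightarrow> norm (green P w) \<le> K * (\<integral>s. \<bar>w s\<bar> \<partial>lborel)"
    using green_norm_le[OF P] by blast
  obtain C where C: "0 \<le> C"
    "\<And>v h. (\<integral>s. \<bar>rate_at P (v + h) s - rate_at P v s - rate_deriv P v h s\<bar> \<partial>lborel) \<le> C * (norm h)\<^sup>2"
    "\<And>v v' h. (\<integral>s. \<bar>rate_deriv P v' h s - rate_deriv P v h s\<bar> \<partial>lborel) \<le> C * (norm (v' - v) * norm h)"
    using rate_at_quadratic by blast
  note i = rate_at_integrable rate_deriv_integrable
  note gd = green_diff[OF P]
  show thesis
  proof (rule that[of "K * C"])
    fix v v' h :: "line_L2 \<times> line_L2"
    have "norm (green P (\<lambda>s. rate_at P (v + h) s - rate_at P v s - rate_deriv P v h s)) \<le> K * (C * (norm h)\<^sup>2)"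
      using K(1) by (intro order_trans[OF K(2)] mult_left_mono C Bochner_Integration.integrable_diff i) simp
    then show "norm (green P (rate_at P (v + h)) - green P (rate_at P v) - green P (rate_deriv P v h)) \<le> K * C * (norm h)\<^sup>2"
      by (simp add: gd i mult.assoc)
    have "norm (green P (\<lambda>s. rate_deriv P v' h s - rate_deriv P v h s)) \<le> K * (C * (norm (v' - v) * norm h))"
      using K(1) by (intro order_trans[OF K(2)] mult_left_mono C Bochner_Integration.integrable_diff i) simp
    then show "norm (green P (rate_deriv P v' h) - green P (rate_deriv P v h)) \<le> K * C * (norm (v' - v) * norm h)"
      by (simp add: gd i mult.assoc)
  qed (use K C in simp)
qed

lemma bounded_linear_green_rate_deriv: "bounded_linear (\<lambda>h. green P (rate_deriv P v h))"
proof -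
  obtain K where K: "0 < K" "\<And>w. integrable lborel w \<Longrightarrow> norm (green P w) \<le> K * (\<integral>s. \<bar>w s\<bar> \<partial>lborel)"
    using green_norm_le[OF P] by blast
  obtain N where N: "0 \<le> N" "\<And>v h. (\<integral>s. \<bar>rate_deriv P v h s\<bar> \<partial>lborel) \<le> N * norm h"
    by (rule rate_deriv_integrable_le) blast
  note i = rate_deriv_integrable
  show ?thesis
  proof (rule bounded_linear_intro)
    fix h k :: "line_L2 \<times> line_L2" and c :: real
    have "AE s in lborel. rate_deriv P v (h + k) s = rate_deriv P v h s + rate_deriv P v k s"
      using rep_line_add_fst_snd[of h k]
      by eventually_elim (simp add: rate_deriv_def algebra_simps del: fst_add snd_add)
    then have "green P (rate_deriv P v (h + k)) = green P (\<lambda>s. rate_deriv P v h s + rate_deriv P v k s)"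
      by (intro green_cong_AE[OF P]) measurable
    then show "green P (rate_deriv P v (h + k)) = green P (rate_deriv P v h) + green P (rate_deriv P v k)"
      by (simp add: green_add[OF P] i)
    have "AE s in lborel. rate_deriv P v (c *\<^sub>R h) s = c * rate_deriv P v h s"
      using rep_line_scaleR[of c "fst h"] rep_line_scaleR[of c "snd h"]
      by eventually_elim (simp add: rate_deriv_def algebra_simps)
    then have "green P (rate_deriv P v (c *\<^sub>R h)) = green P (\<lambda>s. c * rate_deriv P v h s)"
      by (intro green_cong_AE[OF P]) measurable
    then show "green P (rate_deriv P v (c *\<^sub>R h)) = c *\<^sub>R green P (rate_deriv P v h)"
      by (simp add: green_cmult[OF P] i)
    show "norm (green P (rate_deriv P v h)) \<le> norm h * (K * N)"
      using order_trans[OF K(2)[OF i] mult_left_mono[OF N(2)], of v h] K(1) by (simp add: mult.commute mult.left_commute)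
  qed
qed

end

section \<open>The residual of the constraint equations\<close>

text \<open>The projection \<open>pr\<close> splits the space into range and kernel. On the range
  \<open>T\<close> is invertible by assumption; on the kernel it agrees with \<open>U\<close>, whose
  inverse \<open>U'\<close> is bounded. Invertible diagonal blocks make \<open>T\<close>
  invertible.\<close>

lemma bij_block_extension:
  fixes T U U' pr :: "'a::real_normed_vector \<Rightarrow> 'a"
  assumes lin: "bounded_linear T" "bounded_linear pr" "bounded_linear U'"
    and pr: "\<And>h. pr (pr h) = pr h"
    and bij: "bij_betw T {h. pr h = h} {h. pr h = h}" and B: "\<And>h. pr h = h \<Longrightarrow> norm h \<le> B * norm (T h)"
    and U: "\<And>h. pr h = 0 \<Longrightarrow> T h = U h" "\<And>h. pr h = 0 \<Longrightarrow> pr (U h) = 0" "\<And>h. pr h = 0 \<Longrightarrow> pr (U' h) = 0"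
      "\<And>h. U (U' h) = h" "\<And>h. U' (U h) = h"
  obtains B' where "bij T" "\<And>h. norm h \<le> B' * norm (T h)"
proof -
  interpret T: bounded_linear T by fact
  interpret pr: bounded_linear pr by fact
  interpret U': bounded_linear U' by fact
  obtain Kp where Kp: "0 < Kp" "\<And>h. norm (pr h) \<le> Kp * norm h" using pr.pos_bounded by (auto simp: mult.commute)
  obtain Ku where Ku: "0 < Ku" "\<And>h. norm (U' h) \<le> Ku * norm h" using U'.pos_bounded by (auto simp: mult.commute)
  have inS: "pr (T h) = T h" if "pr h = h" for h using bij_betwE[OF bij] that by simp
  have pr0: "pr (h - pr h) = 0" for h by (simp add: pr.diff pr)
  \<comment> \<open>\<open>T\<close> is block diagonal, so each part of \<open>h\<close> is
    estimated by the matching part of \<open>T h\<close>.\<close>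
  have prT: "pr (T h) = T (pr h)" and cT: "U (h - pr h) = T h - pr (T h)" for h
  proof -
    have "T h = T (pr h) + U (h - pr h)" using U(1)[OF pr0[of h]] by (simp add: T.diff diff_eq_eq add.commute)
    moreover from this show "pr (T h) = T (pr h)"
      using inS[OF pr, of h] U(2)[OF pr0[of h]] by (simp add: pr.add)
    ultimately show "U (h - pr h) = T h - pr (T h)" by simp
  qed
  have lower: "norm h \<le> (max B 0 * Kp + Ku * (1 + Kp)) * norm (T h)" for h
  proof -
    have "norm (pr h) \<le> B * norm (pr (T h))" using B[OF pr, of h] by (simp add: prT)
    also have "\<dots> \<le> max B 0 * norm (pr (T h))" by (intro mult_right_mono) auto
    also have "\<dots> \<le> max B 0 * (Kp * norm (T h))" by (intro mult_left_mono Kp) auto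
    finally have 1: "norm (pr h) \<le> max B 0 * (Kp * norm (T h))" .
    have "norm (h - pr h) = norm (U' (T h - pr (T h)))" by (simp add: U(5) flip: cT)
    also have "\<dots> \<le> Ku * norm (T h - pr (T h))" by (rule Ku)
    also have "\<dots> \<le> Ku * (norm (T h) + Kp * norm (T h))"
      using Ku(1) by (intro mult_left_mono order_trans[OF norm_triangle_ineq4] add_left_mono Kp) simp
    finally have 2: "norm (h - pr h) \<le> Ku * (norm (T h) + Kp * norm (T h))" .
    have "norm h \<le> norm (pr h) + norm (h - pr h)" using norm_triangle_ineq[of "pr h" "h - pr h"] by simp
    with 1 2 have "norm h \<le> max B 0 * (Kp * norm (T h)) + Ku * (norm (T h) + Kp * norm (T h))" by linarith
    then show ?thesis by (simp add: algebra_simps)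
  qed
  have "inj T"
  proof (rule injI)
    fix a b assume "T a = T b"
    then show "a = b" using lower[of "a - b"] by (simp add: T.diff)
  qed
  moreover have "\<exists>h. T h = g" for g
  proof -
    have "pr g \<in> T ` {h. pr h = h}" using bij pr by (simp add: bij_betw_def)
    then obtain a where a: "T a = pr g" by auto
    have "T (U' (g - pr g)) = g - pr g" using U(1)[OF U(3)[OF pr0]] U(4) by simp
    with a have "T (a + U' (g - pr g)) = g" by (simp add: T.add)
    then show ?thesis by blast
  qed
  ultimately have "bij T" unfolding bij_def surj_def by metis
  then show thesis using lower by (rule that)
qed

text \<open>The projection onto \<open>L2_on S\<close>; it turns membership in a parameter-dependent
  subspace into a fixed point equation.\<close>

definition restrict_line :: "real set \<Rightarrow> line_L2 \<Rightarrow> line_L2" where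
  "restrict_line S f = L2_class S (rep_line f)"

lemma restrict_line_AE:
  assumes "S \<in> sets borel"
  shows "AE x in lborel. rep_line (restrict_line S f) x = indicator S x * rep_line f x"
  unfolding restrict_line_def
  by (intro L2_class_AE L2_fun_indicator_mult rep_line_L2) (simp add: assms)

lemma bounded_linear_restrict_line:
  assumes S: "S \<in> sets borel"
  shows "bounded_linear (restrict_line S)"
proof (rule bounded_linear_intro[where K=1])
  fix f g :: line_L2 and c :: real
  have "AE x in lborel. rep_line (restrict_line S (f + g)) x = rep_line (restrict_line S f + restrict_line S g) x"
    using restrict_line_AE[OF S, of f] restrict_line_AE[OF S, of g] restrict_line_AE[OF S, of "f + g"]
      rep_line_add[of f g] rep_line_add[of "restrict_line S f" "restrict_line S g"]
    by eventually_elim (simp add: algebra_simps)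
  then show "restrict_line S (f + g) = restrict_line S f + restrict_line S g" by (rule line_L2_eqI)
  have "AE x in lborel. rep_line (restrict_line S (c *\<^sub>R f)) x = rep_line (c *\<^sub>R restrict_line S f) x"
    using restrict_line_AE[OF S, of f] restrict_line_AE[OF S, of "c *\<^sub>R f"]
      rep_line_scaleR[of c f] rep_line_scaleR[of c "restrict_line S f"]
    by eventually_elim simp
  then show "restrict_line S (c *\<^sub>R f) = c *\<^sub>R restrict_line S f" by (rule line_L2_eqI)
  have L2: "(\<lambda>x. indicator S x * rep_line f x) \<in> L2_fun lborel"
    using S by (intro L2_fun_indicator_mult rep_line_L2) simp
  have "(norm (restrict_line S f))\<^sup>2 = (\<integral>x. (indicator S x * rep_line f x)\<^sup>2 \<partial>lborel)"
    unfolding restrict_line_def L2_class_def by (rule norm_abs_line[OF L2])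
  also have "\<dots> \<le> (norm f)\<^sup>2"
    unfolding norm_line
    using L2 rep_line_square_integrable[of f]
    by (intro integral_mono) (auto simp: L2_fun_def indicator_def)
  finally have "norm (restrict_line S f) \<le> norm f" by (rule power2_le_imp_le) simp
  then show "norm (restrict_line S f) \<le> norm f * 1" by simp
qed

lemma restrict_line_eq_iff: "S \<in> sets borel \<Longrightarrow> restrict_line S f = f \<longleftrightarrow> f \<in> L2_on S"
proof
  assume S: "S \<in> sets borel" and "restrict_line S f = f"
  then show "f \<in> L2_on S" using restrict_line_AE[OF S, of f] by (auto simp: L2_on_def)
next
  assume S: "S \<in> sets borel" and "f \<in> L2_on S"
  then have "AE x in lborel. x \<notin> S \<longrightarrow> rep_line f x = 0" by (simp add: L2_on_def)
  with restrict_line_AE[OF S, of f] have "AE x in lborel. rep_line (restrict_line S f) x = rep_line f x"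
    by eventually_elim (auto simp: indicator_def)
  then show "restrict_line S f = f" by (rule line_L2_eqI)
qed

lemma restrict_line_idem:
  assumes S: "S \<in> sets borel"
  shows "restrict_line S (restrict_line S f) = restrict_line S f"
proof -
  have "AE x in lborel. x \<notin> S \<longrightarrow> rep_line (restrict_line S f) x = 0"
    using restrict_line_AE[OF S, of f] by eventually_elim simp
  then show ?thesis using S by (simp add: restrict_line_eq_iff L2_on_def)
qed

definition unit_on :: "real set \<Rightarrow> line_L2" where
  "unit_on S = L2_class S (\<lambda>_. 1)"

lemma unit_on_AE:
  assumes "a \<le> b"
  shows "AE x in lborel. rep_line (unit_on {a..b}) x = indicator {a..b} x"
  using L2_class_AE[OF bounded_on_interval_L2(1)[of "\<lambda>_. 1" a b 1]] assms
  by (auto simp: unit_on_def)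

type_synonym data = "state \<times> real \<times> real"
type_synonym unknown = "potential \<times> real"

text \<open>
  Outside the domains the equations are continued as \<open>k_eff \<phi>\<^sub>1 = 0\<close> and \<open>sigma_eff \<phi>\<^sub>2 = 0\<close>, so
  the implicit function theorem can be applied on the full type and every zero of the residual
  lies in the potential space.
\<close>

definition linear_part :: "cell \<Rightarrow> data \<times> unknown \<Rightarrow> unknown" where
  "linear_part P p =
    ((k_eff P *\<^sub>R fst (fst (snd p)) +
        (k_eff P * (2 * Rgas P * Temp P * (1 - t_plus P) / (Far P * c_ini P))) *\<^sub>R
          (restrict_line {0..L P} (fst (fst (fst p))) - fst (snd (fst p)) *\<^sub>R unit_on {0..L P}),
      sigma_eff P *\<^sub>R snd (fst (snd p)) - sigma_eff P *\<^sub>R snd (snd p) *\<^sub>R unit_on {L1 P..L P}),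
     snd (snd (fst p)))"

definition local_values :: "cell \<Rightarrow> 3 \<Rightarrow> data \<times> unknown \<Rightarrow> line_L2 \<times> line_L2" where
  "local_values P k p =
    (snd (fst (snd p)) - fst (fst (snd p)), surface_conc P k (snd (fst (fst p)) $ k))"

definition residual :: "cell \<Rightarrow> data \<times> unknown \<Rightarrow> unknown" where
  "residual P p = linear_part P p +
    (\<Sum>k\<in>UNIV. area P $ k *\<^sub>R green P (rate_at P (local_values P k p)))"

definition residual_deriv :: "cell \<Rightarrow> data \<times> unknown \<Rightarrow> data \<times> unknown \<Rightarrow> unknown" where
  "residual_deriv P p h = linear_part P h +
    (\<Sum>k\<in>UNIV. area P $ k *\<^sub>R green P (rate_deriv P (local_values P k p) (local_values P k h)))"

definition domain_proj :: "cell \<Rightarrow> unknown \<Rightarrow> unknown" where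
  "domain_proj P h = ((restrict_line {0..L P} (fst (fst h)), restrict_line {L1 P..L P} (snd (fst h))), snd h)"

lemma bounded_linear_domain_proj: "bounded_linear (domain_proj P)"
  unfolding domain_proj_def
  by (intro bounded_linear_Pair bounded_linear_compose[OF bounded_linear_restrict_line]
      bounded_linear_compose[OF bounded_linear_fst] bounded_linear_compose[OF bounded_linear_snd]
      bounded_linear_fst bounded_linear_snd) auto

lemma domain_proj_idem: "domain_proj P (domain_proj P h) = domain_proj P h"
  by (simp add: domain_proj_def restrict_line_idem)

lemma domain_proj_eq_iff: "domain_proj P h = h \<longleftrightarrow> h \<in> potential_space P \<times> UNIV"
  by (cases h) (auto simp: domain_proj_def potential_space_def restrict_line_eq_iff)

lemma subspace_potential_space: "subspace (potential_space P)"
proof -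
  have "bounded_linear (restrict_line {a..b})" for a b by (rule bounded_linear_restrict_line) simp
  then have *: "linear (restrict_line {a..b})" for a b by (simp add: bounded_linear.linear)
  show ?thesis
    by (rule subspaceI)
      (auto simp: potential_space_def linear_0[OF *] linear_add[OF *] linear_scale[OF *] zero_prod_def
        simp flip: restrict_line_eq_iff)
qed

context
  fixes P :: cell
  assumes P: "valid_cell P"
begin

lemma green_sum:
  assumes "\<And>k. k \<in> A \<Longrightarrow> integrable lborel (f k)"
  shows "green P (\<lambda>s. \<Sum>k\<in>A. c k * f k s) = (\<Sum>k\<in>A. c k *\<^sub>R green P (f k))"
  using assms
proof (induction A rule: infinite_finite_induct)
  case (insert k A)
  then show ?case
    by (simp add: green_add[OF P] green_cmult[OF P])
qed (use green_cmult[OF P, of "\<lambda>_. 0" 0] in simp_all)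

lemma bounded_linear_linear_part: "bounded_linear (linear_part P)"
  unfolding linear_part_def
  by (intro bounded_linear_Pair bounded_linear_add bounded_linear_sub
      bounded_linear_compose[OF bounded_linear_scaleR_right]
      bounded_linear_compose[OF bounded_linear_scaleR_left]
      bounded_linear_compose[OF bounded_linear_restrict_line]
      bounded_linear_compose[OF bounded_linear_fst] bounded_linear_compose[OF bounded_linear_snd]
      bounded_linear_fst bounded_linear_snd) auto

lemma bounded_linear_local_values: "bounded_linear (local_values P k)"
  unfolding local_values_def
  by (intro bounded_linear_Pair bounded_linear_sub
      bounded_linear_compose[OF bounded_linear_surface_conc[OF P]]
      bounded_linear_compose[OF bounded_linear_vec_nth]
      bounded_linear_compose[OF bounded_linear_fst] bounded_linear_compose[OF bounded_linear_snd]
      bounded_linear_fst bounded_linear_snd)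

lemma bounded_linear_residual_deriv: "bounded_linear (residual_deriv P p)"
  unfolding residual_deriv_def
  by (intro bounded_linear_add bounded_linear_linear_part bounded_linear_sum
      bounded_linear_compose[OF bounded_linear_scaleR_right]
      bounded_linear_compose[OF bounded_linear_green_rate_deriv[OF P]] bounded_linear_local_values)

text \<open>The linear part cancels from both differences. The local values are bounded linear in
  the point, so the estimates for \<open>green\<close> pull back with the square of their bound and
  are summed with the areas.\<close>

lemma residual_quadratic:
  obtains C where
    "\<And>p h. norm (residual P (p + h) - residual P p - residual_deriv P p h) \<le> C * (norm h)\<^sup>2"
    "\<And>p p' h. norm (residual_deriv P p' h - residual_deriv P p h) \<le> C * norm (p' - p) * norm h"
proof -
  obtain C where C: "0 \<le> C"
    "\<And>v h. norm (green P (rate_at P (v + h)) - green P (rate_at P v) - green P (rate_deriv P v h)) \<le> C * (norm h)\<^sup>2"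
    "\<And>v v' h. norm (green P (rate_deriv P v' h) - green P (rate_deriv P v h)) \<le> C * (norm (v' - v) * norm h)"
    by (rule green_rate_quadratic[OF P]) blast
  have "\<exists>K. \<forall>h. norm (local_values P k h) \<le> K * norm h" for k
    using bounded_linear.bounded[OF bounded_linear_local_values, of k] by (auto simp: mult.commute)
  then obtain K where K: "\<And>k h. norm (local_values P k h) \<le> K k * norm h" by metis
  note lin = linear_add[OF bounded_linear.linear[OF bounded_linear_local_values]]
    linear_diff[OF bounded_linear.linear[OF bounded_linear_local_values]]
    linear_add[OF bounded_linear.linear[OF bounded_linear_linear_part]]
  have prod: "norm (local_values P k a) * norm (local_values P k b) \<le> (K k)\<^sup>2 * (norm a * norm b)" for k a b
    using mult_mono[OF K[of k a] K[of k b]] order_trans[OF norm_ge_zero K[of k a]]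
    by (simp add: power2_eq_square mult.assoc mult.left_commute)
  have area: "0 \<le> area P $ k" for k using P by (auto simp: valid_cell_def intro: less_imp_le)
  show thesis
  proof (rule that)
    fix p h :: "data \<times> unknown"
    let ?v = "\<lambda>k. local_values P k"
    have "residual P (p + h) - residual P p - residual_deriv P p h =
      (\<Sum>k\<in>UNIV. area P $ k *\<^sub>R (green P (rate_at P (?v k p + ?v k h)) - green P (rate_at P (?v k p))
        - green P (rate_deriv P (?v k p) (?v k h))))"
      by (simp add: residual_def residual_deriv_def lin sum_subtractf scaleR_diff_right)
    also have "norm \<dots> \<le> (\<Sum>k\<in>UNIV. area P $ k * (C * ((K k)\<^sup>2 * (norm h)\<^sup>2)))"
    proof (rule sum_norm_le)
      fix k
      have "norm (green P (rate_at P (?v k p + ?v k h)) - green P (rate_at P (?v k p))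
        - green P (rate_deriv P (?v k p) (?v k h))) \<le> C * ((K k)\<^sup>2 * (norm h)\<^sup>2)"
        using C(1) prod[of k h h] by (intro order_trans[OF C(2)] mult_left_mono) (simp_all add: power2_eq_square)
      then show "norm (area P $ k *\<^sub>R (green P (rate_at P (?v k p + ?v k h)) - green P (rate_at P (?v k p))
        - green P (rate_deriv P (?v k p) (?v k h)))) \<le> area P $ k * (C * ((K k)\<^sup>2 * (norm h)\<^sup>2))"
        using area by (simp add: mult_left_mono)
    qed
    also have "\<dots> = (\<Sum>k\<in>UNIV. area P $ k * (C * (K k)\<^sup>2)) * (norm h)\<^sup>2"
      by (simp add: sum_distrib_right mult.assoc)
    finally show "norm (residual P (p + h) - residual P p - residual_deriv P p h)
      \<le> (\<Sum>k\<in>UNIV. area P $ k * (C * (K k)\<^sup>2)) * (norm h)\<^sup>2" .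
  next
    fix p p' h :: "data \<times> unknown"
    let ?v = "\<lambda>k. local_values P k"
    have "residual_deriv P p' h - residual_deriv P p h =
      (\<Sum>k\<in>UNIV. area P $ k *\<^sub>R (green P (rate_deriv P (?v k p') (?v k h)) - green P (rate_deriv P (?v k p) (?v k h))))"
      by (simp add: residual_deriv_def sum_subtractf scaleR_diff_right)
    also have "norm \<dots> \<le> (\<Sum>k\<in>UNIV. area P $ k * (C * ((K k)\<^sup>2 * (norm (p' - p) * norm h))))"
    proof (rule sum_norm_le)
      fix k
      have "norm (green P (rate_deriv P (?v k p') (?v k h)) - green P (rate_deriv P (?v k p) (?v k h)))
        \<le> C * ((K k)\<^sup>2 * (norm (p' - p) * norm h))"
        using C(1) prod[of k "p' - p" h] by (intro order_trans[OF C(3)] mult_left_mono) (simp_all add: lin)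
      then show "norm (area P $ k *\<^sub>R (green P (rate_deriv P (?v k p') (?v k h)) - green P (rate_deriv P (?v k p) (?v k h))))
        \<le> area P $ k * (C * ((K k)\<^sup>2 * (norm (p' - p) * norm h)))"
        using area by (simp add: mult_left_mono)
    qed
    also have "\<dots> = (\<Sum>k\<in>UNIV. area P $ k * (C * (K k)\<^sup>2)) * norm (p' - p) * norm h"
      by (simp add: sum_distrib_right mult.assoc)
    finally show "norm (residual_deriv P p' h - residual_deriv P p h)
      \<le> (\<Sum>k\<in>UNIV. area P $ k * (C * (K k)\<^sup>2)) * norm (p' - p) * norm h" .
  qed
qed

text \<open>The surface concentration was cut off outside the electrode, so the identification is
  made there only; the rate vanishes elsewhere anyway.\<close>

lemma local_values_AE:
  "AE s in lborel. s \<in> {L1 P..L P} \<longrightarrow>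
    rep_line (fst (local_values P k ((c, c0, I), (\<phi>, \<phi>0)))) s = rep_line (snd \<phi>) s - rep_line (fst \<phi>) s \<and>
    rep_line (snd (local_values P k ((c, c0, I), (\<phi>, \<phi>0)))) s = c_bar P c k s"
  using rep_line_diff[of "snd \<phi>" "fst \<phi>"] surface_conc_AE[OF P, of k "snd c $ k"]
  by eventually_elim (simp add: local_values_def c_bar_eq)

lemma i_bar_AE:
  "AE s in lborel. i_bar P c \<phi> k s = rate_at P (local_values P k ((c, c0, I), (\<phi>, \<phi>0))) s"
  using local_values_AE[of k c c0 I \<phi> \<phi>0]
  by eventually_elim (auto simp: i_bar_def rate_eq rate_at_def indicator_def)

lemma i_bar_measurable [measurable]: "i_bar P c \<phi> k \<in> borel_measurable borel"
proof -
  note kinetics_measurable[OF P, measurable]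
  show ?thesis unfolding i_bar_def[abs_def] rate_eq by measurable
qed

lemma residual_components:
  fixes c \<phi> c0 I \<phi>0
  defines "J \<equiv> (\<lambda>s. \<Sum>k\<in>UNIV. area P $ k * i_bar P c \<phi> k s)"
    and "r \<equiv> residual P ((c, c0, I), (\<phi>, \<phi>0))"
  shows "AE x in lborel. rep_line (fst (fst r)) x = k_eff P * rep_line (fst \<phi>) x +
      indicator {0..L P} x * (k_eff P * (2 * Rgas P * Temp P * (1 - t_plus P) / (Far P * c_ini P)) * (rep_line (fst c) x - c0)
        + dbl_int J x - x * (LBINT s:{0..L P}. J s))"
    and "AE x in lborel. rep_line (snd (fst r)) x = sigma_eff P * rep_line (snd \<phi>) x +
      indicator {L1 P..L P} x * (- sigma_eff P * \<phi>0 - dbl_int J x)"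
    and "snd r = I + (LBINT s:{0..L P}. J s)"
proof -
  define p where "p = ((c, c0, I), (\<phi>, \<phi>0))"
  define w where "w s = (\<Sum>k\<in>UNIV. area P $ k * rate_at P (local_values P k p) s)" for s
  have [measurable]: "J \<in> borel_measurable borel" unfolding J_def by measurable
  have w: "integrable lborel w"
    unfolding w_def by (intro Bochner_Integration.integrable_sum integrable_mult_right rate_at_integrable[OF P])
  have [measurable]: "w \<in> borel_measurable borel" using w by auto
  have "AE s in lborel. \<forall>k. i_bar P c \<phi> k s = rate_at P (local_values P k p) s"
    unfolding p_def by (simp add: AE_all_countable i_bar_AE)
  then have Jw: "AE s in lborel. J s = w s"
    by eventually_elim (simp add: J_def w_def)
  have r: "r = linear_part P p + green P w"
    by (simp add: r_def residual_def p_def w_def[abs_def] green_sum rate_at_integrable[OF P])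
  have dw: "dbl_int w x = dbl_int J x" for x by (rule dbl_int_cong_AE) (use Jw in \<open>auto elim: AE_mp\<close>)
  have iw: "(LBINT s:{0..L P}. w s) = (LBINT s:{0..L P}. J s)"
    unfolding set_lebesgue_integral_def
    by (rule integral_cong_AE; (measurable)?) (use Jw in eventually_elim, simp)
  show "snd r = I + (LBINT s:{0..L P}. J s)"
    by (simp add: r linear_part_def green_def p_def iw)
  note len = cell_len[OF P]
  let ?K = "k_eff P * (2 * Rgas P * Temp P * (1 - t_plus P) / (Far P * c_ini P))"
  define a b d where "a = restrict_line {0..L P} (fst c)" and "b = unit_on {0..L P}"
    and "d = L2_class {0..L P} (\<lambda>x. dbl_int w x - x * (LBINT s:{0..L P}. w s))"
  have e: "fst (fst r) = k_eff P *\<^sub>R fst \<phi> + ?K *\<^sub>R (a - c0 *\<^sub>R b) + d"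
    by (simp add: r linear_part_def green_def p_def a_def b_def d_def)
  have ab: "AE x in lborel. rep_line a x = indicator {0..L P} x * rep_line (fst c) x"
    "AE x in lborel. rep_line b x = indicator {0..L P} x"
    "AE x in lborel. rep_line d x = indicator {0..L P} x * (dbl_int w x - x * (LBINT s:{0..L P}. w s))"
    unfolding a_def b_def d_def
    by (intro restrict_line_AE unit_on_AE L2_class_AE green_component_L2[OF P w]; use len in simp)+
  show "AE x in lborel. rep_line (fst (fst r)) x = k_eff P * rep_line (fst \<phi>) x +
      indicator {0..L P} x * (?K * (rep_line (fst c) x - c0) + dbl_int J x - x * (LBINT s:{0..L P}. J s))"
    unfolding e
    using ab rep_line_add[of "k_eff P *\<^sub>R fst \<phi> + ?K *\<^sub>R (a - c0 *\<^sub>R b)" d]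
      rep_line_add[of "k_eff P *\<^sub>R fst \<phi>" "?K *\<^sub>R (a - c0 *\<^sub>R b)"] rep_line_scaleR[of "k_eff P" "fst \<phi>"]
      rep_line_scaleR[of ?K "a - c0 *\<^sub>R b"] rep_line_diff[of a "c0 *\<^sub>R b"] rep_line_scaleR[of c0 b]
    by eventually_elim (simp add: dw iw algebra_simps)
  define b2 d2 where "b2 = unit_on {L1 P..L P}" and "d2 = L2_class {L1 P..L P} (\<lambda>x. - dbl_int w x)"
  have e2: "snd (fst r) = sigma_eff P *\<^sub>R snd \<phi> - sigma_eff P *\<^sub>R \<phi>0 *\<^sub>R b2 + d2"
    by (simp add: r linear_part_def green_def p_def b2_def d2_def)
  have ab2: "AE x in lborel. rep_line b2 x = indicator {L1 P..L P} x"
    "AE x in lborel. rep_line d2 x = indicator {L1 P..L P} x * - dbl_int w x"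
    unfolding b2_def d2_def
    by (intro unit_on_AE L2_class_AE green_component_L2[OF P w]; use len in simp)+
  show "AE x in lborel. rep_line (snd (fst r)) x = sigma_eff P * rep_line (snd \<phi>) x +
      indicator {L1 P..L P} x * (- sigma_eff P * \<phi>0 - dbl_int J x)"
    unfolding e2
    using ab2 rep_line_add[of "sigma_eff P *\<^sub>R snd \<phi> - sigma_eff P *\<^sub>R \<phi>0 *\<^sub>R b2" d2]
      rep_line_diff[of "sigma_eff P *\<^sub>R snd \<phi>" "sigma_eff P *\<^sub>R \<phi>0 *\<^sub>R b2"]
      rep_line_scaleR[of "sigma_eff P" "snd \<phi>"] rep_line_scaleR[of "sigma_eff P" "\<phi>0 *\<^sub>R b2"] rep_line_scaleR[of \<phi>0 b2]
    by eventually_elim (simp add: dw algebra_simps)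
qed

text \<open>Off the domains only the multiple of the potential survives, and its nonzero coefficient
  forces the extension by zero. On the domains, division by \<open>k_eff P\<close> and
  \<open>sigma_eff P\<close> recovers the integrated equations.\<close>

lemma residual_eq_0_iff:
  "residual P ((c, c0, I), (\<phi>, \<phi>0)) = 0 \<longleftrightarrow> \<phi> \<in> potential_space P \<and> constraint_eqs P c \<phi> I c0 \<phi>0"
proof -
  define r where "r = residual P ((c, c0, I), (\<phi>, \<phi>0))"
  define J where "J s = (\<Sum>k\<in>UNIV. area P $ k * i_bar P c \<phi> k s)" for s
  let ?S1 = "{0..L P}" and ?S2 = "{L1 P..L P}"
  have k: "k_eff P \<noteq> 0" "sigma_eff P \<noteq> 0" using P by (auto simp: valid_cell_def)
  note comp = residual_components[of c c0 I \<phi> \<phi>0, folded r_def J_def[abs_def]]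
  have 1: "fst (fst r) = 0 \<longleftrightarrow> (AE x in lborel. (x \<notin> ?S1 \<longrightarrow> rep_line (fst \<phi>) x = 0) \<and>
      (x \<in> ?S1 \<longrightarrow> rep_line (fst \<phi>) x = x / k_eff P * (LBINT s:?S1. J s)
            - 2 * Rgas P * Temp P * (1 - t_plus P) / (Far P * c_ini P) * (rep_line (fst c) x - c0)
            - 1 / k_eff P * dbl_int J x))"
    unfolding line_L2_eq_0_iff
  proof (rule eventually_subst)
    show "AE x in lborel. rep_line (fst (fst r)) x = 0 \<longleftrightarrow> (x \<notin> ?S1 \<longrightarrow> rep_line (fst \<phi>) x = 0) \<and>
      (x \<in> ?S1 \<longrightarrow> rep_line (fst \<phi>) x = x / k_eff P * (LBINT s:?S1. J s)
            - 2 * Rgas P * Temp P * (1 - t_plus P) / (Far P * c_ini P) * (rep_line (fst c) x - c0)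
            - 1 / k_eff P * dbl_int J x)"
      using comp(1)
    proof eventually_elim
      case (elim x)
      have *: "k * u + (k * q * v + d - x * j) = 0 \<longleftrightarrow> u = x / k * j - q * v - 1 / k * d"
        if "k \<noteq> 0" for k u q v d x j :: real
      proof -
        have "u = x / k * j - q * v - 1 / k * d \<longleftrightarrow> k * u = k * (x / k * j - q * v - 1 / k * d)"
          using that by simp
        also have "k * (x / k * j - q * v - 1 / k * d) = x * j - k * q * v - d"
          using that by (simp add: right_diff_distrib)
        finally show ?thesis by linarith
      qed
      define \<kappa> where "\<kappa> = 2 * Rgas P * Temp P * (1 - t_plus P) / (Far P * c_ini P)"
      show ?case
        unfolding elim \<kappa>_def[symmetric] using *[OF k(1)] k by (auto simp: indicator_def)
    qed
  qed
  have 2: "snd (fst r) = 0 \<longleftrightarrow> (AE x in lborel. (x \<notin> ?S2 \<longrightarrow> rep_line (snd \<phi>) x = 0) \<and>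
      (x \<in> ?S2 \<longrightarrow> rep_line (snd \<phi>) x = \<phi>0 + 1 / sigma_eff P * dbl_int J x))"
    unfolding line_L2_eq_0_iff
  proof (rule eventually_subst)
    show "AE x in lborel. rep_line (snd (fst r)) x = 0 \<longleftrightarrow> (x \<notin> ?S2 \<longrightarrow> rep_line (snd \<phi>) x = 0) \<and>
      (x \<in> ?S2 \<longrightarrow> rep_line (snd \<phi>) x = \<phi>0 + 1 / sigma_eff P * dbl_int J x)"
      using comp(2)
    proof eventually_elim
      case (elim x)
      have *: "k * u + (- k * q - d) = 0 \<longleftrightarrow> u = q + 1 / k * d" if "k \<noteq> 0" for k u q d :: real
        using that by (auto simp: field_simps)
      show ?case
        unfolding elim using *[OF k(2)] k by (auto simp: indicator_def)
    qed
  qed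
  have "r = 0 \<longleftrightarrow> fst (fst r) = 0 \<and> snd (fst r) = 0 \<and> snd r = 0" by (simp add: prod_eq_iff)
  then show ?thesis
    unfolding 1 2 comp(3) AE_conj_iff constraint_eqs_def Let_def potential_space_def L2_on_def
    by (auto simp: mem_Times_iff r_def J_def[abs_def])
qed

end

section \<open>The operator matrix as a partial derivative\<close>

context
  fixes P :: cell
  assumes P: "valid_cell P"
begin

text \<open>The rate depends on the potentials through
  \<open>\<phi>\<^sub>2 - \<phi>\<^sub>1\<close> alone, so this one function gives both partial
  derivatives up to sign.\<close>

definition kinetics_slope :: "state \<Rightarrow> potential \<Rightarrow> 3 \<Rightarrow> real \<Rightarrow> real" where
  "kinetics_slope c \<phi> k s = indicator {L1 P..L P} s *
    deriv (kinetics P) (rep_line (snd \<phi>) s - rep_line (fst \<phi>) s - surface_ocp P (c_bar P c k s))"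

lemma kinetics_DERIV: "(kinetics P has_real_derivative deriv (kinetics P) x) (at x)"
proof -
  obtain M where "lipschitz_C1 M (kinetics P)" by (rule cell_lipschitz[OF P])
  then show ?thesis by (rule lipschitz_C1D)
qed

lemma g1_eq: "g1 P c \<phi> k s = - kinetics_slope c \<phi> k s"
  unfolding g1_def rate_eq kinetics_slope_def
  by (rule DERIV_imp_deriv) (auto intro!: derivative_eq_intros DERIV_chain2[OF kinetics_DERIV])

lemma g2_eq: "g2 P c \<phi> k s = kinetics_slope c \<phi> k s"
  unfolding g2_def rate_eq kinetics_slope_def
  by (rule DERIV_imp_deriv) (auto intro!: derivative_eq_intros DERIV_chain2[OF kinetics_DERIV])

lemma kinetics_slope_mult_AE:
  "AE s in lborel. kinetics_slope c \<phi> k s * rep_line u s =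
    rate_deriv P (local_values P k ((c, c0, I), (\<phi>, \<phi>0))) (u, 0) s"
  using local_values_AE[OF P, of k c c0 I \<phi> \<phi>0] rep_line_zero
  by eventually_elim (auto simp: kinetics_slope_def rate_deriv_def indicator_def)

lemma kinetics_slope_measurable [measurable]: "kinetics_slope c \<phi> k \<in> borel_measurable borel"
proof -
  note kinetics_measurable[OF P, measurable]
  show ?thesis unfolding kinetics_slope_def[abs_def] by measurable
qed

lemma kinetics_slope_mult_integrable: "integrable lborel (\<lambda>s. kinetics_slope c \<phi> k s * rep_line u s)"
proof (rule integrable_cong_AE_imp[OF rate_deriv_integrable[OF P]])
  show "AE s in lborel. rate_deriv P (local_values P k ((c, 0, 0), (\<phi>, 0))) (u, 0) s =
      kinetics_slope c \<phi> k s * rep_line u s"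
    using kinetics_slope_mult_AE[of c \<phi> k u 0 0 0] by eventually_elim simp
qed measurable

text \<open>As \<open>g1\<close> and \<open>g2\<close> are opposite, the two columns act through
  \<open>h2 - h1\<close>, and all integral entries are \<open>green\<close> of the single density
  \<open>w\<close>. Membership in the potential space is what reconciles the cut-off multiplication
  terms of \<open>DO\<close> with the uncut ones of the extended residual.\<close>

lemma DO_eq_residual_deriv:
  assumes h: "h \<in> potential_space P \<times> UNIV"
  shows "DO P c \<phi> I c0 \<phi>0 h = residual_deriv P ((c, c0, I), (\<phi>, \<phi>0)) (0, h)"
proof -
  obtain h1 h2 h3 where hh: "h = ((h1, h2), h3)" by (metis prod.collapse)
  define w where "w s = (\<Sum>k\<in>UNIV. area P $ k * (kinetics_slope c \<phi> k s * rep_line (h2 - h1) s))" for s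
  define w1 where "w1 u s = (\<Sum>k\<in>UNIV. area P $ k * (kinetics_slope c \<phi> k s * rep_line u s))" for u s
  have i1: "integrable lborel (w1 u)" for u
    unfolding w1_def by (intro Bochner_Integration.integrable_sum integrable_mult_right kinetics_slope_mult_integrable)
  have w: "w = w1 (h2 - h1)" by (simp add: w_def[abs_def] w1_def[abs_def])
  have iw: "integrable lborel w" unfolding w by (rule i1)
  have w21: "AE s in lborel. w s = w1 h2 s - w1 h1 s"
    using rep_line_diff[of h2 h1]
    by eventually_elim (simp add: w_def w1_def right_diff_distrib sum_subtractf)
  let ?v = "\<lambda>k. local_values P k ((c, c0, I), (\<phi>, \<phi>0))"
  have sc0: "surface_conc P k 0 = 0" for k
    using linear_0[OF bounded_linear.linear[OF bounded_linear_surface_conc[OF P]]] .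
  have lin0: "restrict_line {0..L P} 0 = 0"
    using linear_0[OF bounded_linear.linear[OF bounded_linear_restrict_line]] by simp
  have "green P (rate_deriv P (?v k) (local_values P k (0, h))) =
      green P (\<lambda>s. kinetics_slope c \<phi> k s * rep_line (h2 - h1) s)" for k
    by (rule green_cong_AE[OF P]; (use rate_deriv_measurable[OF P] in measurable)?)
      (use kinetics_slope_mult_AE[of c \<phi> k "h2 - h1" c0 I \<phi>0] in
        \<open>eventually_elim, simp add: local_values_def hh sc0\<close>)
  then have R: "residual_deriv P ((c, c0, I), (\<phi>, \<phi>0)) (0, h) =
      ((k_eff P *\<^sub>R h1, sigma_eff P *\<^sub>R h2 - sigma_eff P *\<^sub>R h3 *\<^sub>R unit_on {L1 P..L P}), 0) + green P w"
    by (simp add: residual_deriv_def linear_part_def hh lin0 w_def[abs_def]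
        green_sum[OF P] kinetics_slope_mult_integrable)
  have [measurable]: "w \<in> borel_measurable borel" "w1 u \<in> borel_measurable borel" for u
    using iw i1[of u] by auto
  have d: "dbl_int w x = dbl_int (w1 h2) x - dbl_int (w1 h1) x" for x
  proof -
    have "dbl_int w x = dbl_int (\<lambda>s. w1 h2 s + (-1) * w1 h1 s) x"
      by (rule dbl_int_cong_AE; (measurable)?) (use w21 in eventually_elim, simp)
    also have "\<dots> = dbl_int (w1 h2) x + dbl_int (\<lambda>s. (-1) * w1 h1 s) x"
      by (intro dbl_int_add integrable_mult_right i1)
    finally show ?thesis unfolding dbl_int_cmult by simp
  qed
  have i: "(LBINT s:{0..L P}. w s) = (LBINT s:{0..L P}. w1 h2 s) - (LBINT s:{0..L P}. w1 h1 s)"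
  proof -
    have "(LBINT s:{0..L P}. w s) = (LBINT s:{0..L P}. w1 h2 s - w1 h1 s)"
      unfolding set_lebesgue_integral_def
      by (rule integral_cong_AE; (measurable)?) (use w21 in eventually_elim, simp)
    also have "\<dots> = (LBINT s:{0..L P}. w1 h2 s) - (LBINT s:{0..L P}. w1 h1 s)"
      by (intro set_integral_diff set_integrable_lborel i1) auto
    finally show ?thesis .
  qed
  have G2: "(\<lambda>s. \<Sum>k\<in>UNIV. area P $ k * (g2 P c \<phi> k s * rep_line h2 s)) = w1 h2"
    by (simp add: w1_def[abs_def] g2_eq)
  have G1: "(LBINT s:{0..L P}. \<Sum>k\<in>UNIV. area P $ k * (g1 P c \<phi> k s * rep_line h1 s)) = - (LBINT s:{0..L P}. w1 h1 s)"
    by (simp add: w1_def g1_eq sum_negf set_lebesgue_integral_def)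
  have D2: "(\<Sum>k\<in>UNIV. area P $ k * dbl_int (\<lambda>s. g2 P c \<phi> k s * rep_line h2 s) x) = dbl_int (w1 h2) x" for x
    unfolding w1_def[abs_def] by (subst dbl_int_sum) (simp_all add: kinetics_slope_mult_integrable g2_eq)
  have D1: "(\<Sum>k\<in>UNIV. area P $ k * dbl_int (\<lambda>s. g1 P c \<phi> k s * rep_line h1 s) x) = - dbl_int (w1 h1) x" for x
  proof -
    have "dbl_int (\<lambda>s. g1 P c \<phi> k s * rep_line h1 s) x = - dbl_int (\<lambda>s. kinetics_slope c \<phi> k s * rep_line h1 s) x" for k
      using dbl_int_cmult[of "-1" "\<lambda>s. kinetics_slope c \<phi> k s * rep_line h1 s" x] by (simp add: g1_eq)
    then show ?thesis
      unfolding w1_def[abs_def]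
      by (subst dbl_int_sum) (simp_all add: kinetics_slope_mult_integrable sum_negf)
  qed
  have DO: "DO P c \<phi> I c0 \<phi>0 h =
    ((L2_class {0..L P} (\<lambda>x. k_eff P * rep_line h1 x + (dbl_int w x - x * (LBINT s:{0..L P}. w s))),
      L2_class {L1 P..L P} (\<lambda>x. sigma_eff P * rep_line h2 x - dbl_int w x - sigma_eff P * h3)),
      LBINT s:{0..L P}. w s)"
    unfolding DO_def hh Let_def prod.case G2 G1 D1 D2 d i
    by (simp add: algebra_simps)
  note len = cell_len[OF P]
  have in_space: "AE x in lborel. x \<notin> {0..L P} \<longrightarrow> rep_line h1 x = 0"
    "AE x in lborel. x \<notin> {L1 P..L P} \<longrightarrow> rep_line h2 x = 0"
    using h by (auto simp: hh potential_space_def L2_on_def)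
  note gl = green_component_L2[OF P iw]
  have ind: "(\<lambda>x. indicator {a..b} x * (c * rep_line u x)) \<in> L2_fun lborel" for a b c :: real and u
    by (intro L2_fun_indicator_mult L2_fun_scale rep_line_L2) simp
  have L2a: "(\<lambda>x. indicator {0..L P} x * (k_eff P * rep_line h1 x + (dbl_int w x - x * (LBINT s:{0..L P}. w s)))) \<in> L2_fun lborel"
    using L2_fun_add[OF ind gl(1)] by (simp add: distrib_left)
  let ?a = "L2_class {0..L P} (\<lambda>x. dbl_int w x - x * (LBINT s:{0..L P}. w s))"
  have 1: "k_eff P *\<^sub>R h1 + ?a = L2_class {0..L P} (\<lambda>x. k_eff P * rep_line h1 x + (dbl_int w x - x * (LBINT s:{0..L P}. w s)))"
  proof (rule L2_class_eqI[OF L2a])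
    show "AE x in lborel. rep_line (k_eff P *\<^sub>R h1 + ?a) x =
        indicator {0..L P} x * (k_eff P * rep_line h1 x + (dbl_int w x - x * (LBINT s:{0..L P}. w s)))"
      using in_space(1) L2_class_AE[OF gl(1)] rep_line_add[of "k_eff P *\<^sub>R h1" ?a] rep_line_scaleR[of "k_eff P" h1]
      by eventually_elim (auto simp: indicator_def)
  qed
  have c: "(\<lambda>x. indicator {L1 P..L P} x * (- (sigma_eff P * h3))) \<in> L2_fun lborel"
    by (rule bounded_on_interval_L2(1)[where m="\<bar>sigma_eff P * h3\<bar>"]) (use len in auto)
  have L2b: "(\<lambda>x. indicator {L1 P..L P} x * (sigma_eff P * rep_line h2 x - dbl_int w x - sigma_eff P * h3)) \<in> L2_fun lborel"
    using L2_fun_add[OF L2_fun_add[OF ind gl(2)] c] by (simp add: algebra_simps)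
  let ?b = "L2_class {L1 P..L P} (\<lambda>x. - dbl_int w x)" and ?u = "unit_on {L1 P..L P}"
  have 2: "sigma_eff P *\<^sub>R h2 - sigma_eff P *\<^sub>R h3 *\<^sub>R ?u + ?b
      = L2_class {L1 P..L P} (\<lambda>x. sigma_eff P * rep_line h2 x - dbl_int w x - sigma_eff P * h3)"
  proof (rule L2_class_eqI[OF L2b])
    have "AE x in lborel. rep_line ?u x = indicator {L1 P..L P} x" using len by (intro unit_on_AE) simp
    then show "AE x in lborel. rep_line (sigma_eff P *\<^sub>R h2 - sigma_eff P *\<^sub>R h3 *\<^sub>R ?u + ?b) x =
        indicator {L1 P..L P} x * (sigma_eff P * rep_line h2 x - dbl_int w x - sigma_eff P * h3)"
      using in_space(2) L2_class_AE[OF gl(2)] rep_line_add[of "sigma_eff P *\<^sub>R h2 - sigma_eff P *\<^sub>R h3 *\<^sub>R ?u" ?b]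
        rep_line_diff[of "sigma_eff P *\<^sub>R h2" "sigma_eff P *\<^sub>R h3 *\<^sub>R ?u"]
        rep_line_scaleR[of "sigma_eff P" h2] rep_line_scaleR[of "sigma_eff P" "h3 *\<^sub>R ?u"] rep_line_scaleR[of h3 ?u]
      by eventually_elim (auto simp: indicator_def)
  qed
  show ?thesis by (simp add: R DO green_def flip: 1 2)
qed

text \<open>An increment vanishing on both domains is invisible to the rate, which lives on the
  electrode; only multiplication by the coefficients remains.\<close>

lemma residual_deriv_off_domain:
  assumes "domain_proj P h = 0"
  shows "residual_deriv P p (0, h) = ((k_eff P *\<^sub>R fst (fst h), sigma_eff P *\<^sub>R snd (fst h)), 0)"
proof -
  have h: "restrict_line {0..L P} (fst (fst h)) = 0" "restrict_line {L1 P..L P} (snd (fst h)) = 0" "snd h = 0"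
    using assms by (auto simp: domain_proj_def zero_prod_def)
  have sc0: "surface_conc P k 0 = 0" for k
    using linear_0[OF bounded_linear.linear[OF bounded_linear_surface_conc[OF P]]] .
  have lin0: "restrict_line {0..L P} 0 = 0"
    using linear_0[OF bounded_linear.linear[OF bounded_linear_restrict_line]] by simp
  have g0: "green P (\<lambda>_. 0) = 0" using green_cmult[OF P, of "\<lambda>_. 0" 0] by simp
  have "AE s in lborel. s \<in> {L1 P..L P} \<longrightarrow> rep_line (snd (fst h) - fst (fst h)) s = 0"
    using restrict_line_AE[of "{0..L P}" "fst (fst h)", unfolded h, OF atLeastAtMost_borel]
      restrict_line_AE[of "{L1 P..L P}" "snd (fst h)", unfolded h, OF atLeastAtMost_borel]
      rep_line_zero rep_line_diff[of "snd (fst h)" "fst (fst h)"]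
  proof eventually_elim
    case (elim s)
    then show ?case using cell_len[OF P] by (auto simp: indicator_def)
  qed
  then have "AE s in lborel. rate_deriv P v (local_values P k (0, h)) s = 0" for v k
    using rep_line_zero by eventually_elim (auto simp: rate_deriv_def local_values_def sc0 indicator_def)
  then have "green P (rate_deriv P v (local_values P k (0, h))) = green P (\<lambda>_. 0)" for v k
    by (intro green_cong_AE[OF P] rate_deriv_measurable[OF P]) auto
  then show ?thesis
    by (simp add: residual_deriv_def linear_part_def g0 lin0 h)
qed

lemma residual_deriv_bij:
  assumes ns: "nonsingular_on (potential_space P \<times> UNIV) (DO P c \<phi> I c0 \<phi>0)"
  obtains B where "bij (\<lambda>h. residual_deriv P ((c, c0, I), (\<phi>, \<phi>0)) (0, h))"
    "\<And>h. norm h \<le> B * norm (residual_deriv P ((c, c0, I), (\<phi>, \<phi>0)) (0, h))"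
proof -
  define T where "T h = residual_deriv P ((c, c0, I), (\<phi>, \<phi>0)) (0, h)" for h
  have S: "potential_space P \<times> UNIV = {h. domain_proj P h = h}"
    using domain_proj_eq_iff by auto
  have DO: "DO P c \<phi> I c0 \<phi>0 h = T h" if "domain_proj P h = h" for h
    using that unfolding T_def domain_proj_eq_iff by (rule DO_eq_residual_deriv)
  have "bij_betw (DO P c \<phi> I c0 \<phi>0) {h. domain_proj P h = h} {h. domain_proj P h = h}"
    using ns unfolding nonsingular_on_def S by blast
  then have bij: "bij_betw T {h. domain_proj P h = h} {h. domain_proj P h = h}"
    by (subst (asm) bij_betw_cong[where g=T]) (simp_all add: DO)
  obtain B where B: "\<And>h. domain_proj P h = h \<Longrightarrow> norm h \<le> B * norm (T h)"
    using ns DO unfolding nonsingular_on_def S by fastforce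
  \<comment> \<open>The identity in the scalar slot makes \<open>U\<close> and \<open>U'\<close>
    inverse to each other on the whole type. On the kernel of the projection that slot is zero, and
    \<open>U\<close> agrees with \<open>T\<close>.\<close>
  define U U' :: "unknown \<Rightarrow> unknown"
    where "U h = ((k_eff P *\<^sub>R fst (fst h), sigma_eff P *\<^sub>R snd (fst h)), snd h)"
      and "U' h = (((1 / k_eff P) *\<^sub>R fst (fst h), (1 / sigma_eff P) *\<^sub>R snd (fst h)), snd h)" for h
  have k: "k_eff P \<noteq> 0" "sigma_eff P \<noteq> 0" using P by (auto simp: valid_cell_def)
  have sc: "restrict_line {a..b} (x *\<^sub>R f) = x *\<^sub>R restrict_line {a..b} f" for a b x f
    using linear_scale[OF bounded_linear.linear[OF bounded_linear_restrict_line]] by simp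
  have linT: "bounded_linear T"
    unfolding T_def
    by (intro bounded_linear_compose[OF bounded_linear_residual_deriv[OF P]] bounded_linear_Pair
        bounded_linear_zero bounded_linear_ident)
  have linU': "bounded_linear U'"
    unfolding U'_def
    by (intro bounded_linear_Pair bounded_linear_compose[OF bounded_linear_scaleR_right]
      bounded_linear_compose[OF bounded_linear_fst] bounded_linear_compose[OF bounded_linear_snd]
      bounded_linear_fst bounded_linear_snd)
  show thesis
  proof (rule bij_block_extension[OF linT bounded_linear_domain_proj[of P] linU' domain_proj_idem bij B])
    fix h
    show "T h = U h" if "domain_proj P h = 0"
      using residual_deriv_off_domain[OF that] that by (simp add: T_def U_def domain_proj_def zero_prod_def)
    show "domain_proj P (U h) = 0" "domain_proj P (U' h) = 0" if "domain_proj P h = 0"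
      using that by (simp_all add: U_def U'_def domain_proj_def zero_prod_def sc)
    show "U (U' h) = h" "U' (U h) = h" using k by (simp_all add: U_def U'_def)
  qed (use that in \<open>auto simp: T_def[abs_def]\<close>)
qed

end

section \<open>The local solution and its extension\<close>

theorem theorem2p1:
  fixes P :: cell
    and cs :: state and \<phi>s :: potential and Is c0s \<phi>0s :: real
  assumes "valid_cell P"
    and "cs \<in> state_space P" and "\<phi>s \<in> potential_space P"
    and "constraint_eqs P cs \<phi>s Is c0s \<phi>0s"
    and "nonsingular_on (potential_space P \<times> UNIV) (DO P cs \<phi>s Is c0s \<phi>0s)"
  shows "\<exists>R :: state \<times> real \<times> real \<Rightarrow> potential.
    R ` (state_space P \<times> UNIV \<times> UNIV) \<subseteq> potential_space P \<and>
    R differentiable_on (state_space P \<times> UNIV \<times> UNIV) \<and>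
    (\<exists>A B.
       openin (top_of_set (state_space P \<times> UNIV \<times> UNIV)) A \<and> (cs, c0s, Is) \<in> A \<and>
       openin (top_of_set (potential_space P \<times> UNIV)) B \<and> (\<phi>s, \<phi>0s) \<in> B \<and>
       (\<forall>(c, c0, I)\<in>A. \<exists>!q. q \<in> B \<and> constraint_eqs P c (fst q) I c0 (snd q)) \<and>
       (\<forall>(c, c0, I)\<in>A. \<forall>(\<phi>, \<phi>0)\<in>B.
          constraint_eqs P c \<phi> I c0 \<phi>0 \<longrightarrow> \<phi> = R (c, c0, I)))"
proof -
  note P = assms(1)
  let ?Z = "state_space P \<times> (UNIV :: real set) \<times> (UNIV :: real set)"
    and ?Q = "potential_space P \<times> (UNIV :: real set)"
  define z0 q0 where "z0 = (cs, c0s, Is)" and "q0 = (\<phi>s, \<phi>0s)"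
  obtain C where C:
    "\<And>p h. norm (residual P (p + h) - residual P p - residual_deriv P p h) \<le> C * (norm h)\<^sup>2"
    "\<And>p p' h. norm (residual_deriv P p' h - residual_deriv P p h) \<le> C * norm (p' - p) * norm h"
    by (rule residual_quadratic[OF P]) blast
  obtain B where B: "bij (\<lambda>h. residual_deriv P (z0, q0) (0, h))"
    "\<And>h. norm h \<le> B * norm (residual_deriv P (z0, q0) (0, h))"
    unfolding z0_def q0_def by (rule residual_deriv_bij[OF P assms(5)]) blast
  have zero: "residual P (z0, q0) = 0"
    using assms unfolding z0_def q0_def by (simp add: residual_eq_0_iff)
  obtain r \<rho> Q where r: "0 < r" "0 < \<rho>"
    and Q: "\<And>z. z \<in> ball z0 r \<Longrightarrow> Q z \<in> ball q0 \<rho> \<and> residual P (z, Q z) = 0"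
    and uniq: "\<And>z q. z \<in> ball z0 r \<Longrightarrow> q \<in> ball q0 \<rho> \<Longrightarrow> residual P (z, q) = 0 \<Longrightarrow> q = Q z"
    and diff: "\<And>z. z \<in> ball z0 r \<Longrightarrow> Q differentiable (at z)"
    by (rule implicit_function_quadratic[OF bounded_linear_residual_deriv[OF P] C zero B]) blast
  \<comment> \<open>Zeros on the full type are exactly the solutions in the potential space, so
    existence and uniqueness transfer without further projection.\<close>
  have sol: "residual P ((c, c0, I), q) = 0 \<longleftrightarrow> q \<in> ?Q \<and> constraint_eqs P c (fst q) I c0 (snd q)" for c c0 I q
    using residual_eq_0_iff[OF P, of c c0 I "fst q" "snd q"] by (simp add: mem_Times_iff)
  have "(\<lambda>z. fst (Q z)) differentiable (at z)" if "z \<in> ball z0 r" for z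
    using diff[OF that] unfolding differentiable_def by (blast intro: has_derivative_fst)
  moreover have "fst (Q z) \<in> potential_space P" if "z \<in> ball z0 r" for z
    using Q[OF that] sol[of "fst z" "fst (snd z)" "snd (snd z)" "Q z"] by (simp add: mem_Times_iff)
  ultimately obtain R where R: "\<And>z. R differentiable (at z)" "\<And>z. R z \<in> potential_space P"
    "\<And>z. z \<in> ball z0 (r/2) \<Longrightarrow> R z = fst (Q z)"
    using differentiable_extension[OF r(1), of z0 "\<lambda>z. fst (Q z)" "potential_space P"]
      subspace_potential_space by blast
  \<comment> \<open>Half the radius for the data, where the extension still agrees with the implicit
    function; the full \<rho> for the unknowns, where uniqueness holds.\<close>
  define A' B' where "A' = ?Z \<inter> ball z0 (r/2)" and "B' = ?Q \<inter> ball q0 \<rho>"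
  have sub: "z \<in> ball z0 r" if "z \<in> A'" for z
    using that r subset_ball[of "r/2" r z0] by (auto simp: A'_def)
  have "openin (top_of_set ?Z) A'" "openin (top_of_set ?Q) B'"
    unfolding A'_def B'_def by (auto intro: openin_open_Int)
  moreover have "(cs, c0s, Is) \<in> A'" "(\<phi>s, \<phi>0s) \<in> B'"
    using assms r by (auto simp: A'_def B'_def z0_def q0_def)
  moreover have "\<exists>!q. q \<in> B' \<and> constraint_eqs P c (fst q) I c0 (snd q)" if "(c, c0, I) \<in> A'" for c c0 I
  proof (rule ex1I[of _ "Q (c, c0, I)"])
    show "Q (c, c0, I) \<in> B' \<and> constraint_eqs P c (fst (Q (c, c0, I))) I c0 (snd (Q (c, c0, I)))"
      using Q[OF sub[OF that]] by (simp add: B'_def sol)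
    show "q = Q (c, c0, I)" if "q \<in> B' \<and> constraint_eqs P c (fst q) I c0 (snd q)" for q
      using that uniq[OF sub[OF \<open>(c, c0, I) \<in> A'\<close>], of q] by (simp add: B'_def sol)
  qed
  moreover have "\<phi> = R (c, c0, I)"
    if "(c, c0, I) \<in> A'" "(\<phi>, \<phi>0) \<in> B'" "constraint_eqs P c \<phi> I c0 \<phi>0" for c c0 I \<phi> \<phi>0
  proof -
    have "(\<phi>, \<phi>0) = Q (c, c0, I)"
      using that uniq[OF sub[OF that(1)], of "(\<phi>, \<phi>0)"] by (simp add: B'_def sol)
    then have "\<phi> = fst (Q (c, c0, I))" by (metis fst_conv)
    then show ?thesis using that(1) R(3) by (simp add: A'_def)
  qed
  moreover have "R ` ?Z \<subseteq> potential_space P" using R(2) by blast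
  moreover have "R differentiable_on ?Z"
    unfolding differentiable_on_def using R(1) differentiable_at_withinI by blast
  ultimately show ?thesis
    by (intro exI[of _ R] exI[of _ A'] exI[of _ B'] conjI) blast+
qed

end
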